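(* Let $a<b$ and let $\omega\in\mathcal{S}[a,b]$ be a smooth diagram. Then: (1a) The exterior transition measure of $\omega$ is absolutely continuous on $[a,b]$, with density equal to $$\frac{1}{\pi}\cos\!\left(\frac{\pi\omega'(x)}{2}\right)(x-a)^{-(1+\omega'(x))/2}(b-x)^{-(1-\omega'(x))/2}\exp\left(\frac12\int_a^b\frac{\omega'(u)-\omega'(x)}{u-x}\,du\right).$$ (1b) The interior transition measure of $\omega$ is absolutely continuous on $[a,b]$, with density equal to $$\frac{2}{\pi A(\omega)}\cos\!\left(\frac{\pi\omega'(x)}{2}\right)(x-a)^{(1+\omega'(x))/2}(b-x)^{(1-\omega'(x))/2}\exp\left(-\frac12\int_a^b\frac{\omega'(u)-\omega'(x)}{u-x}\,du\right).$$
   Context: Diagrams. A diagram on $[a,b]$ is a 1-Lipschitz function $\omega:[a,b]\to\mathbb{R}$ with $a+\omega(a)=b-\omega(b)$; its center is $z=z(\omega)=a+\omega(a)$. (Equivalently, $\omega$ is extended to $\mathbb{R}$ by $\omega(x)=|x-z|$ outside $[a,b]$.) $\mathcal{D}[a,b]$ is the set of diagrams on $[a,b]$. The area is $A(\omega)=\int_a^b(\omega(x)-|x-z|)\,dx$. The domain is $D_\omega=\{(x,y):a\le x\le b,\ |x-z|\le y\le\omega(x)\}$ and the dual domain is $D'_\omega=\{(x,y):a\le x\le b,\ \omega(x)\le y\le\min(\omega(a)+x-a,\ \omega(b)+b-x)\}$. Smooth diagrams. $\mathcal{S}[a,b]$ is the set of $\omega\in\mathcal{D}[a,b]$ that are piecewise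 twice continuously differentiable, with $\omega''$ bounded, and such that for some constants $-1<c_1<c_2<1$ one has $c_1<\omega'(x)<c_2$ wherever $\omega'$ is defined. Hooks. The interior hook of $(x,y)\in D_\omega$ is the set of $(x',y')\in D_\omega$ with ($x'\le x$ and $y'-y=x-x'$) or ($x'>x$ and $y'-y=x'-x$). The exterior hook of $(x,y)\in D'_\omega$ is the set of $(x',y')\in D'_\omega$ with ($x'\le x$ and $y-y'=x-x'$) or ($x'>x$ and $y-y'=x'-x$). Hook walks. The exterior (corner) walk is the Markov chain on $D'_\omega$ that starts at $(b-\omega(a),\omega(a)+\omega(b))$ and at each step moves to a point chosen uniformly (by arc length) from the exterior hook of the current point. The interior (uniform) walk is the Markov chain on $D_\omega$ that starts at a point chosen uniformly (by area) in $D_\omega$ and at each step moves to a point chosen uniformly (by arc length) from the interior hook of the current point. Each walk converges almost surely to a point on the graph of $\omega$; the distribution of the $x$-coordinate of the limit point is called the exterior, respectively interior, transition measure of $\omega$. *)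

theory Defs
  imports "HOL-Probability.Probability"
begin

section \<open>Diagrams\<close>

text \<open>
  A diagram on \<open>[a,b]\<close> is represented by a total function \<open>real \<Rightarrow> real\<close> of which only the
  values on \<open>{a..b}\<close> matter. All derivatives below are taken at points of the open interval
  \<open>{a<..<b}\<close>, so they do not depend on the values outside either.
\<close>

definition diagrams :: "real \<Rightarrow> real \<Rightarrow> (real \<Rightarrow> real) set" where
  "diagrams a b = {\<omega>. 1-lipschitz_on {a..b} \<omega> \<and> a + \<omega> a = b - \<omega> b}"

definition diagram_center :: "real \<Rightarrow> (real \<Rightarrow> real) \<Rightarrow> real" where
  "diagram_center a \<omega> = a + \<omega> a"

definition diagram_area :: "real \<Rightarrow> real \<Rightarrow> (real \<Rightarrow> real) \<Rightarrow> real" where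
  "diagram_area a b \<omega> = (LBINT x:{a..b}. \<omega> x - \<bar>x - diagram_center a \<omega>\<bar>)"

definition diagram_domain :: "real \<Rightarrow> real \<Rightarrow> (real \<Rightarrow> real) \<Rightarrow> (real \<times> real) set" where
  "diagram_domain a b \<omega> = {(x, y). a \<le> x \<and> x \<le> b \<and> \<bar>x - diagram_center a \<omega>\<bar> \<le> y \<and> y \<le> \<omega> x}"

definition dual_domain :: "real \<Rightarrow> real \<Rightarrow> (real \<Rightarrow> real) \<Rightarrow> (real \<times> real) set" where
  "dual_domain a b \<omega> =
     {(x, y). a \<le> x \<and> x \<le> b \<and> \<omega> x \<le> y \<and> y \<le> min (\<omega> a + x - a) (\<omega> b + b - x)}"

text \<open>
  Piecewise \<open>C\<^sup>2\<close> with bounded second derivative: away from a finite set \<open>S\<close> of break points,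
  \<open>\<omega>''\<close> exists, is continuous and is bounded (one-sided limits of \<open>\<omega>'\<close> at the break points then
  exist automatically). The slope condition concerns every point where \<open>\<omega>\<close> happens to be
  differentiable, break points included.
\<close>

definition smooth_diagrams :: "real \<Rightarrow> real \<Rightarrow> (real \<Rightarrow> real) set" where
  "smooth_diagrams a b = {\<omega> \<in> diagrams a b.
     (\<exists>S. finite S \<and>
        (\<forall>x\<in>{a<..<b} - S. \<omega> differentiable (at x) \<and> deriv \<omega> differentiable (at x)) \<and>
        continuous_on ({a<..<b} - S) (deriv (deriv \<omega>)) \<and>
        bounded (deriv (deriv \<omega>) ` ({a<..<b} - S))) \<and>
     (\<exists>c1 c2. -1 < c1 \<and> c1 < c2 \<and> c2 < 1 \<and>
        (\<forall>x\<in>{a<..<b}. \<omega> differentiable (at x) \<longrightarrow> c1 < deriv \<omega> x \<and> deriv \<omega> x < c2))}"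


section \<open>Hooks\<close>

definition interior_hook ::
    "real \<Rightarrow> real \<Rightarrow> (real \<Rightarrow> real) \<Rightarrow> real \<times> real \<Rightarrow> (real \<times> real) set" where
  "interior_hook a b \<omega> = (\<lambda>(x, y). {(x', y') \<in> diagram_domain a b \<omega>.
     (x' \<le> x \<and> y' - y = x - x') \<or> (x' > x \<and> y' - y = x' - x)})"

definition exterior_hook ::
    "real \<Rightarrow> real \<Rightarrow> (real \<Rightarrow> real) \<Rightarrow> real \<times> real \<Rightarrow> (real \<times> real) set" where
  "exterior_hook a b \<omega> = (\<lambda>(x, y). {(x', y') \<in> dual_domain a b \<omega>.
     (x' \<le> x \<and> y - y' = x - x') \<or> (x' > x \<and> y - y' = x' - x)})"

text \<open>
  The two rays through \<open>p\<close> that carry the hook of \<open>p\<close>, jointly parametrised by signed arc length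
  (\<open>t < 0\<close> on the left arm, \<open>t > 0\<close> on the right arm). The sign \<open>\<sigma>\<close> is \<open>1\<close> for interior
  (upward) hooks and \<open>-1\<close> for exterior (downward) hooks.
\<close>

definition hook_arc :: "real \<Rightarrow> real \<times> real \<Rightarrow> real \<Rightarrow> real \<times> real" where
  "hook_arc \<sigma> p t = (fst p + t / sqrt 2, snd p + \<sigma> * \<bar>t\<bar> / sqrt 2)"

text \<open>
  The uniform distribution with respect to arc length on the part \<open>H\<close> of these rays. If \<open>H\<close> has
  length \<open>0\<close>, as it has for \<open>p\<close> on the graph of a smooth diagram, the walk stays at \<open>p\<close>.
\<close>

definition uniform_on_hook ::
    "real \<Rightarrow> real \<times> real \<Rightarrow> (real \<times> real) set \<Rightarrow> (real \<times> real) measure" where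
  "uniform_on_hook \<sigma> p H =
     (if emeasure lborel {t. hook_arc \<sigma> p t \<in> H} = 0 then return borel p
      else distr (uniform_measure lborel {t. hook_arc \<sigma> p t \<in> H}) borel (hook_arc \<sigma> p))"

definition interior_step ::
    "real \<Rightarrow> real \<Rightarrow> (real \<Rightarrow> real) \<Rightarrow> real \<times> real \<Rightarrow> (real \<times> real) measure" where
  "interior_step a b \<omega> p = uniform_on_hook 1 p (interior_hook a b \<omega> p)"

definition exterior_step ::
    "real \<Rightarrow> real \<Rightarrow> (real \<Rightarrow> real) \<Rightarrow> real \<times> real \<Rightarrow> (real \<times> real) measure" where
  "exterior_step a b \<omega> p = uniform_on_hook (-1) p (exterior_hook a b \<omega> p)"


section \<open>Markov chains and hook walks\<close>

text \<open>
  The law on trajectories of the time-homogeneous Markov chain with state space \<open>M\<close>, initial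
  distribution \<open>\<mu>\<close> and transition kernel \<open>K\<close>, given by the Ionescu-Tulcea theorem; see
  \<open>chain_law_Suc\<close> below.
\<close>

definition chain_kernel ::
    "'a measure \<Rightarrow> ('a \<Rightarrow> 'a measure) \<Rightarrow> nat \<Rightarrow> (nat \<Rightarrow> 'a) \<Rightarrow> 'a measure" where
  "chain_kernel \<mu> K n w = (case n of 0 \<Rightarrow> \<mu> | Suc m \<Rightarrow> K (w m))"

definition chain_law ::
    "'a measure \<Rightarrow> 'a measure \<Rightarrow> ('a \<Rightarrow> 'a measure) \<Rightarrow> (nat \<Rightarrow> 'a) measure" where
  "chain_law M \<mu> K =
     projective_family.lim UNIV (Ionescu_Tulcea.CI (chain_kernel \<mu> K) (\<lambda>_. M)) (\<lambda>_. M)"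

definition exterior_walk ::
    "real \<Rightarrow> real \<Rightarrow> (real \<Rightarrow> real) \<Rightarrow> (nat \<Rightarrow> real \<times> real) measure" where
  "exterior_walk a b \<omega> =
     chain_law borel (return borel (b - \<omega> a, \<omega> a + \<omega> b)) (exterior_step a b \<omega>)"

definition interior_walk ::
    "real \<Rightarrow> real \<Rightarrow> (real \<Rightarrow> real) \<Rightarrow> (nat \<Rightarrow> real \<times> real) measure" where
  "interior_walk a b \<omega> =
     chain_law borel (uniform_measure lborel (diagram_domain a b \<omega>)) (interior_step a b \<omega>)"

definition exterior_transition_measure ::
    "real \<Rightarrow> real \<Rightarrow> (real \<Rightarrow> real) \<Rightarrow> real measure" where
  "exterior_transition_measure a b \<omega> = distr (exterior_walk a b \<omega>) borel (\<lambda>X. fst (lim X))"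

definition interior_transition_measure ::
    "real \<Rightarrow> real \<Rightarrow> (real \<Rightarrow> real) \<Rightarrow> real measure" where
  "interior_transition_measure a b \<omega> = distr (interior_walk a b \<omega>) borel (\<lambda>X. fst (lim X))"

definition has_density_on :: "real measure \<Rightarrow> real set \<Rightarrow> (real \<Rightarrow> real) \<Rightarrow> bool" where
  "has_density_on \<nu> A f \<longleftrightarrow>
     absolutely_continuous lborel \<nu> \<and>
     set_borel_measurable lborel A f \<and>
     \<nu> = density lborel (\<lambda>x. ennreal (f x) * indicator A x)"


section \<open>The hook walks are Markov chains\<close>

lemma Ionescu_Tulcea_chain_kernel:
  assumes \<mu>: "\<mu> \<in> space (prob_algebra M)" and K[measurable]: "K \<in> M \<rightarrow>\<^sub>M prob_algebra M"
  shows "Ionescu_Tulcea (chain_kernel \<mu> K) (\<lambda>_. M)"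
proof -
  have kernel: "chain_kernel \<mu> K i \<in> PiM {0..<i} (\<lambda>_. M) \<rightarrow>\<^sub>M prob_algebra M" for i
  proof (cases i)
    case 0
    then show ?thesis using \<mu> by (simp add: chain_kernel_def[abs_def])
  next
    case (Suc m)
    have "(\<lambda>w. w m) \<in> PiM {0..<i} (\<lambda>_. M) \<rightarrow>\<^sub>M M"
      using Suc by (intro measurable_component_singleton) auto
    then have "(\<lambda>w. K (w m)) \<in> PiM {0..<i} (\<lambda>_. M) \<rightarrow>\<^sub>M prob_algebra M"
      by measurable
    then show ?thesis using Suc by (simp add: chain_kernel_def[abs_def])
  qed
  show ?thesis
  proof (rule Ionescu_Tulcea.intro)
    show "chain_kernel \<mu> K i \<in> PiM {0..<i} (\<lambda>_. M) \<rightarrow>\<^sub>M subprob_algebra M" for i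
      by (rule measurable_prob_algebraD[OF kernel])
    show "prob_space (chain_kernel \<mu> K i x)" if "x \<in> space (PiM {0..<i} (\<lambda>_. M))" for i x
      using measurable_space[OF kernel that] by (simp add: space_prob_algebra)
  qed
qed

lemma sets_chain_law:
  assumes "\<mu> \<in> space (prob_algebra M)" "K \<in> M \<rightarrow>\<^sub>M prob_algebra M"
  shows "sets (chain_law M \<mu> K) = sets (PiM UNIV (\<lambda>_. M))"
proof -
  interpret Ionescu_Tulcea "chain_kernel \<mu> K" "\<lambda>_. M"
    by (rule Ionescu_Tulcea_chain_kernel) fact+
  show ?thesis by (simp add: chain_law_def)
qed

lemma chain_law_Suc:
  assumes \<mu>: "\<mu> \<in> space (prob_algebra M)" and K: "K \<in> M \<rightarrow>\<^sub>M prob_algebra M"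
  defines "first n \<equiv>
    distr (chain_law M \<mu> K) (PiM {0..<n} (\<lambda>_. M)) (\<lambda>w. restrict w {0..<n})"
  shows "first 0 = return (PiM {} (\<lambda>_. M)) (\<lambda>_. undefined)"
    and "first (Suc n) =
      first n \<bind> (\<lambda>w. distr (chain_kernel \<mu> K n w) (PiM {0..<Suc n} (\<lambda>_. M)) (fun_upd w n))"
proof -
  interpret Ionescu_Tulcea "chain_kernel \<mu> K" "\<lambda>_. M"
    by (rule Ionescu_Tulcea_chain_kernel) fact+
  have first: "first n = C 0 n (\<lambda>_. undefined)" for n
  proof -
    have "up_to {0..<n} = n"
      unfolding up_to_def by (rule Least_equality) (auto simp: not_less[symmetric])
    then show ?thesis
      unfolding first_def chain_law_def
      using distr_C[of n n "\<lambda>_. undefined" 0]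
      by (simp add: distr_lim CI_def)
  qed
  show "first 0 = return (PiM {} (\<lambda>_. M)) (\<lambda>_. undefined)"
    by (simp add: first)
  show "first (Suc n) =
      first n \<bind> (\<lambda>w. distr (chain_kernel \<mu> K n w) (PiM {0..<Suc n} (\<lambda>_. M)) (fun_upd w n))"
    by (simp add: first eP_def[abs_def])
qed

lemma uniform_on_hook_measurable:
  fixes H :: "real \<times> real \<Rightarrow> (real \<times> real) set"
  assumes [measurable]: "Measurable.pred (borel \<Otimes>\<^sub>M borel) (\<lambda>(p, t). hook_arc \<sigma> p t \<in> H p)"
    and H: "\<And>p. fst ` H p \<subseteq> {a..b}"
  shows "(\<lambda>p. uniform_on_hook \<sigma> p (H p)) \<in> borel \<rightarrow>\<^sub>M prob_algebra borel"
proof -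
  define T where "T p = {t. hook_arc \<sigma> p t \<in> H p}" for p
  define Q where "Q = {(p, t). hook_arc \<sigma> p t \<in> H p}"
  have arc[measurable]: "(\<lambda>(p, t). hook_arc \<sigma> p t) \<in> borel \<Otimes>\<^sub>M borel \<rightarrow>\<^sub>M borel"
    unfolding hook_arc_def[abs_def] borel_prod[symmetric] by measurable
  have arc1[measurable]: "hook_arc \<sigma> p \<in> borel \<rightarrow>\<^sub>M borel" for p
    using measurable_Pair2[OF arc, of p] by simp
  have Q: "Q \<in> sets (borel \<Otimes>\<^sub>M lborel)"
  proof -
    have "{x \<in> space (borel \<Otimes>\<^sub>M borel). (\<lambda>(p, t). hook_arc \<sigma> p t \<in> H p) x} \<in> sets (borel \<Otimes>\<^sub>M borel)"
      by (rule predE) fact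
    then show ?thesis
      by (simp add: Q_def space_pair_measure cong: sets_pair_measure_cong)
  qed
  have TQ: "T p = Pair p -` Q" for p
    by (auto simp: T_def Q_def)
  have T[measurable]: "T p \<in> sets borel" for p
    using sets_Pair1[OF Q, of p] by (simp add: TQ)
  have eT[measurable]: "(\<lambda>p. emeasure lborel (T p)) \<in> borel_measurable borel"
    unfolding TQ by (rule lborel.measurable_emeasure_Pair[OF Q])
  have fin: "emeasure lborel (T p) \<noteq> \<infinity>" for p
  proof -
    have "T p \<subseteq> {(a - fst p) * sqrt 2 .. (b - fst p) * sqrt 2}"
    proof
      fix t assume "t \<in> T p"
      then have "fst (hook_arc \<sigma> p t) \<in> {a..b}"
        using H[of p] by (auto simp: T_def)
      then show "t \<in> {(a - fst p) * sqrt 2 .. (b - fst p) * sqrt 2}"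
        by (auto simp: hook_arc_def field_simps)
    qed
    then have "emeasure lborel (T p) \<le> emeasure lborel {(a - fst p) * sqrt 2 .. (b - fst p) * sqrt 2}"
      by (intro emeasure_mono) auto
    also have "\<dots> < \<infinity>"
      by (simp add: emeasure_lborel_Icc_eq)
    finally show ?thesis by simp
  qed
  have prob: "prob_space (uniform_on_hook \<sigma> p (H p))" for p
    unfolding uniform_on_hook_def T_def[symmetric]
    using fin[of p]
    by (auto intro!: prob_space_return prob_space.prob_space_distr prob_space_uniform_measure)
  have sets: "sets (uniform_on_hook \<sigma> p (H p)) = sets borel" for p
    by (simp add: uniform_on_hook_def)
  have em: "emeasure (uniform_on_hook \<sigma> p (H p)) A =
      (if emeasure lborel (T p) = 0 then indicator A p
       else emeasure lborel (T p \<inter> hook_arc \<sigma> p -` A) / emeasure lborel (T p))"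
    if [measurable]: "A \<in> sets borel" for p A
    using measurable_sets[OF arc1 that, of p]
    by (simp add: uniform_on_hook_def T_def[symmetric] emeasure_distr)
  have "(\<lambda>p. uniform_on_hook \<sigma> p (H p)) \<in> borel \<rightarrow>\<^sub>M subprob_algebra borel"
  proof (rule measurable_subprob_algebra)
    fix A :: "(real \<times> real) set" assume A[measurable]: "A \<in> sets borel"
    have "Q \<inter> ((\<lambda>(p, t). hook_arc \<sigma> p t) -` A \<inter> space (borel \<Otimes>\<^sub>M borel)) \<in> sets (borel \<Otimes>\<^sub>M lborel)"
      using measurable_sets[OF arc A] Q by (auto cong: sets_pair_measure_cong)
    then have "(\<lambda>p. emeasure lborel (Pair p -` (Q \<inter> ((\<lambda>(p, t). hook_arc \<sigma> p t) -` A \<inter>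
        space (borel \<Otimes>\<^sub>M borel))))) \<in> borel_measurable borel"
      by (rule lborel.measurable_emeasure_Pair)
    moreover have "Pair p -` (Q \<inter> ((\<lambda>(p, t). hook_arc \<sigma> p t) -` A \<inter> space (borel \<Otimes>\<^sub>M borel))) =
        T p \<inter> hook_arc \<sigma> p -` A" for p
      by (auto simp: TQ space_pair_measure)
    ultimately have [measurable]:
      "(\<lambda>p. emeasure lborel (T p \<inter> hook_arc \<sigma> p -` A)) \<in> borel_measurable borel"
      by simp
    show "(\<lambda>p. emeasure (uniform_on_hook \<sigma> p (H p)) A) \<in> borel_measurable borel"
      unfolding em[OF A] by measurable
  qed (use prob sets in \<open>auto intro: prob_space_imp_subprob_space\<close>)
  then show ?thesis
    by (intro measurable_prob_algebraI prob)
qed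

lemma diagrams_continuous_on: "\<omega> \<in> diagrams a b \<Longrightarrow> continuous_on {a..b} \<omega>"
  by (auto simp: diagrams_def intro: lipschitz_on_continuous_on)

lemma diagram_domain_closed:
  assumes "\<omega> \<in> diagrams a b"
  shows "closed (diagram_domain a b \<omega>)"
proof -
  have c: "continuous_on ({a..b} \<times> UNIV) (\<lambda>p::real \<times> real. \<omega> (fst p))"
    by (rule continuous_on_compose2[OF diagrams_continuous_on[OF assms]])
       (auto intro: continuous_intros)
  have "closed {p \<in> {a..b} \<times> UNIV. \<bar>fst p - diagram_center a \<omega>\<bar> \<le> snd p}"
    by (rule continuous_on_closed_Collect_le)
       (auto intro!: continuous_intros closed_Times)
  moreover have "closed {p \<in> {a..b} \<times> UNIV. snd p \<le> \<omega> (fst p)}"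
    by (rule continuous_on_closed_Collect_le) (auto intro!: continuous_intros c closed_Times)
  ultimately have "closed ({p \<in> {a..b} \<times> UNIV. \<bar>fst p - diagram_center a \<omega>\<bar> \<le> snd p} \<inter>
      {p \<in> {a..b} \<times> UNIV. snd p \<le> \<omega> (fst p)})"
    by (rule closed_Int)
  also have "\<dots> = diagram_domain a b \<omega>"
    by (auto simp: diagram_domain_def)
  finally show ?thesis .
qed

lemma dual_domain_closed:
  assumes "\<omega> \<in> diagrams a b"
  shows "closed (dual_domain a b \<omega>)"
proof -
  have c: "continuous_on ({a..b} \<times> UNIV) (\<lambda>p::real \<times> real. \<omega> (fst p))"
    by (rule continuous_on_compose2[OF diagrams_continuous_on[OF assms]])
       (auto intro: continuous_intros)
  have "closed {p \<in> {a..b} \<times> UNIV. snd p \<le> min (\<omega> a + fst p - a) (\<omega> b + b - fst p)}"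
    by (rule continuous_on_closed_Collect_le)
       (auto intro!: continuous_intros closed_Times)
  moreover have "closed {p \<in> {a..b} \<times> UNIV. \<omega> (fst p) \<le> snd p}"
    by (rule continuous_on_closed_Collect_le) (auto intro!: continuous_intros c closed_Times)
  ultimately have "closed ({p \<in> {a..b} \<times> UNIV. snd p \<le> min (\<omega> a + fst p - a) (\<omega> b + b - fst p)} \<inter>
      {p \<in> {a..b} \<times> UNIV. \<omega> (fst p) \<le> snd p})"
    by (rule closed_Int)
  also have "\<dots> = dual_domain a b \<omega>"
    by (auto simp: dual_domain_def)
  finally show ?thesis .
qed

lemma hook_arc_in_interior_hook_iff:
  "hook_arc 1 p t \<in> interior_hook a b \<omega> p \<longleftrightarrow> hook_arc 1 p t \<in> diagram_domain a b \<omega>"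
  by (cases "t \<le> 0") (auto simp: hook_arc_def interior_hook_def field_simps split: prod.splits)

lemma hook_arc_in_exterior_hook_iff:
  "hook_arc (-1) p t \<in> exterior_hook a b \<omega> p \<longleftrightarrow> hook_arc (-1) p t \<in> dual_domain a b \<omega>"
  by (cases "t \<le> 0") (auto simp: hook_arc_def exterior_hook_def field_simps split: prod.splits)

lemma pred_hook_arc:
  assumes "closed D"
  shows "Measurable.pred (borel \<Otimes>\<^sub>M borel) (\<lambda>(p, t). hook_arc \<sigma> p t \<in> D)"
proof -
  have [measurable]: "(\<lambda>(p, t). hook_arc \<sigma> p t) \<in> borel \<Otimes>\<^sub>M borel \<rightarrow>\<^sub>M borel"
    unfolding hook_arc_def[abs_def] borel_prod[symmetric] by measurable
  have [measurable]: "D \<in> sets borel" using assms by auto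
  have "Measurable.pred (borel \<Otimes>\<^sub>M borel) (\<lambda>x. (case x of (p, t) \<Rightarrow> hook_arc \<sigma> p t) \<in> D)"
    by measurable
  then show ?thesis by (simp add: case_prod_beta)
qed

lemma interior_step_measurable:
  assumes "\<omega> \<in> diagrams a b"
  shows "interior_step a b \<omega> \<in> borel \<rightarrow>\<^sub>M prob_algebra borel"
  unfolding interior_step_def[abs_def]
proof (rule uniform_on_hook_measurable)
  show "fst ` interior_hook a b \<omega> p \<subseteq> {a..b}" for p
    by (auto simp: interior_hook_def diagram_domain_def split: prod.splits)
qed (use pred_hook_arc[OF diagram_domain_closed[OF assms], of 1] in
    \<open>simp add: hook_arc_in_interior_hook_iff\<close>)

lemma exterior_step_measurable:
  assumes "\<omega> \<in> diagrams a b"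
  shows "exterior_step a b \<omega> \<in> borel \<rightarrow>\<^sub>M prob_algebra borel"
  unfolding exterior_step_def[abs_def]
proof (rule uniform_on_hook_measurable)
  show "fst ` exterior_hook a b \<omega> p \<subseteq> {a..b}" for p
    by (auto simp: exterior_hook_def dual_domain_def split: prod.splits)
qed (use pred_hook_arc[OF dual_domain_closed[OF assms], of "-1"] in
    \<open>simp add: hook_arc_in_exterior_hook_iff\<close>)

end

theory Submission
  imports Defs
begin

text \<open>
  A point of the domain is determined by the abscissas \<open>s \<le> t\<close> at which the two arms of its hook
  meet the graph. In these coordinates one step of a walk chooses \<open>u\<close> uniformly in \<open>[s, t]\<close> and then
  replaces \<open>[s, t]\<close> by \<open>[s, u]\<close> with probability \<open>p u\<close> and by \<open>[u, t]\<close> with probability \<open>1 - p u\<close>,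
  where \<open>p = (1 + \<omega>') / 2\<close> for the exterior walk and \<open>p = (1 - \<omega>') / 2\<close> for the interior walk. The
  density \<open>f\<^bsub>s,t\<^esub>\<close> claimed for the exterior walk started from \<open>[s, t]\<close> splits, at a fixed \<open>x\<close>, into a
  factor \<open>G (x - s)\<close> and a factor \<open>H (t - x)\<close> with \<open>(d G(d))' = (1 - p(x - d)) G(d)\<close> and
  \<open>(d H(d))' = p(x + d) H(d)\<close>. Integrating these two identities gives
  \<open>(t - s) f\<^bsub>s,t\<^esub> = \<integral> p(u) f\<^bsub>s,u\<^esub> + (1 - p(u)) f\<^bsub>u,t\<^esub> du\<close>: the density is harmonic for the walk.

  Its total mass is therefore harmonic too. On short intervals without break points it is close to
  \<open>1\<close> by comparison with the Beta integral and the reflection formula, and since a step contracts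
  the expected length and the expected number of break points, the mass is \<open>1\<close> everywhere. The mass
  given to an open set is a bounded harmonic function which is \<open>1\<close> on intervals contained in the set,
  so Fatou's lemma along the walk identifies the distribution of the limit. The interior density
  is the average of \<open>f\<^bsub>s,t\<^esub>\<close> over the starting point, and the same two identities evaluate it.
\<close>

section \<open>The harmonic density\<close>

text \<open>Harmonicity determines the density only up to a factor depending on \<open>x\<close>, so
  \<open>sin (pi * p x) / pi\<close> has to come from the boundary: on a short interval where
  \<open>p\<close> is almost constant, the density is almost that of the Beta law with parameters
  \<open>1 - p\<close> and \<open>p\<close>, whose normalising constant is
  \<open>pi / sin (pi * p)\<close>. The obstacle is a break point. An interval around it, however
  short, does not resemble the constant case, and there the mass is at first only known to be
  bounded. Such intervals are rare along the walk, however: a given break point stays inside the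
  current interval with probability at most \<open>1 - \<delta>\<close> per step. Hence break points
  are counted alongside the length when smallness is propagated. A sign \<open>\<sigma>\<close>
  covers both walks, since reflection in the horizontal axis exchanges the two kinds of hooks and
  the sign of the slope; only the starting laws differ.\<close>

text \<open>Up to a factor, the solution of \<open>(d * G d)' = k d * G d\<close>. Splitting off the
  power with exponent \<open>k 0 - 1\<close> leaves a bounded integrand near 0. At
  \<open>d = 0\<close> the value is 0 because \<open>0 powr _ = 0\<close>, which later allows end
  points to be added to or removed from intervals of integration.\<close>

definition arm :: "(real \<Rightarrow> real) \<Rightarrow> real \<Rightarrow> real" where
  "arm k d = d powr (k 0 - 1) * exp (LBINT v:{0..d}. (k v - k 0) / v)"

lemma arm_nonneg: "0 \<le> arm k d"
  by (simp add: arm_def)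

text \<open>\<open>p u\<close> is the probability of keeping the left part \<open>[s, u]\<close>. It
  is given on the whole line, so that translation and reflection stay inside the locale. The bound
  \<open>\<delta>\<close> yields integrable singularities and the contraction of the walk;
  \<open>L\<close> will come from the bound on the second derivative between break points.\<close>

locale splitting =
  fixes p :: "real \<Rightarrow> real" and S :: "real set" and \<delta> L :: real
  assumes finite_S: "finite S" and delta_pos: "0 < \<delta>" and L_nonneg: "0 \<le> L"
    and p_ge: "\<And>u. \<delta> \<le> p u" and p_le: "\<And>u. p u \<le> 1 - \<delta>"
    and p_Lipschitz: "\<And>x y. x \<le> y \<Longrightarrow> {x..y} \<inter> S = {} \<Longrightarrow> \<bar>p y - p x\<bar> \<le> L * (y - x)"
begin

lemma p_pos: "0 < p u" and p_less_1: "p u < 1"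
  using p_ge[of u] p_le[of u] delta_pos by linarith+

lemma p_diff_le_1: "\<bar>p x - p y\<bar> \<le> 1"
  using p_pos[of x] p_pos[of y] p_less_1[of x] p_less_1[of y] by (simp add: abs_if)

lemma ball_avoiding_breaks:
  assumes "x \<notin> S"
  obtains e where "0 < e" "{x - e..x + e} \<inter> S = {}"
proof -
  obtain d where "0 < d" "\<forall>y\<in>S. y \<noteq> x \<longrightarrow> d \<le> dist x y"
    using finite_set_avoid[OF finite_S, of x] by auto
  then have "0 < d / 2" "{x - d / 2..x + d / 2} \<inter> S = {}"
    using assms by (auto simp: dist_real_def abs_if split: if_splits)
  then show ?thesis by (rule that)
qed

lemma p_local_Lipschitz:
  assumes "x \<notin> S"
  obtains e where "0 < e" "\<And>y. \<bar>y - x\<bar> \<le> e \<Longrightarrow> \<bar>p y - p x\<bar> \<le> L * \<bar>y - x\<bar>"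
proof -
  obtain e where e: "0 < e" "{x - e..x + e} \<inter> S = {}"
    using ball_avoiding_breaks[OF assms] .
  have "\<bar>p y - p x\<bar> \<le> L * \<bar>y - x\<bar>" if "\<bar>y - x\<bar> \<le> e" for y
  proof (cases "x \<le> y")
    case True
    then have "{x..y} \<subseteq> {x - e..x + e}" using that e(1) by auto
    then have "{x..y} \<inter> S = {}" using e(2) by blast
    then show ?thesis using p_Lipschitz[of x y] True by simp
  next
    case False
    then have "{y..x} \<subseteq> {x - e..x + e}" using that e(1) by auto
    then have "{y..x} \<inter> S = {}" using e(2) by blast
    then show ?thesis using p_Lipschitz[of y x] False by (simp add: abs_minus_commute)
  qed
  with e(1) show ?thesis by (rule that)
qed

lemma isCont_p:
  assumes "x \<notin> S"
  shows "isCont p x"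
proof -
  obtain e where e: "0 < e" "\<And>y. \<bar>y - x\<bar> \<le> e \<Longrightarrow> \<bar>p y - p x\<bar> \<le> L * \<bar>y - x\<bar>"
    using p_local_Lipschitz[OF assms] by blast
  have "((\<lambda>y. p y - p x) \<longlongrightarrow> 0) (at x)"
  proof (rule Lim_null_comparison)
    show "\<forall>\<^sub>F y in at x. norm (p y - p x) \<le> L * \<bar>y - x\<bar>"
      using e by (auto simp: eventually_at dist_real_def intro!: exI[of _ e])
    show "((\<lambda>y. L * \<bar>y - x\<bar>) \<longlongrightarrow> 0) (at x)"
      by (auto intro!: tendsto_eq_intros)
  qed
  then show ?thesis by (simp add: isCont_def LIM_zero_iff)
qed

lemma p_measurable[measurable]: "p \<in> borel_measurable borel"
proof -
  have "open (- S)" using finite_S by (simp add: finite_imp_closed open_Compl)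
  moreover have "continuous_on (- S) p"
    using isCont_p by (auto intro: continuous_at_imp_continuous_on)
  ultimately have "(\<lambda>x. indicator (- S) x *\<^sub>R p x) \<in> borel_measurable borel"
    by (intro borel_measurable_continuous_on_indicator) auto
  then show ?thesis
    by (rule measurable_discrete_difference[where X = S]) (auto simp: finite_S countable_finite)
qed

lemma arm_integral_measurable[measurable]:
  "(\<lambda>d. LBINT v:{0..d}. (p v - p 0) / v) \<in> borel_measurable borel"
proof -
  have "(\<lambda>d. \<integral>v. (if 0 \<le> v \<and> v \<le> d then (p v - p 0) / v else 0) \<partial>lborel) \<in> borel_measurable borel"
    by measurable
  also have "(\<lambda>d. \<integral>v. (if 0 \<le> v \<and> v \<le> d then (p v - p 0) / v else 0) \<partial>lborel) =
      (\<lambda>d. LBINT v:{0..d}. (p v - p 0) / v)"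
    unfolding set_lebesgue_integral_def by (intro ext Bochner_Integration.integral_cong) auto
  finally show ?thesis .
qed

lemma arm_measurable[measurable]: "arm p \<in> borel_measurable borel"
  unfolding arm_def[abs_def] by measurable

context
  assumes zero_notin_S: "0 \<notin> S"
begin

text \<open>Near 0 the Lipschitz condition bounds the quotient by \<open>L\<close>; beyond the
  distance \<open>e\<close> the numerator is at most 1. At \<open>v = 0\<close> the quotient is
  \<open>0 / 0 = 0\<close>.\<close>

lemma diff_quotient_bounded:
  obtains M where "\<And>v. 0 \<le> v \<Longrightarrow> \<bar>(p v - p 0) / v\<bar> \<le> M"
proof -
  obtain e where e: "0 < e" "\<And>y. \<bar>y\<bar> \<le> e \<Longrightarrow> \<bar>p y - p 0\<bar> \<le> L * \<bar>y\<bar>"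
    using p_local_Lipschitz[OF zero_notin_S] by auto
  have "\<bar>(p v - p 0) / v\<bar> \<le> L + 1 / e" if "0 \<le> v" for v
  proof (cases "v \<le> e")
    case True
    then have "\<bar>(p v - p 0) / v\<bar> \<le> L"
      using e(2)[of v] that L_nonneg by (cases "v = 0") (auto simp: field_simps abs_if)
    then show ?thesis using e(1) by (simp add: add_increasing2)
  next
    case False
    have "\<bar>(p v - p 0) / v\<bar> = \<bar>p v - p 0\<bar> / v" using False e(1) by simp
    also have "\<dots> \<le> 1 / e" using False e(1) p_diff_le_1[of v 0] by (intro frac_le) auto
    finally show ?thesis using L_nonneg by simp
  qed
  then show ?thesis by (rule that)
qed

lemma diff_quotient_integrable:
  "set_integrable lborel {0..d} (\<lambda>v. (p v - p 0) / v)"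
proof -
  obtain M where "\<And>v. 0 \<le> v \<Longrightarrow> \<bar>(p v - p 0) / v\<bar> \<le> M"
    using diff_quotient_bounded by blast
  then show ?thesis unfolding set_integrable_def
    by (intro integrableI_bounded_set_indicator[where B = M]) (auto simp: emeasure_lborel_Icc_eq)
qed

lemma diff_quotient_integral_eq:
  "(LBINT v:{0..d}. (p v - p 0) / v) = integral {0..d} (\<lambda>v. (p v - p 0) / v)"
  by (rule set_borel_integral_eq_integral(2)[OF diff_quotient_integrable])

lemma diff_quotient_integral_continuous:
  "continuous_on {0..D} (\<lambda>d. LBINT v:{0..d}. (p v - p 0) / v)"
  unfolding diff_quotient_integral_eq
  by (rule indefinite_integral_continuous_1)
     (rule set_borel_integral_eq_integral(1)[OF diff_quotient_integrable])

lemma diff_quotient_integral_deriv: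
  assumes "0 < d" "d \<notin> S"
  shows "((\<lambda>d. LBINT v:{0..d}. (p v - p 0) / v) has_real_derivative (p d - p 0) / d) (at d)"
proof -
  \<comment> \<open>The interval extends to \<open>d + 1\<close> so that \<open>d\<close> is an
    interior point and the restricted filter is \<open>at d\<close>.\<close>
  have "((\<lambda>u. integral {0..u} (\<lambda>v. (p v - p 0) / v)) has_vector_derivative (p d - p 0) / d)
      (at d within ({0..d + 1} - {}))"
  proof (rule integral_has_vector_derivative_continuous_at)
    show "(\<lambda>v. (p v - p 0) / v) integrable_on {0..d + 1}"
      by (rule set_borel_integral_eq_integral(1)[OF diff_quotient_integrable])
    show "continuous (at d within ({0..d + 1} - {})) (\<lambda>v. (p v - p 0) / v)"
      using assms
      by (intro continuous_at_imp_continuous_at_within[where s = "{0..d + 1} - {}"] isCont_divide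
          isCont_diff isCont_p continuous_const continuous_ident) auto
    show "d \<in> {0..d + 1} - {}" using assms by simp
  qed simp
  moreover have "at d within ({0..d + 1} - {}) = at d"
    using assms by (simp add: at_within_Icc_at)
  ultimately show ?thesis
    by (simp add: has_real_derivative_iff_has_vector_derivative diff_quotient_integral_eq)
qed

text \<open>The logarithmic derivative is \<open>(p 0 - 1) / d\<close> from the power plus
  \<open>(p d - p 0) / d\<close> from the exponential.\<close>

lemma arm_deriv:
  assumes "0 < d" "d \<notin> S"
  shows "(arm p has_real_derivative (p d - 1) / d * arm p d) (at d)"
proof -
  have "((\<lambda>d. d powr (p 0 - 1) * exp (LBINT v:{0..d}. (p v - p 0) / v)) has_real_derivative
      (p d - 1) / d * arm p d) (at d)"
    by (rule derivative_eq_intros diff_quotient_integral_deriv refl assms)+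
       (use assms in \<open>simp add: arm_def powr_diff field_simps power2_eq_square\<close>)
  then show ?thesis by (simp add: arm_def[abs_def])
qed

lemma mult_arm: "0 \<le> d \<Longrightarrow> d * arm p d = d powr p 0 * exp (LBINT v:{0..d}. (p v - p 0) / v)"
  by (cases "d = 0") (auto simp: arm_def powr_diff)

text \<open>The logarithmic derivative of \<open>d * arm p d\<close> is \<open>p d / d\<close>.\<close>

lemma nn_integral_arm:
  assumes "0 \<le> d"
  shows "(\<integral>\<^sup>+v. ennreal (p v * arm p v) * indicator {0..d} v \<partial>lborel) = ennreal (d * arm p d)"
proof -
  define D where "D = (\<lambda>d. d powr p 0 * exp (LBINT v:{0..d}. (p v - p 0) / v))"
  have deriv: "(D has_real_derivative p x * arm p x) (at x)" if "0 < x" "x \<notin> S" for x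
    unfolding D_def
    by (rule derivative_eq_intros diff_quotient_integral_deriv refl that)+
       (use that in \<open>simp add: arm_def powr_diff field_simps\<close>)
  have "((\<lambda>v. p v * arm p v) has_integral (D d - D 0)) {0..d}"
  proof (rule fundamental_theorem_of_calculus_interior_strong[OF finite_S assms])
    show "(D has_vector_derivative p x * arm p x) (at x)" if "x \<in> {0<..<d} - S" for x
      using deriv[of x] that by (simp add: has_real_derivative_iff_has_vector_derivative)
    show "continuous_on {0..d} D" unfolding D_def
      using p_pos[of 0]
      by (intro continuous_intros diff_quotient_integral_continuous continuous_on_powr') auto
  qed
  then have "((\<lambda>v. indicator {0..d} v * (p v * arm p v)) has_integral (D d - D 0)) UNIV"
    unfolding has_integral_restrict_UNIV[of "{0..d}", symmetric]
    by (rule has_integral_eq[rotated]) (simp add: indicator_def)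
  then have "(\<integral>\<^sup>+v. ennreal (indicator {0..d} v * (p v * arm p v)) \<partial>lborel) = ennreal (D d - D 0)"
    using less_imp_le[OF p_pos] by (intro nn_integral_has_integral_lborel) (auto simp: arm_nonneg)
  moreover have "(\<integral>\<^sup>+v. ennreal (indicator {0..d} v * (p v * arm p v)) \<partial>lborel) =
      (\<integral>\<^sup>+v. ennreal (p v * arm p v) * indicator {0..d} v \<partial>lborel)"
    by (intro nn_integral_cong) (simp add: indicator_def)
  moreover have "D 0 = 0" "D d = d * arm p d"
    using mult_arm[OF assms] by (auto simp: D_def)
  ultimately show ?thesis by simp
qed

text \<open>As \<open>p < 1\<close>, the derivative is not positive off the break points, and
  continuity carries the decrease across them.\<close>

lemma arm_antimono:
  assumes "0 < d" "d \<le> e"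
  shows "arm p e \<le> arm p d"
proof -
  have "((\<lambda>v. (p v - 1) / v * arm p v) has_integral (arm p e - arm p d)) {d..e}"
  proof (rule fundamental_theorem_of_calculus_interior_strong[OF finite_S assms(2)])
    show "(arm p has_vector_derivative (p x - 1) / x * arm p x) (at x)" if "x \<in> {d<..<e} - S" for x
      using arm_deriv[of x] that assms by (simp add: has_real_derivative_iff_has_vector_derivative)
    have "continuous_on {0..e} (\<lambda>d. LBINT v:{0..d}. (p v - p 0) / v)"
      by (rule diff_quotient_integral_continuous)
    then have "continuous_on {d..e} (\<lambda>d. LBINT v:{0..d}. (p v - p 0) / v)"
      by (rule continuous_on_subset) (use assms in auto)
    then show "continuous_on {d..e} (arm p)" unfolding arm_def[abs_def]
      using assms by (intro continuous_intros) auto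
  qed
  moreover have "(p v - 1) / v * arm p v \<le> 0" if "v \<in> {d..e}" for v
    using that assms p_less_1[of v] arm_nonneg[of p v]
    by (intro mult_nonpos_nonneg divide_nonpos_nonneg) auto
  ultimately have "arm p e - arm p d \<le> 0"
    by (rule has_integral_le[OF _ has_integral_0])
  then show ?thesis by simp
qed

end

section \<open>The two arms of the density at a point x\<close>

lemma splitting_right:
  "splitting (\<lambda>v. p (x + v)) ((\<lambda>c. c - x) ` S) \<delta> L"
proof
  fix y z assume "y \<le> z" and disj: "{y..z} \<inter> (\<lambda>c. c - x) ` S = {}"
  have "{x + y..x + z} \<inter> S = {}"
  proof (rule ccontr)
    assume "{x + y..x + z} \<inter> S \<noteq> {}"
    then obtain c where "c \<in> S" "x + y \<le> c" "c \<le> x + z" by auto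
    then have "c - x \<in> {y..z} \<inter> (\<lambda>c. c - x) ` S" by auto
    then show False using disj by blast
  qed
  then show "\<bar>p (x + z) - p (x + y)\<bar> \<le> L * (z - y)"
    using p_Lipschitz[of "x + y" "x + z"] \<open>y \<le> z\<close> by simp
qed (simp_all add: finite_S delta_pos L_nonneg p_ge p_le)

text \<open>Running leftwards from \<open>x\<close> exchanges the two parts of a split, hence
  \<open>1 - p\<close> and the reversed argument. The hypotheses are symmetric under this exchange,
  so each one-sided lemma serves both arms.\<close>

lemma splitting_left:
  "splitting (\<lambda>v. 1 - p (x - v)) ((\<lambda>c. x - c) ` S) \<delta> L"
proof
  fix y z assume "y \<le> z" and disj: "{y..z} \<inter> (\<lambda>c. x - c) ` S = {}"
  have "{x - z..x - y} \<inter> S = {}"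
  proof (rule ccontr)
    assume "{x - z..x - y} \<inter> S \<noteq> {}"
    then obtain c where "c \<in> S" "x - z \<le> c" "c \<le> x - y" by auto
    then have "x - c \<in> {y..z} \<inter> (\<lambda>c. x - c) ` S" by auto
    then show False using disj by blast
  qed
  then show "\<bar>1 - p (x - z) - (1 - p (x - y))\<bar> \<le> L * (z - y)"
    using p_Lipschitz[of "x - z" "x - y"] \<open>y \<le> z\<close> by simp
next
  show "\<delta> \<le> 1 - p (x - u)" for u using p_le[of "x - u"] by simp
  show "1 - p (x - u) \<le> 1 - \<delta>" for u using p_ge[of "x - u"] by simp
qed (simp_all add: finite_S delta_pos L_nonneg)

abbreviation right_arm :: "real \<Rightarrow> real \<Rightarrow> real" where
  "right_arm x \<equiv> arm (\<lambda>v. p (x + v))"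

abbreviation left_arm :: "real \<Rightarrow> real \<Rightarrow> real" where
  "left_arm x \<equiv> arm (\<lambda>v. 1 - p (x - v))"

text \<open>Only the left arm depends on \<open>s\<close> and only the right arm on
  \<open>t\<close>. The prefactor is the reciprocal of \<open>Beta (1 - p x) (p x)\<close>.\<close>

definition limit_density :: "real \<Rightarrow> real \<Rightarrow> real \<Rightarrow> real" where
  "limit_density s t x = sin (pi * p x) / pi * left_arm x (x - s) * right_arm x (t - x)"

text \<open>Extended values allow harmonicity and subadditivity to be proved first; finiteness is
  then a consequence of the latter.\<close>

definition limit_mass :: "real set \<Rightarrow> real \<Rightarrow> real \<Rightarrow> ennreal" where
  "limit_mass A s t = (\<integral>\<^sup>+x. ennreal (limit_density s t x) * indicator (A \<inter> {s<..<t}) x \<partial>lborel)"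

lemma sin_p_nonneg: "0 \<le> sin (pi * p x)"
proof (rule sin_ge_zero)
  show "0 \<le> pi * p x" using p_pos[of x] by simp
  have "pi * p x \<le> pi * 1" using p_less_1[of x] by (intro mult_left_mono) auto
  then show "pi * p x \<le> pi" by simp
qed

lemma limit_density_nonneg: "0 \<le> limit_density s t x"
  by (simp add: limit_density_def sin_p_nonneg arm_nonneg)

text \<open>The limits of integration depend on the argument. Moved into an \<open>if\<close> inside
  the integrand, they leave a parametric integral of a jointly measurable function.\<close>

lemma right_arm_measurable[measurable (raw)]:
  assumes [measurable]: "f \<in> borel_measurable M" "g \<in> borel_measurable M"
  shows "(\<lambda>z. right_arm (f z) (g z)) \<in> borel_measurable M"
proof -
  have "(\<lambda>z. \<integral>v. (if 0 \<le> v \<and> v \<le> g z then (p (f z + v) - p (f z + 0)) / v else 0) \<partial>lborel)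
      \<in> borel_measurable M"
    by measurable
  also have "(\<lambda>z. \<integral>v. (if 0 \<le> v \<and> v \<le> g z then (p (f z + v) - p (f z + 0)) / v else 0) \<partial>lborel) =
      (\<lambda>z. LBINT v:{0..g z}. (p (f z + v) - p (f z + 0)) / v)"
    unfolding set_lebesgue_integral_def by (intro ext Bochner_Integration.integral_cong) auto
  finally have [measurable]:
    "(\<lambda>z. LBINT v:{0..g z}. (p (f z + v) - p (f z + 0)) / v) \<in> borel_measurable M" .
  show ?thesis unfolding arm_def by measurable
qed

lemma left_arm_measurable[measurable (raw)]:
  assumes [measurable]: "f \<in> borel_measurable M" "g \<in> borel_measurable M"
  shows "(\<lambda>z. left_arm (f z) (g z)) \<in> borel_measurable M"
proof -
  have "(\<lambda>z. \<integral>v. (if 0 \<le> v \<and> v \<le> g z then (1 - p (f z - v) - (1 - p (f z - 0))) / v else 0) \<partial>lborel)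
      \<in> borel_measurable M"
    by measurable
  also have "(\<lambda>z. \<integral>v. (if 0 \<le> v \<and> v \<le> g z then (1 - p (f z - v) - (1 - p (f z - 0))) / v else 0) \<partial>lborel) =
      (\<lambda>z. LBINT v:{0..g z}. (1 - p (f z - v) - (1 - p (f z - 0))) / v)"
    unfolding set_lebesgue_integral_def by (intro ext Bochner_Integration.integral_cong) auto
  finally have [measurable]:
    "(\<lambda>z. LBINT v:{0..g z}. (1 - p (f z - v) - (1 - p (f z - 0))) / v) \<in> borel_measurable M" .
  show ?thesis unfolding arm_def by measurable
qed

lemma limit_density_measurable[measurable (raw)]:
  assumes [measurable]: "f \<in> borel_measurable M" "g \<in> borel_measurable M" "h \<in> borel_measurable M"
  shows "(\<lambda>z. limit_density (f z) (g z) (h z)) \<in> borel_measurable M"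
  unfolding limit_density_def by measurable

lemma limit_mass_measurable[measurable (raw)]:
  assumes [measurable]: "f \<in> borel_measurable M" "g \<in> borel_measurable M" "A \<in> sets borel"
  shows "(\<lambda>z. limit_mass A (f z) (g z)) \<in> borel_measurable M"
proof -
  have "(\<lambda>z. \<integral>\<^sup>+x. ennreal (limit_density (f z) (g z) x) *
      (if x \<in> A \<and> f z < x \<and> x < g z then 1 else 0) \<partial>lborel) \<in> borel_measurable M"
    by measurable
  also have "(\<lambda>z. \<integral>\<^sup>+x. ennreal (limit_density (f z) (g z) x) *
      (if x \<in> A \<and> f z < x \<and> x < g z then 1 else 0) \<partial>lborel) = (\<lambda>z. limit_mass A (f z) (g z))"
    unfolding limit_mass_def by (intro ext nn_integral_cong) (auto simp: indicator_def)
  finally show ?thesis .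
qed

lemma nn_integral_right_arm:
  assumes "x \<notin> S" "x \<le> t"
  shows "(\<integral>\<^sup>+u. ennreal (p u * right_arm x (u - x)) * indicator {x..t} u \<partial>lborel) =
    ennreal ((t - x) * right_arm x (t - x))"
proof -
  interpret R: splitting "\<lambda>v. p (x + v)" "(\<lambda>c. c - x) ` S" \<delta> L by (rule splitting_right)
  have "0 \<notin> (\<lambda>c. c - x) ` S" using assms(1) by auto
  then have "(\<integral>\<^sup>+v. ennreal (p (x + v) * right_arm x v) * indicator {0..t - x} v \<partial>lborel) =
      ennreal ((t - x) * right_arm x (t - x))"
    using R.nn_integral_arm[of "t - x"] assms(2) by simp
  also have "(\<integral>\<^sup>+v. ennreal (p (x + v) * right_arm x v) * indicator {0..t - x} v \<partial>lborel) =
      (\<integral>\<^sup>+u. ennreal (p u * right_arm x (u - x)) * indicator {x..t} u \<partial>lborel)"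
    by (subst (2) nn_integral_real_affine[where c = 1 and t = x])
       (auto intro!: nn_integral_cong simp: indicator_def)
  finally show ?thesis .
qed

lemma nn_integral_left_arm:
  assumes "x \<notin> S" "s \<le> x"
  shows "(\<integral>\<^sup>+u. ennreal ((1 - p u) * left_arm x (x - u)) * indicator {s..x} u \<partial>lborel) =
    ennreal ((x - s) * left_arm x (x - s))"
proof -
  interpret R: splitting "\<lambda>v. 1 - p (x - v)" "(\<lambda>c. x - c) ` S" \<delta> L by (rule splitting_left)
  have "0 \<notin> (\<lambda>c. x - c) ` S" using assms(1) by auto
  then have "(\<integral>\<^sup>+v. ennreal ((1 - p (x - v)) * left_arm x v) * indicator {0..x - s} v \<partial>lborel) =
      ennreal ((x - s) * left_arm x (x - s))"
    using R.nn_integral_arm[of "x - s"] assms(2) by simp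
  also have "(\<integral>\<^sup>+v. ennreal ((1 - p (x - v)) * left_arm x v) * indicator {0..x - s} v \<partial>lborel) =
      (\<integral>\<^sup>+u. ennreal ((1 - p u) * left_arm x (x - u)) * indicator {s..x} u \<partial>lborel)"
    by (subst (2) nn_integral_real_affine[where c = "-1" and t = x])
       (auto intro!: nn_integral_cong simp: indicator_def)
  finally show ?thesis .
qed

lemma AE_notin_S: "AE x in lborel. x \<notin> S"
  using finite_S by (intro AE_not_in finite_imp_null_set_lborel)

text \<open>A split point \<open>u\<close> beyond \<open>x\<close> moves only the right end, so the
  left arm is a constant factor of the first integral; the second is its mirror image. The one-sided
  identities leave the lengths \<open>t - x\<close> and \<open>x - s\<close>, which add up to
  \<open>t - s\<close>.\<close>

lemma limit_density_harmonic:
  assumes "x \<notin> S" "s \<le> x" "x \<le> t"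
  shows "(\<integral>\<^sup>+u. ennreal (p u * limit_density s u x) * indicator {x..t} u \<partial>lborel) +
      (\<integral>\<^sup>+u. ennreal ((1 - p u) * limit_density u t x) * indicator {s..x} u \<partial>lborel) =
    ennreal ((t - s) * limit_density s t x)"
proof -
  define a where "a = sin (pi * p x) / pi"
  have a: "0 \<le> a" by (simp add: a_def sin_p_nonneg)
  have "(\<integral>\<^sup>+u. ennreal (p u * limit_density s u x) * indicator {x..t} u \<partial>lborel) =
      (\<integral>\<^sup>+u. ennreal (a * left_arm x (x - s)) *
        (ennreal (p u * right_arm x (u - x)) * indicator {x..t} u) \<partial>lborel)"
    using a less_imp_le[OF p_pos]
    by (intro nn_integral_cong)
       (simp add: limit_density_def a_def[symmetric] indicator_def arm_nonneg ennreal_mult'[symmetric] mult_ac)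
  also have "\<dots> = ennreal (a * left_arm x (x - s)) * ennreal ((t - x) * right_arm x (t - x))"
    by (subst nn_integral_cmult) (simp_all add: nn_integral_right_arm assms)
  finally have 1: "(\<integral>\<^sup>+u. ennreal (p u * limit_density s u x) * indicator {x..t} u \<partial>lborel) =
      ennreal (a * left_arm x (x - s) * ((t - x) * right_arm x (t - x)))"
    using a assms by (simp add: ennreal_mult' arm_nonneg)
  have q: "0 \<le> 1 - p u" for u using p_less_1[of u] by simp
  have "(\<integral>\<^sup>+u. ennreal ((1 - p u) * limit_density u t x) * indicator {s..x} u \<partial>lborel) =
      (\<integral>\<^sup>+u. ennreal (a * right_arm x (t - x)) *
        (ennreal ((1 - p u) * left_arm x (x - u)) * indicator {s..x} u) \<partial>lborel)"
    using a q
    by (intro nn_integral_cong)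
       (simp add: limit_density_def a_def[symmetric] indicator_def arm_nonneg ennreal_mult'[symmetric] mult_ac)
  also have "\<dots> = ennreal (a * right_arm x (t - x)) * ennreal ((x - s) * left_arm x (x - s))"
    by (subst nn_integral_cmult) (simp_all add: nn_integral_left_arm assms)
  finally have 2: "(\<integral>\<^sup>+u. ennreal ((1 - p u) * limit_density u t x) * indicator {s..x} u \<partial>lborel) =
      ennreal (a * right_arm x (t - x) * ((x - s) * left_arm x (x - s)))"
    using a assms by (simp add: ennreal_mult' arm_nonneg)
  have "a * left_arm x (x - s) * ((t - x) * right_arm x (t - x)) +
      a * right_arm x (t - x) * ((x - s) * left_arm x (x - s)) = (t - s) * limit_density s t x"
    by (simp add: limit_density_def a_def[symmetric] algebra_simps)
  then show ?thesis unfolding 1 2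
    using a assms by (subst ennreal_plus[symmetric]) (auto simp: arm_nonneg)
qed

lemma limit_mass_harmonic:
  assumes [measurable]: "A \<in> sets borel" and "s \<le> t"
  shows "ennreal (t - s) * limit_mass A s t =
    (\<integral>\<^sup>+u. (ennreal (p u) * limit_mass A s u + ennreal (1 - p u) * limit_mass A u t) *
      indicator {s..t} u \<partial>lborel)"
proof -
  have q: "0 \<le> 1 - p u" and p: "0 \<le> p u" for u
    using p_less_1[of u] p_pos[of u] by simp_all
  \<comment> \<open>Each \<open>if\<close> states only one half of \<open>s \<le> u \<le> t\<close>;
    the other half follows from the position of \<open>x\<close>.\<close>
  define F where "F u x = ennreal (p u * limit_density s u x) *
      (if x \<in> A \<and> s < x \<and> x < u \<and> u \<le> t then 1 else 0) +
      ennreal ((1 - p u) * limit_density u t x) *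
      (if x \<in> A \<and> u < x \<and> x < t \<and> s \<le> u then 1 else 0)" for u x
  have [measurable]: "case_prod F \<in> borel_measurable (lborel \<Otimes>\<^sub>M lborel)"
    unfolding F_def by measurable
  have "(\<integral>\<^sup>+u. (ennreal (p u) * limit_mass A s u + ennreal (1 - p u) * limit_mass A u t) *
      indicator {s..t} u \<partial>lborel) = (\<integral>\<^sup>+u. (\<integral>\<^sup>+x. F u x \<partial>lborel) \<partial>lborel)"
  proof (intro nn_integral_cong)
    fix u
    have "(ennreal (p u) * limit_mass A s u + ennreal (1 - p u) * limit_mass A u t) * indicator {s..t} u =
        (\<integral>\<^sup>+x. (ennreal (p u) * (ennreal (limit_density s u x) * indicator (A \<inter> {s<..<u}) x) +
          ennreal (1 - p u) * (ennreal (limit_density u t x) * indicator (A \<inter> {u<..<t}) x)) *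
          indicator {s..t} u \<partial>lborel)"
      unfolding limit_mass_def
      by (subst nn_integral_multc, measurable, subst nn_integral_add, measurable)
         (simp add: nn_integral_cmult)
    also have "\<dots> = (\<integral>\<^sup>+x. F u x \<partial>lborel)"
      by (intro nn_integral_cong)
         (auto simp: F_def indicator_def ennreal_mult p less_imp_le[OF p_less_1] limit_density_nonneg mult_ac)
    finally show "(ennreal (p u) * limit_mass A s u + ennreal (1 - p u) * limit_mass A u t) *
      indicator {s..t} u = (\<integral>\<^sup>+x. F u x \<partial>lborel)" .
  qed
  also have "\<dots> = (\<integral>\<^sup>+x. (\<integral>\<^sup>+u. F u x \<partial>lborel) \<partial>lborel)"
    by (rule lborel_pair.Fubini') measurable
  also have "\<dots> = (\<integral>\<^sup>+x. ennreal (t - s) * (ennreal (limit_density s t x) * indicator (A \<inter> {s<..<t}) x) \<partial>lborel)"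
  proof (intro nn_integral_cong_AE, use AE_notin_S in eventually_elim)
    fix x assume x: "x \<notin> S"
    show "(\<integral>\<^sup>+u. F u x \<partial>lborel) =
        ennreal (t - s) * (ennreal (limit_density s t x) * indicator (A \<inter> {s<..<t}) x)"
    proof (cases "x \<in> A \<and> s < x \<and> x < t")
      case True
      have "(\<integral>\<^sup>+u. F u x \<partial>lborel) =
          (\<integral>\<^sup>+u. ennreal (p u * limit_density s u x) * indicator {x..t} u +
            ennreal ((1 - p u) * limit_density u t x) * indicator {s..x} u \<partial>lborel)"
        \<comment> \<open>The closed intervals also contain \<open>u = x\<close>, where an arm of
          length 0 makes the density 0.\<close>
        using True by (intro nn_integral_cong) (auto simp: F_def indicator_def limit_density_def arm_def)
      also have "\<dots> = ennreal ((t - s) * limit_density s t x)"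
        using limit_density_harmonic[of x s t] True x
        by (subst nn_integral_add) auto
      finally show ?thesis
        using True assms by (simp add: ennreal_mult limit_density_nonneg)
    next
      case False
      then have "F u x = 0" for u by (auto simp: F_def)
      then show ?thesis using False by (auto simp: indicator_def)
    qed
  qed
  also have "\<dots> = ennreal (t - s) * limit_mass A s t"
    unfolding limit_mass_def by (rule nn_integral_cmult) measurable
  finally show ?thesis ..
qed

text \<open>Cutting at \<open>c\<close> shortens one of the two arms at \<open>x\<close>, and arms
  decrease with their length, so the density at \<open>x\<close> can only grow.\<close>

lemma limit_mass_subadditive:
  assumes [measurable]: "A \<in> sets borel" and "s < c" "c < t"
  shows "limit_mass A s t \<le> limit_mass A s c + limit_mass A c t"
proof -
  have "limit_mass A s t \<le> (\<integral>\<^sup>+x. ennreal (limit_density s c x) * indicator (A \<inter> {s<..<c}) x +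
      ennreal (limit_density c t x) * indicator (A \<inter> {c<..<t}) x \<partial>lborel)"
    unfolding limit_mass_def
  proof (intro nn_integral_mono_AE, use AE_notin_S AE_lborel_singleton[of c] in eventually_elim)
    fix x assume x: "x \<notin> S" "x \<noteq> c"
    interpret R: splitting "\<lambda>v. p (x + v)" "(\<lambda>c. c - x) ` S" \<delta> L by (rule splitting_right)
    interpret G: splitting "\<lambda>v. 1 - p (x - v)" "(\<lambda>c. x - c) ` S" \<delta> L by (rule splitting_left)
    have S0: "0 \<notin> (\<lambda>c. c - x) ` S" "0 \<notin> (\<lambda>c. x - c) ` S" using x by auto
    show "ennreal (limit_density s t x) * indicator (A \<inter> {s<..<t}) x
        \<le> ennreal (limit_density s c x) * indicator (A \<inter> {s<..<c}) x +
          ennreal (limit_density c t x) * indicator (A \<inter> {c<..<t}) x"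
    proof (cases "x \<in> A \<and> s < x \<and> x < t")
      case True
      show ?thesis
      proof (cases "x < c")
        case xc: True
        have "right_arm x (t - x) \<le> right_arm x (c - x)"
          using R.arm_antimono[OF S0(1), of "c - x" "t - x"] xc assms by simp
        then have "limit_density s t x \<le> limit_density s c x"
          unfolding limit_density_def
          by (intro mult_left_mono mult_nonneg_nonneg arm_nonneg) (auto simp: sin_p_nonneg)
        then show ?thesis using True xc by (simp add: indicator_def ennreal_leI)
      next
        case False
        then have xc: "c < x" using x by simp
        have "left_arm x (x - s) \<le> left_arm x (x - c)"
          using G.arm_antimono[OF S0(2), of "x - c" "x - s"] xc assms by simp
        then have "limit_density s t x \<le> limit_density c t x"
          unfolding limit_density_def
          by (intro mult_right_mono mult_left_mono arm_nonneg) (auto simp: sin_p_nonneg)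
        then show ?thesis using True xc by (simp add: indicator_def ennreal_leI)
      qed
    qed (auto simp: indicator_def)
  qed
  also have "\<dots> = limit_mass A s c + limit_mass A c t"
    unfolding limit_mass_def by (rule nn_integral_add) measurable
  finally show ?thesis .
qed

end

section \<open>The total mass of the harmonic density\<close>

lemma Beta_reflection:
  fixes x :: real
  assumes "0 < x" "x < 1"
  shows "Beta (1 - x) x = pi / sin (pi * x)"
proof -
  have "complex_of_real (Gamma x * Gamma (1 - x)) = complex_of_real (pi / sin (pi * x))"
    using Gamma_reflection_complex[of "complex_of_real x"]
    by (simp add: Gamma_complex_of_real[symmetric] sin_of_real[symmetric])
  then have "Gamma x * Gamma (1 - x) = pi / sin (pi * x)"
    by (simp only: of_real_eq_iff)
  then show ?thesis by (simp add: Beta_def mult.commute)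
qed

lemma nn_integral_Beta_interval:
  fixes s t \<alpha> \<beta> :: real
  assumes "s < t" "0 < \<alpha>" "0 < \<beta>"
  shows "(\<integral>\<^sup>+x. ennreal (((x - s) / (t - s)) powr (\<alpha> - 1) * ((t - x) / (t - s)) powr (\<beta> - 1)) *
      indicator {s<..<t} x \<partial>lborel) = ennreal ((t - s) * Beta \<alpha> \<beta>)"
proof -
  have ts: "t - s \<noteq> 0" using assms by simp
  have ind: "s + (t - s) * y \<in> {s<..<t} \<longleftrightarrow> y \<in> {0<..<1}" for y
  proof -
    have "s + (t - s) * y < t \<longleftrightarrow> (t - s) * y < (t - s) * 1" by (simp add: algebra_simps)
    also have "\<dots> \<longleftrightarrow> y < 1" using assms by (subst mult_less_cancel_left_pos) auto
    finally show ?thesis using assms by (auto simp: zero_less_mult_iff)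
  qed
  have "(\<integral>\<^sup>+x. ennreal (((x - s) / (t - s)) powr (\<alpha> - 1) * ((t - x) / (t - s)) powr (\<beta> - 1)) *
      indicator {s<..<t} x \<partial>lborel) =
      ennreal \<bar>t - s\<bar> * (\<integral>\<^sup>+y. ennreal (((s + (t - s) * y - s) / (t - s)) powr (\<alpha> - 1) *
        ((t - (s + (t - s) * y)) / (t - s)) powr (\<beta> - 1)) * indicator {s<..<t} (s + (t - s) * y) \<partial>lborel)"
    by (rule nn_integral_real_affine[OF _ ts]) measurable
  also have "(\<integral>\<^sup>+y. ennreal (((s + (t - s) * y - s) / (t - s)) powr (\<alpha> - 1) *
        ((t - (s + (t - s) * y)) / (t - s)) powr (\<beta> - 1)) * indicator {s<..<t} (s + (t - s) * y) \<partial>lborel) =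
      (\<integral>\<^sup>+y. ennreal (indicator {0..1} y * (y powr (\<alpha> - 1) * (1 - y) powr (\<beta> - 1))) \<partial>lborel)"
  proof (intro nn_integral_cong)
    fix y
    have "(t - (s + (t - s) * y)) / (t - s) = 1 - y" "(s + (t - s) * y - s) / (t - s) = y"
      using ts by (simp_all add: field_simps)
    then show "ennreal (((s + (t - s) * y - s) / (t - s)) powr (\<alpha> - 1) *
        ((t - (s + (t - s) * y)) / (t - s)) powr (\<beta> - 1)) * indicator {s<..<t} (s + (t - s) * y) =
        ennreal (indicator {0..1} y * (y powr (\<alpha> - 1) * (1 - y) powr (\<beta> - 1)))"
      \<comment> \<open>At \<open>y = 0\<close> and \<open>y = 1\<close> one of the powers is
        \<open>0 powr _ = 0\<close>, so the open and the closed interval agree.\<close>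
      using ind[of y] by (cases "y = 0"; cases "y = 1") (auto simp: indicator_def)
  qed
  also have "\<dots> = ennreal (Beta \<alpha> \<beta>)"
  proof (rule nn_integral_has_integral_lborel)
    show "((\<lambda>y. indicator {0..1} y * (y powr (\<alpha> - 1) * (1 - y) powr (\<beta> - 1))) has_integral Beta \<alpha> \<beta>) UNIV"
      using has_integral_Beta_real[OF assms(2,3)]
      unfolding has_integral_restrict_UNIV[of "{0..1}", symmetric]
      by (rule has_integral_eq[rotated]) (simp add: indicator_def)
  qed auto
  finally show ?thesis using assms by (simp add: ennreal_mult')
qed

lemma abs_sin_diff_le: "\<bar>sin x - sin y\<bar> \<le> \<bar>x - y\<bar>" for x y :: real
proof -
  have "\<bar>sin x - sin y\<bar> = 2 * \<bar>sin ((x - y) / 2)\<bar> * \<bar>cos ((x + y) / 2)\<bar>"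
    by (simp add: sin_diff_sin abs_mult)
  also have "\<dots> \<le> 2 * \<bar>(x - y) / 2\<bar> * 1"
    by (intro mult_mono abs_sin_x_le_abs_x) auto
  finally show ?thesis by simp
qed

text \<open>
  Freezing \<open>p\<close> at the value \<open>P\<close> on an interval on which it varies by at most \<open>\<eta>\<close> changes the mass
  of the limit density at most from \<open>beta_majorant P \<eta>\<close> (upper bound) or \<open>beta_majorant P (-\<eta>)\<close>
  (lower bound) to \<open>beta_majorant P 0 = 1\<close>.
\<close>

definition beta_majorant :: "real \<Rightarrow> real \<Rightarrow> real" where
  "beta_majorant P \<eta> = exp \<eta> * (sin (pi * P) + pi * \<eta>) / pi * Beta (1 - P - \<eta>) (P - \<eta>)"

lemma beta_majorant_0: "0 < P \<Longrightarrow> P < 1 \<Longrightarrow> beta_majorant P 0 = 1"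
proof -
  assume P: "0 < P" "P < 1"
  then have "0 < sin (pi * P)" by (intro sin_gt_zero) auto
  then show ?thesis using P by (simp add: beta_majorant_def Beta_reflection)
qed

text \<open>The value at \<open>\<eta> = 0\<close> is 1; what matters is that \<open>\<eta>0\<close>
  does not depend on \<open>P\<close>. This is uniform continuity on a compact rectangle on which
  both Beta arguments are at least \<open>\<delta> / 2\<close>.\<close>

lemma beta_majorant_near_1:
  assumes "0 < \<delta>" "\<delta> < 1" "0 < \<epsilon>"
  obtains \<eta>0 where "0 < \<eta>0" "\<eta>0 \<le> \<delta> / 2"
    "\<And>P \<eta>. \<delta> \<le> P \<Longrightarrow> P \<le> 1 - \<delta> \<Longrightarrow> \<bar>\<eta>\<bar> \<le> \<eta>0 \<Longrightarrow> \<bar>beta_majorant P \<eta> - 1\<bar> \<le> \<epsilon>"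
proof -
  define K where "K = {\<delta>..1 - \<delta>} \<times> {- \<delta> / 2..\<delta> / 2}"
  \<comment> \<open>The two Beta arguments and their sum, the argument of Gamma in the
    denominator.\<close>
  have pos: "0 < 1 - fst z - snd z" "0 < fst z - snd z" "0 < 1 - fst z - snd z + (fst z - snd z)"
    if "z \<in> K" for z
    using that assms by (auto simp: K_def)
  have nn: "f z \<notin> \<int>\<^sub>\<le>\<^sub>0" if "0 < f z" for f :: "real \<times> real \<Rightarrow> real" and z
    using that by (auto simp: nonpos_Ints_def)
  have G: "continuous_on K (\<lambda>z. Gamma (f z))"
    if "continuous_on K f" "\<And>z. z \<in> K \<Longrightarrow> 0 < f z" for f :: "real \<times> real \<Rightarrow> real"
  proof (rule continuous_on_compose2[of "{0<..}" Gamma])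
    show "continuous_on {0<..} (Gamma :: real \<Rightarrow> real)"
      by (rule continuous_on_Gamma) (auto simp: nonpos_Ints_def)
  qed (use that in auto)
  have "continuous_on K (\<lambda>z. beta_majorant (fst z) (snd z))"
    unfolding beta_majorant_def Beta_def
    by (intro continuous_intros G)
       (use pos in \<open>auto simp: less_imp_neq[OF Gamma_real_pos, symmetric]\<close>)
  moreover have "compact K" unfolding K_def by (intro compact_Times) auto
  ultimately have "uniformly_continuous_on K (\<lambda>z. beta_majorant (fst z) (snd z))"
    by (rule compact_uniformly_continuous)
  then obtain d where d: "0 < d" "\<And>z z'. z \<in> K \<Longrightarrow> z' \<in> K \<Longrightarrow> dist z' z < d \<Longrightarrow>
      dist (beta_majorant (fst z') (snd z')) (beta_majorant (fst z) (snd z)) < \<epsilon>"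
    using assms(3) unfolding uniformly_continuous_on_def by metis
  show ?thesis
  proof (rule that[of "min (d / 2) (\<delta> / 2)"])
    fix P \<eta> assume P: "\<delta> \<le> P" "P \<le> 1 - \<delta>" and \<eta>: "\<bar>\<eta>\<bar> \<le> min (d / 2) (\<delta> / 2)"
    have "dist (beta_majorant (fst (P, \<eta>)) (snd (P, \<eta>))) (beta_majorant (fst (P, 0::real)) (snd (P, 0::real))) < \<epsilon>"
      using P \<eta> d(1) assms by (intro d(2)[of "(P, 0)" "(P, \<eta>)"]) (auto simp: K_def dist_Pair_Pair dist_real_def)
    then show "\<bar>beta_majorant P \<eta> - 1\<bar> \<le> \<epsilon>"
      using P assms by (simp add: beta_majorant_0 dist_real_def)
  qed (use d assms in auto)
qed

section \<open>Intervals without break points: comparison with the Beta integral\<close>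

context splitting
begin

text \<open>The Lipschitz condition bounds the integrand by \<open>L\<close>. The interval is
  half-open since an interval without interior break points may still end at one.\<close>

lemma abs_diff_quotient_integral_le:
  assumes S0: "0 \<notin> S" and "0 \<le> d" "{0..<d} \<inter> S = {}"
  shows "\<bar>LBINT v:{0..d}. (p v - p 0) / v\<bar> \<le> L * d"
proof -
  have bound: "(p v - p 0) / v \<in> {- L..L}" if "0 \<le> v" "v < d" for v
  proof -
    have "{0..v} \<subseteq> {0..<d}" using that by auto
    then have "{0..v} \<inter> S = {}" using assms(3) by blast
    then show ?thesis
      using p_Lipschitz[of 0 v] that L_nonneg by (cases "v = 0") (auto simp: field_simps abs_le_iff)
  qed
  have AE: "AE v\<in>{0..d} in lborel. (p v - p 0) / v \<in> {- L..L}"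
    using AE_lborel_singleton[of d] by eventually_elim (intro impI bound, auto)
  have int: "set_integrable lborel {0..d} (\<lambda>_. c)" for c :: real
    unfolding set_integrable_def 
    by (intro integrableI_bounded_set_indicator[where B = "norm c"]) (auto simp: emeasure_lborel_Icc_eq)
  have const: "(LBINT v:{0..d}. c) = c * d" for c :: real
    using assms by (simp add: set_lebesgue_integral_def)
  have "(LBINT v:{0..d}. (p v - p 0) / v) \<le> (LBINT v:{0..d}. L)"
    by (rule set_integral_mono_AE[OF diff_quotient_integrable[OF S0] int]) (use AE in eventually_elim, auto)
  moreover have "(LBINT v:{0..d}. - L) \<le> (LBINT v:{0..d}. (p v - p 0) / v)"
    by (rule set_integral_mono_AE[OF int diff_quotient_integrable[OF S0]]) (use AE in eventually_elim, auto)
  ultimately show ?thesis unfolding const by auto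
qed

text \<open>The exponents \<open>- p x\<close> and \<open>p x - 1\<close> add up to -1, so rescaling
  to unit length costs exactly the factor \<open>1 / (t - s)\<close>. The correction
  \<open>J\<close> collects the exponents of both arms, bounded by \<open>L * (x - s)\<close> and
  \<open>L * (t - x)\<close>.\<close>

lemma limit_density_eq_exp:
  assumes "{s<..<t} \<inter> S = {}" "s < x" "x < t"
  obtains J where "\<bar>J\<bar> \<le> L * (t - s)"
    "limit_density s t x = exp J * sin (pi * p x) / (pi * (t - s)) *
      (((x - s) / (t - s)) powr (- p x) * ((t - x) / (t - s)) powr (p x - 1))"
proof -
  define JR where "JR = (LBINT v:{0..t - x}. (p (x + v) - p (x + 0)) / v)"
  define JL where "JL = (LBINT v:{0..x - s}. (1 - p (x - v) - (1 - p (x - 0))) / v)"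
  interpret R: splitting "\<lambda>v. p (x + v)" "(\<lambda>c. c - x) ` S" \<delta> L by (rule splitting_right)
  interpret G: splitting "\<lambda>v. 1 - p (x - v)" "(\<lambda>c. x - c) ` S" \<delta> L by (rule splitting_left)
  have x: "x \<notin> S" using assms by auto
  have out: "\<not> (s < c \<and> c < t)" if "c \<in> S" for c using assms(1) that by auto
  have JR: "\<bar>JR\<bar> \<le> L * (t - x)" unfolding JR_def
    by (rule R.abs_diff_quotient_integral_le) (use x assms out in \<open>fastforce+\<close>)
  have JL: "\<bar>JL\<bar> \<le> L * (x - s)" unfolding JL_def
    by (rule G.abs_diff_quotient_integral_le) (use x assms out in \<open>fastforce+\<close>)
  show ?thesis
  proof (rule that[of "JL + JR"])
    have "\<bar>JL + JR\<bar> \<le> L * (x - s) + L * (t - x)" using JL JR by linarith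
    also have "\<dots> = L * (t - s)" by (simp add: algebra_simps)
    finally show "\<bar>JL + JR\<bar> \<le> L * (t - s)" .
    have "((x - s) / (t - s)) powr (- p x) * ((t - x) / (t - s)) powr (p x - 1) =
        (x - s) powr (- p x) * (t - x) powr (p x - 1) / ((t - s) powr (- p x) * (t - s) powr (p x - 1))"
      using assms by (simp add: powr_divide)
    also have "(t - s) powr (- p x) * (t - s) powr (p x - 1) = (t - s) powr (- p x + (p x - 1))"
      by (rule powr_add[symmetric])
    also have "\<dots> = 1 / (t - s)" using assms by (simp add: powr_neg_one)
    finally have *: "((x - s) / (t - s)) powr (- p x) * ((t - x) / (t - s)) powr (p x - 1) =
        (t - s) * ((x - s) powr (- p x) * (t - x) powr (p x - 1))" by simp
    show "limit_density s t x = exp (JL + JR) * sin (pi * p x) / (pi * (t - s)) *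
      (((x - s) / (t - s)) powr (- p x) * ((t - x) / (t - s)) powr (p x - 1))"
      unfolding * limit_density_def arm_def JR_def[symmetric] JL_def[symmetric]
      using assms by (simp add: exp_add)
  qed
qed

lemma limit_mass_le_Beta:
  assumes "s < t" "0 < \<alpha>" "0 < \<beta>" "0 \<le> C"
    and "\<And>x. s < x \<Longrightarrow> x < t \<Longrightarrow> limit_density s t x \<le>
      C / (t - s) * (((x - s) / (t - s)) powr (\<alpha> - 1) * ((t - x) / (t - s)) powr (\<beta> - 1))"
  shows "limit_mass UNIV s t \<le> ennreal (C * Beta \<alpha> \<beta>)"
proof -
  have "limit_mass UNIV s t \<le> (\<integral>\<^sup>+x. ennreal (C / (t - s)) * (ennreal (((x - s) / (t - s)) powr (\<alpha> - 1) *
      ((t - x) / (t - s)) powr (\<beta> - 1)) * indicator {s<..<t} x) \<partial>lborel)"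
    unfolding limit_mass_def using assms
    by (intro nn_integral_mono)
       (auto simp: indicator_def ennreal_mult'[symmetric] intro!: ennreal_leI)
  also have "\<dots> = ennreal (C / (t - s)) * ennreal ((t - s) * Beta \<alpha> \<beta>)"
    by (subst nn_integral_cmult) (simp_all add: nn_integral_Beta_interval assms)
  also have "\<dots> = ennreal (C * Beta \<alpha> \<beta>)"
    using assms by (subst ennreal_mult'[symmetric]) (auto intro!: arg_cong[where f = ennreal])
  finally show ?thesis .
qed

lemma limit_mass_ge_Beta:
  assumes "s < t" "0 < \<alpha>" "0 < \<beta>" "0 \<le> C"
    and "\<And>x. s < x \<Longrightarrow> x < t \<Longrightarrow> limit_density s t x \<ge>
      C / (t - s) * (((x - s) / (t - s)) powr (\<alpha> - 1) * ((t - x) / (t - s)) powr (\<beta> - 1))"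
  shows "limit_mass UNIV s t \<ge> ennreal (C * Beta \<alpha> \<beta>)"
proof -
  have "ennreal (C * Beta \<alpha> \<beta>) = ennreal (C / (t - s)) * ennreal ((t - s) * Beta \<alpha> \<beta>)"
    using assms by (subst ennreal_mult'[symmetric]) (auto intro!: arg_cong[where f = ennreal])
  also have "\<dots> = (\<integral>\<^sup>+x. ennreal (C / (t - s)) * (ennreal (((x - s) / (t - s)) powr (\<alpha> - 1) *
      ((t - x) / (t - s)) powr (\<beta> - 1)) * indicator {s<..<t} x) \<partial>lborel)"
    by (subst nn_integral_cmult) (simp_all add: nn_integral_Beta_interval assms)
  also have "\<dots> \<le> limit_mass UNIV s t"
    unfolding limit_mass_def using assms
    by (intro nn_integral_mono)
       (auto simp: indicator_def ennreal_mult'[symmetric] intro!: ennreal_leI)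
  finally show ?thesis .
qed

lemma Beta_nonneg: "0 < x \<Longrightarrow> 0 < y \<Longrightarrow> 0 \<le> Beta x y" for x y :: real
  by (simp add: Beta_def Gamma_real_pos less_imp_le)

text \<open>A crude bound that needs no smallness: the sine is at most 1, and on bases in
  \<open>[0, 1]\<close> both exponents may be lowered to \<open>\<delta> - 1\<close>.\<close>

lemma limit_mass_no_break_bounded:
  assumes "s < t" "t - s \<le> \<Lambda>" "{s<..<t} \<inter> S = {}"
  shows "limit_mass UNIV s t \<le> ennreal (exp (L * \<Lambda>) / pi * Beta \<delta> \<delta>)"
proof (rule limit_mass_le_Beta)
  fix x assume x: "s < x" "x < t"
  obtain J where J: "\<bar>J\<bar> \<le> L * (t - s)"
    "limit_density s t x = exp J * sin (pi * p x) / (pi * (t - s)) *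
      (((x - s) / (t - s)) powr (- p x) * ((t - x) / (t - s)) powr (p x - 1))"
    using limit_density_eq_exp[OF assms(3) x] .
  have "L * (t - s) \<le> L * \<Lambda>" using L_nonneg assms by (intro mult_left_mono) auto
  then have "exp J * sin (pi * p x) \<le> exp (L * \<Lambda>) * 1"
    using J(1) sin_p_nonneg by (intro mult_mono) auto
  then have 1: "exp J * sin (pi * p x) / (pi * (t - s)) \<le> exp (L * \<Lambda>) / (pi * (t - s))"
    using assms by (intro divide_right_mono) auto
  have y: "0 \<le> (x - s) / (t - s)" "(x - s) / (t - s) \<le> 1" "0 \<le> (t - x) / (t - s)" "(t - x) / (t - s) \<le> 1"
    using x by auto
  have 2: "((x - s) / (t - s)) powr (- p x) \<le> ((x - s) / (t - s)) powr (\<delta> - 1)"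
    using p_le[of x] by (intro powr_mono' y) auto
  have 3: "((t - x) / (t - s)) powr (p x - 1) \<le> ((t - x) / (t - s)) powr (\<delta> - 1)"
    using p_ge[of x] by (intro powr_mono' y) auto
  have "limit_density s t x \<le> exp (L * \<Lambda>) / (pi * (t - s)) *
      (((x - s) / (t - s)) powr (\<delta> - 1) * ((t - x) / (t - s)) powr (\<delta> - 1))"
    unfolding J(2) using assms sin_p_nonneg by (intro mult_mono 1 2 3) auto
  then show "limit_density s t x \<le> exp (L * \<Lambda>) / pi / (t - s) *
      (((x - s) / (t - s)) powr (\<delta> - 1) * ((t - x) / (t - s)) powr (\<delta> - 1))"
    by simp
qed (use assms delta_pos in auto)

text \<open>\<open>P\<close> is the value of \<open>p\<close> at the midpoint. The single number
  \<open>\<eta>\<close> bounds both the oscillation of \<open>p\<close> around \<open>P\<close> and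
  the correction \<open>J\<close>; with \<open>\<eta> \<le> \<delta> / 2\<close> the shifted Beta
  arguments stay positive.\<close>

lemma limit_mass_between_beta_majorants:
  assumes "s < t" "{s<..<t} \<inter> S = {}" and \<eta>: "\<eta> = L * (t - s)" "\<eta> \<le> \<delta> / 2"
  obtains P where "\<delta> \<le> P" "P \<le> 1 - \<delta>" "limit_mass UNIV s t \<le> ennreal (beta_majorant P \<eta>)"
    "ennreal (beta_majorant P (- \<eta>)) \<le> limit_mass UNIV s t"
proof (rule that)
  define z where "z = (s + t) / 2"
  have z: "s < z" "z < t" using assms by (auto simp: z_def)
  show P: "\<delta> \<le> p z" "p z \<le> 1 - \<delta>" by (rule p_ge p_le)+
  have \<eta>0: "0 \<le> \<eta>" using L_nonneg assms by simp
  have close: "\<bar>p x - p z\<bar> \<le> \<eta>" if "s < x" "x < t" for x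
  proof (cases "x \<le> z")
    case True
    have "{x..z} \<subseteq> {s<..<t}" using that z by auto
    then have "{x..z} \<inter> S = {}" using assms(2) by blast
    then have "\<bar>p z - p x\<bar> \<le> L * (z - x)" using True by (intro p_Lipschitz)
    also have "\<dots> \<le> \<eta>" unfolding \<eta> using that z L_nonneg by (intro mult_left_mono) auto
    finally show ?thesis by simp
  next
    case False
    have "{z..x} \<subseteq> {s<..<t}" using that z by auto
    then have "{z..x} \<inter> S = {}" using assms(2) by blast
    then have "\<bar>p x - p z\<bar> \<le> L * (x - z)" using False by (intro p_Lipschitz) auto
    also have "\<dots> \<le> \<eta>" unfolding \<eta> using that z L_nonneg by (intro mult_left_mono) auto
    finally show ?thesis .
  qed
  have sin_close: "\<bar>sin (pi * p x) - sin (pi * p z)\<bar> \<le> pi * \<eta>" if "s < x" "x < t" for x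
  proof -
    have "\<bar>sin (pi * p x) - sin (pi * p z)\<bar> \<le> \<bar>pi * p x - pi * p z\<bar>" by (rule abs_sin_diff_le)
    also have "\<dots> = pi * \<bar>p x - p z\<bar>" by (simp add: abs_mult right_diff_distrib[symmetric])
    also have "\<dots> \<le> pi * \<eta>" using close[OF that] by (intro mult_left_mono) auto
    finally show ?thesis .
  qed
  have y: "0 \<le> (x - s) / (t - s)" "(x - s) / (t - s) \<le> 1" "0 \<le> (t - x) / (t - s)" "(t - x) / (t - s) \<le> 1"
    if "s < x" "x < t" for x
    using that by auto
  have "limit_mass UNIV s t \<le> ennreal (exp \<eta> * (sin (pi * p z) + pi * \<eta>) / pi * Beta (1 - p z - \<eta>) (p z - \<eta>))"
  proof (rule limit_mass_le_Beta)
    fix x assume x: "s < x" "x < t"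
    obtain J where J: "\<bar>J\<bar> \<le> L * (t - s)"
      "limit_density s t x = exp J * sin (pi * p x) / (pi * (t - s)) *
        (((x - s) / (t - s)) powr (- p x) * ((t - x) / (t - s)) powr (p x - 1))"
      using limit_density_eq_exp[OF assms(2) x] .
    have "exp J * sin (pi * p x) \<le> exp \<eta> * (sin (pi * p z) + pi * \<eta>)"
      using J(1) sin_close[OF x] sin_p_nonneg \<eta> by (intro mult_mono) auto
    then have 1: "exp J * sin (pi * p x) / (pi * (t - s)) \<le> exp \<eta> * (sin (pi * p z) + pi * \<eta>) / (pi * (t - s))"
      using assms by (intro divide_right_mono) auto
    have 2: "((x - s) / (t - s)) powr (- p x) \<le> ((x - s) / (t - s)) powr (1 - p z - \<eta> - 1)"
      using close[OF x] by (intro powr_mono' y x) auto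
    have 3: "((t - x) / (t - s)) powr (p x - 1) \<le> ((t - x) / (t - s)) powr (p z - \<eta> - 1)"
      using close[OF x] by (intro powr_mono' y x) auto
    have "limit_density s t x \<le> exp \<eta> * (sin (pi * p z) + pi * \<eta>) / (pi * (t - s)) *
        (((x - s) / (t - s)) powr (1 - p z - \<eta> - 1) * ((t - x) / (t - s)) powr (p z - \<eta> - 1))"
      unfolding J(2) using assms sin_p_nonneg \<eta>0 by (intro mult_mono 1 2 3) auto
    then show "limit_density s t x \<le> exp \<eta> * (sin (pi * p z) + pi * \<eta>) / pi / (t - s) *
        (((x - s) / (t - s)) powr (1 - p z - \<eta> - 1) * ((t - x) / (t - s)) powr (p z - \<eta> - 1))"
      by simp
  qed (use assms(1) P delta_pos \<eta> \<eta>0 sin_p_nonneg in auto)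
  then show "limit_mass UNIV s t \<le> ennreal (beta_majorant (p z) \<eta>)" by (simp add: beta_majorant_def)
  show "ennreal (beta_majorant (p z) (- \<eta>)) \<le> limit_mass UNIV s t"
  proof (cases "0 \<le> sin (pi * p z) - pi * \<eta>")
    case True
    have "ennreal (exp (- \<eta>) * (sin (pi * p z) - pi * \<eta>) / pi * Beta (1 - p z + \<eta>) (p z + \<eta>)) \<le> limit_mass UNIV s t"
    proof (rule limit_mass_ge_Beta)
      fix x assume x: "s < x" "x < t"
      obtain J where J: "\<bar>J\<bar> \<le> L * (t - s)"
        "limit_density s t x = exp J * sin (pi * p x) / (pi * (t - s)) *
          (((x - s) / (t - s)) powr (- p x) * ((t - x) / (t - s)) powr (p x - 1))"
        using limit_density_eq_exp[OF assms(2) x] .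
      have "exp (- \<eta>) * (sin (pi * p z) - pi * \<eta>) \<le> exp J * sin (pi * p x)"
        using J(1) sin_close[OF x] True \<eta> by (intro mult_mono) auto
      then have 1: "exp (- \<eta>) * (sin (pi * p z) - pi * \<eta>) / (pi * (t - s)) \<le> exp J * sin (pi * p x) / (pi * (t - s))"
        using assms by (intro divide_right_mono) auto
      have 2: "((x - s) / (t - s)) powr (1 - p z + \<eta> - 1) \<le> ((x - s) / (t - s)) powr (- p x)"
        using close[OF x] by (intro powr_mono' y x) auto
      have 3: "((t - x) / (t - s)) powr (p z + \<eta> - 1) \<le> ((t - x) / (t - s)) powr (p x - 1)"
        using close[OF x] by (intro powr_mono' y x) auto
      have "exp (- \<eta>) * (sin (pi * p z) - pi * \<eta>) / (pi * (t - s)) *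
          (((x - s) / (t - s)) powr (1 - p z + \<eta> - 1) * ((t - x) / (t - s)) powr (p z + \<eta> - 1)) \<le> limit_density s t x"
        unfolding J(2) using assms sin_p_nonneg True by (intro mult_mono 1 2 3) auto
      then show "exp (- \<eta>) * (sin (pi * p z) - pi * \<eta>) / pi / (t - s) *
          (((x - s) / (t - s)) powr (1 - p z + \<eta> - 1) * ((t - x) / (t - s)) powr (p z + \<eta> - 1)) \<le> limit_density s t x"
        by simp
    qed (use assms(1) P delta_pos \<eta>0 True in auto)
    then show ?thesis by (simp add: beta_majorant_def)
  next
    case False
    have "beta_majorant (p z) (- \<eta>) \<le> 0" unfolding beta_majorant_def
      using False P delta_pos \<eta>0
      by (intro mult_nonpos_nonneg divide_nonpos_nonneg mult_nonneg_nonpos Beta_nonneg) auto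
    then show ?thesis by (simp add: ennreal_neg)
  qed
qed

section \<open>Intervals with break points\<close>

lemma delta_less_1: "\<delta> < 1"
  using p_ge[of 0] p_less_1[of 0] by simp

text \<open>The cut point is counted on neither side. When it is itself a break point, the total
  drops, which drives the induction for \<open>limit_mass_bounded\<close>.\<close>

lemma card_breaks_split:
  assumes "c \<in> {s<..<t}"
  shows "card (S \<inter> {s<..<c}) + card (S \<inter> {c<..<t}) \<le> card (S \<inter> {s<..<t} - {c})"
proof -
  have "card (S \<inter> {s<..<c}) + card (S \<inter> {c<..<t}) = card (S \<inter> {s<..<c} \<union> S \<inter> {c<..<t})"
    using finite_S by (intro card_Un_disjoint[symmetric]) auto
  also have "\<dots> \<le> card (S \<inter> {s<..<t} - {c})"
    using assms finite_S by (intro card_mono) auto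
  finally show ?thesis .
qed

text \<open>Cutting at each interior break point leaves one more piece than there are break points;
  subadditivity adds up their crude bounds.\<close>

lemma limit_mass_bounded:
  assumes "s < t" "t - s \<le> \<Lambda>"
  shows "limit_mass UNIV s t \<le>
    ennreal ((real (card (S \<inter> {s<..<t})) + 1) * (exp (L * \<Lambda>) / pi * Beta \<delta> \<delta>))"
  using assms
proof (induction "card (S \<inter> {s<..<t})" arbitrary: s t rule: less_induct)
  case less
  define B where "B = exp (L * \<Lambda>) / pi * Beta \<delta> \<delta>"
  have B: "0 \<le> B" using delta_pos by (simp add: B_def Beta_nonneg)
  show ?case
  proof (cases "S \<inter> {s<..<t} = {}")
    case True
    then show ?thesis
      using limit_mass_no_break_bounded[OF less.prems] by (simp add: Int_commute)
  next
    case False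
    then obtain c where c: "c \<in> S" "s < c" "c < t" by auto
    have "card (S \<inter> {s<..<t} - {c}) < card (S \<inter> {s<..<t})"
      using c finite_S by (intro card_Diff1_less) auto
    then have cards: "card (S \<inter> {s<..<c}) + card (S \<inter> {c<..<t}) < card (S \<inter> {s<..<t})"
      using card_breaks_split[of c s t] c by simp
    have "limit_mass UNIV s t \<le> limit_mass UNIV s c + limit_mass UNIV c t"
      using c by (intro limit_mass_subadditive) auto
    also have "\<dots> \<le> ennreal ((real (card (S \<inter> {s<..<c})) + 1) * B) + ennreal ((real (card (S \<inter> {c<..<t})) + 1) * B)"
      unfolding B_def by (intro add_mono less.hyps) (use c cards less.prems in auto)
    also have "\<dots> = ennreal ((real (card (S \<inter> {s<..<c})) + 1) * B + (real (card (S \<inter> {c<..<t})) + 1) * B)"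
      using B by (intro ennreal_plus[symmetric]) auto
    also have "\<dots> \<le> ennreal ((real (card (S \<inter> {s<..<t})) + 1) * B)"
    proof (rule ennreal_leI)
      have "(real (card (S \<inter> {s<..<c})) + 1) * B + (real (card (S \<inter> {c<..<t})) + 1) * B =
          (real (card (S \<inter> {s<..<c}) + card (S \<inter> {c<..<t}) + 1) + 1) * B"
        by (simp add: algebra_simps)
      also have "\<dots> \<le> (real (card (S \<inter> {s<..<t})) + 1) * B"
        using cards B by (intro mult_right_mono) auto
      finally show "(real (card (S \<inter> {s<..<c})) + 1) * B + (real (card (S \<inter> {c<..<t})) + 1) * B
        \<le> (real (card (S \<inter> {s<..<t})) + 1) * B" .
    qed
    finally show ?thesis unfolding B_def .
  qed
qed

text \<open>
  One step of the walk shrinks the expectation of \<open>\<kappa>(s, t)\<close> by a factor \<open>1 - \<delta>\<close>, for every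
  measure \<open>\<kappa>\<close>; here \<open>\<kappa>\<close> is \<open>C\<close> times Lebesgue measure plus \<open>M\<close> times the counting
  measure of the break points.
\<close>

lemma subharmonic_eq_0:
  fixes F :: "real \<Rightarrow> real \<Rightarrow> ennreal"
  assumes C: "0 \<le> C" and M: "0 \<le> M"
    and bound: "\<And>s t. s < t \<Longrightarrow> t - s \<le> \<Lambda> \<Longrightarrow>
      F s t \<le> ennreal (C * (t - s) + M * real (card (S \<inter> {s<..<t})))"
    and sub: "\<And>s t. s < t \<Longrightarrow> t - s \<le> \<Lambda> \<Longrightarrow> ennreal (t - s) * F s t \<le>
      (\<integral>\<^sup>+u. (ennreal (p u) * F s u + ennreal (1 - p u) * F u t) * indicator {s<..<t} u \<partial>lborel)"
    and st: "s < t" "t - s \<le> \<Lambda>"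
  shows "F s t = 0"
proof -
  define W where "W s t = C * (t - s) + M * real (card (S \<inter> {s<..<t}))" for s t
  have W_nonneg: "0 \<le> W s t" if "s < t" for s t using that C M by (simp add: W_def)
  have W: "p u * W s u + (1 - p u) * W u t \<le> (1 - \<delta>) * W s t" if "s < u" "u < t" for s t u
  proof -
    have "real (card (S \<inter> {s<..<u})) + real (card (S \<inter> {u<..<t})) \<le> real (card (S \<inter> {s<..<t} - {u}))"
      using card_breaks_split[of u s t] that by simp
    also have "\<dots> \<le> real (card (S \<inter> {s<..<t}))"
      using finite_S by (intro of_nat_mono card_mono) auto
    finally have "M * (real (card (S \<inter> {s<..<u})) + real (card (S \<inter> {u<..<t}))) \<le> M * real (card (S \<inter> {s<..<t}))"
      using M by (rule mult_left_mono)
    then have "W s u + W u t \<le> W s t" by (simp add: W_def algebra_simps)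
    then have "(1 - \<delta>) * (W s u + W u t) \<le> (1 - \<delta>) * W s t"
      using delta_less_1 by (intro mult_left_mono) auto
    moreover have "p u * W s u + (1 - p u) * W u t \<le> (1 - \<delta>) * W s u + (1 - \<delta>) * W u t"
      using that p_le[of u] p_ge[of u] by (intro add_mono mult_right_mono W_nonneg) auto
    ultimately show ?thesis by (simp add: algebra_simps)
  qed
  have F: "F s t \<le> ennreal ((1 - \<delta>) ^ n * W s t)" if "s < t" "t - s \<le> \<Lambda>" for s t n
    using that
  proof (induction n arbitrary: s t)
    case 0
    then show ?case using bound by (simp add: W_def)
  next
    case (Suc n)
    have "ennreal (t - s) * F s t \<le>
        (\<integral>\<^sup>+u. (ennreal (p u) * F s u + ennreal (1 - p u) * F u t) * indicator {s<..<t} u \<partial>lborel)"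
      using Suc.prems by (rule sub)
    also have "\<dots> \<le> (\<integral>\<^sup>+u. ennreal ((1 - \<delta>) ^ Suc n * W s t) * indicator {s<..<t} u \<partial>lborel)"
    proof (intro nn_integral_mono)
      fix u
      show "(ennreal (p u) * F s u + ennreal (1 - p u) * F u t) * indicator {s<..<t} u \<le>
          ennreal ((1 - \<delta>) ^ Suc n * W s t) * indicator {s<..<t} u"
      proof (cases "u \<in> {s<..<t}")
        case True
        then have u: "s < u" "u < t" by auto
        have "ennreal (p u) * F s u + ennreal (1 - p u) * F u t \<le>
            ennreal (p u) * ennreal ((1 - \<delta>) ^ n * W s u) + ennreal (1 - p u) * ennreal ((1 - \<delta>) ^ n * W u t)"
          using u Suc.prems by (intro add_mono mult_left_mono Suc.IH) auto
        also have "\<dots> = ennreal (p u * ((1 - \<delta>) ^ n * W s u) + (1 - p u) * ((1 - \<delta>) ^ n * W u t))"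
          using u p_pos[of u] p_less_1[of u] delta_less_1 W_nonneg[of s u] W_nonneg[of u t]
          by (subst ennreal_plus) (simp_all add: ennreal_mult)
        also have "\<dots> = ennreal ((1 - \<delta>) ^ n * (p u * W s u + (1 - p u) * W u t))"
          by (simp add: algebra_simps)
        also have "\<dots> \<le> ennreal ((1 - \<delta>) ^ n * ((1 - \<delta>) * W s t))"
          using W[OF u] delta_less_1 by (intro ennreal_leI mult_left_mono) auto
        finally show ?thesis using True by (simp add: mult_ac)
      qed simp
    qed
    also have "\<dots> = ennreal (t - s) * ennreal ((1 - \<delta>) ^ Suc n * W s t)"
      using Suc.prems by (subst nn_integral_cmult_indicator) (auto simp: mult.commute)
    finally show ?case
      using Suc.prems by (subst (asm) ennreal_mult_le_mult_iff) auto
  qed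
  have "(\<lambda>n. (1 - \<delta>) ^ n * W s t) \<longlonglongrightarrow> 0 * W s t"
    using delta_pos delta_less_1 by (intro tendsto_intros LIMSEQ_power_zero) auto
  then have "(\<lambda>n. ennreal ((1 - \<delta>) ^ n * W s t)) \<longlonglongrightarrow> ennreal 0"
    by (intro tendsto_ennrealI) simp
  then have "F s t \<le> ennreal 0"
    by (rule LIMSEQ_le_const) (use F[OF st] in auto)
  then show ?thesis by simp
qed

text \<open>The excess of the mass over \<open>1 + \<epsilon>\<close> and its deficit below
  \<open>1 - \<epsilon>\<close> are bounded by \<open>M\<close> and vanish on short intervals free
  of break points. As positive parts of differences of harmonic functions they are subharmonic, so
  \<open>subharmonic_eq_0\<close> removes them. Subtraction in \<open>ennreal\<close> truncates at 0
  and thus is the positive part.\<close>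

lemma limit_mass_eq_1:
  assumes "s < t"
  shows "limit_mass UNIV s t = 1"
proof -
  \<comment> \<open>Splitting never lengthens an interval, so the given length bounds all those that
    occur.\<close>
  define \<Lambda> where "\<Lambda> = t - s"
  \<comment> \<open>The \<open>max 1\<close> lets \<open>M\<close> dominate the deficit as
    well.\<close>
  define M where "M = max 1 ((real (card S) + 1) * (exp (L * \<Lambda>) / pi * Beta \<delta> \<delta>))"
  have M: "1 \<le> M" by (simp add: M_def)
  have mass_le_M: "limit_mass UNIV s t \<le> ennreal M" if "s < t" "t - s \<le> \<Lambda>" for s t
  proof -
    have "(real (card (S \<inter> {s<..<t})) + 1) * (exp (L * \<Lambda>) / pi * Beta \<delta> \<delta>) \<le>
        (real (card S) + 1) * (exp (L * \<Lambda>) / pi * Beta \<delta> \<delta>)"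
      using finite_S delta_pos
      by (intro mult_right_mono mult_nonneg_nonneg Beta_nonneg) (auto intro!: card_mono)
    then have "(real (card (S \<inter> {s<..<t})) + 1) * (exp (L * \<Lambda>) / pi * Beta \<delta> \<delta>) \<le> M"
      by (simp add: M_def)
    then show ?thesis
      using limit_mass_bounded[OF that] by (meson ennreal_leI order_trans)
  qed
  have harm: "ennreal (t - s) * limit_mass UNIV s t =
    (\<integral>\<^sup>+u. (ennreal (p u) * limit_mass UNIV s u + ennreal (1 - p u) * limit_mass UNIV u t) *
      indicator {s<..<t} u \<partial>lborel)" if "s < t" for s t
    using limit_mass_harmonic[of UNIV s t] that
    by (simp, intro nn_integral_cong_AE)
       (use AE_lborel_singleton[of s] AE_lborel_singleton[of t] in eventually_elim, auto simp: indicator_def)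
  have pq: "ennreal (p u) + ennreal (1 - p u) = 1" for u
    using p_pos[of u] p_less_1[of u] by (subst ennreal_plus[symmetric]) auto
  \<comment> \<open>Constants are harmonic because the two weights add up to 1; this is what permits
    subtracting one from the mass.\<close>
  have split: "ennreal (p u) * (c + x) + ennreal (1 - p u) * (c + y) =
      c + (ennreal (p u) * x + ennreal (1 - p u) * y)" for u c x y
  proof -
    have "ennreal (p u) * (c + x) + ennreal (1 - p u) * (c + y) =
        (ennreal (p u) + ennreal (1 - p u)) * c + (ennreal (p u) * x + ennreal (1 - p u) * y)"
      by (simp add: distrib_left distrib_right add_ac)
    then show ?thesis by (simp add: pq)
  qed
  have both: "limit_mass UNIV s t \<le> ennreal (1 + \<epsilon>) \<and> ennreal (1 - \<epsilon>) \<le> limit_mass UNIV s t"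
    if \<epsilon>: "0 < \<epsilon>" "\<epsilon> < 1" for \<epsilon>
  proof -
    obtain \<eta>0 where \<eta>0: "0 < \<eta>0" "\<eta>0 \<le> \<delta> / 2"
      "\<And>P \<eta>. \<delta> \<le> P \<Longrightarrow> P \<le> 1 - \<delta> \<Longrightarrow> \<bar>\<eta>\<bar> \<le> \<eta>0 \<Longrightarrow> \<bar>beta_majorant P \<eta> - 1\<bar> \<le> \<epsilon>"
      using beta_majorant_near_1[OF delta_pos delta_less_1 \<epsilon>(1)] by blast
    \<comment> \<open>Chosen to give \<open>L * r \<le> \<eta>0\<close>; the denominator
      \<open>L + 1\<close> is positive even if \<open>L = 0\<close>.\<close>
    define r where "r = \<eta>0 / (L + 1)"
    have r: "0 < r" using \<eta>0 L_nonneg by (simp add: r_def)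
    have small: "limit_mass UNIV s t \<le> ennreal (1 + \<epsilon>)" "ennreal (1 - \<epsilon>) \<le> limit_mass UNIV s t"
      if st: "s < t" "t - s \<le> r" "S \<inter> {s<..<t} = {}" for s t
    proof -
      define \<eta> where "\<eta> = L * (t - s)"
      have "L * (t - s) \<le> (L + 1) * r" using st L_nonneg by (intro mult_mono) auto
      also have "\<dots> = \<eta>0" using L_nonneg by (simp add: r_def)
      finally have \<eta>: "\<eta> \<le> \<eta>0" "0 \<le> \<eta>" using st L_nonneg by (simp_all add: \<eta>_def)
      have dis: "{s<..<t} \<inter> S = {}" using st by (simp add: Int_commute)
      obtain P where P: "\<delta> \<le> P" "P \<le> 1 - \<delta>" "limit_mass UNIV s t \<le> ennreal (beta_majorant P \<eta>)"
        "ennreal (beta_majorant P (- \<eta>)) \<le> limit_mass UNIV s t"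
        using limit_mass_between_beta_majorants[OF st(1) dis \<eta>_def] \<eta> \<eta>0(2) by (metis order_trans)
      have "\<bar>beta_majorant P \<eta> - 1\<bar> \<le> \<epsilon>" "\<bar>beta_majorant P (- \<eta>) - 1\<bar> \<le> \<epsilon>"
        using P \<eta> by (auto intro!: \<eta>0(3))
      then have "ennreal (beta_majorant P \<eta>) \<le> ennreal (1 + \<epsilon>)" "ennreal (1 - \<epsilon>) \<le> ennreal (beta_majorant P (- \<eta>))"
        by - (rule ennreal_leI, linarith)+
      with P show "limit_mass UNIV s t \<le> ennreal (1 + \<epsilon>)" "ennreal (1 - \<epsilon>) \<le> limit_mass UNIV s t"
        by (meson order_trans)+
    qed
    have bound: "G s t \<le> ennreal (M / r * (t - s) + M * real (card (S \<inter> {s<..<t})))"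
      if "s < t" "G s t \<le> ennreal M" "t - s \<le> r \<Longrightarrow> S \<inter> {s<..<t} = {} \<Longrightarrow> G s t = 0"
      for G :: "real \<Rightarrow> real \<Rightarrow> ennreal" and s t
    \<comment> \<open>On an interval longer than \<open>r\<close> the length term alone exceeds
      \<open>M\<close>; on one with a break point the counting term reaches it.\<close>
    proof (cases "t - s \<le> r \<and> S \<inter> {s<..<t} = {}")
      case False
      have "M \<le> M / r * (t - s) + M * real (card (S \<inter> {s<..<t}))"
      proof (cases "S \<inter> {s<..<t} = {}")
        case True
        then have "M / r * r \<le> M / r * (t - s)" using False M r by (intro mult_left_mono) auto
        then show ?thesis using r True by simp
      next
        case f: False
        then have "1 \<le> card (S \<inter> {s<..<t})" using finite_S by (simp add: Suc_le_eq card_gt_0_iff)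
        then have "M * 1 \<le> M * real (card (S \<inter> {s<..<t}))" using M by (intro mult_left_mono) auto
        moreover have "0 \<le> M / r * (t - s)" using M r that(1) by simp
        ultimately show ?thesis by simp
      qed
      then show ?thesis using that(2) by (meson ennreal_leI order_trans)
    qed (use that in auto)
    define F1 where "F1 s t = limit_mass UNIV s t - ennreal (1 + \<epsilon>)" for s t
    define F2 where "F2 s t = ennreal (1 - \<epsilon>) - limit_mass UNIV s t" for s t
    have [measurable]: "(\<lambda>u. F1 s u) \<in> borel_measurable borel" "(\<lambda>u. F1 u t) \<in> borel_measurable borel"
      "(\<lambda>u. F2 s u) \<in> borel_measurable borel" "(\<lambda>u. F2 u t) \<in> borel_measurable borel" for s t
      unfolding F1_def F2_def by measurable
    have Mr: "0 \<le> M / r" "0 \<le> M" using M r by auto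
    have st: "s < t" "t - s \<le> \<Lambda>" using assms by (auto simp: \<Lambda>_def)
    have "F1 s t = 0"
    proof (rule subharmonic_eq_0[OF Mr _ _ st])
      fix s t assume st: "s < t" "t - s \<le> \<Lambda>"
      show "F1 s t \<le> ennreal (M / r * (t - s) + M * real (card (S \<inter> {s<..<t})))"
      proof (rule bound)
        show "F1 s t \<le> ennreal M"
          using mass_le_M[OF st] by (auto simp: F1_def intro: order_trans[OF diff_le_self_ennreal])
        show "F1 s t = 0" if "t - s \<le> r" "S \<inter> {s<..<t} = {}"
          using small(1)[OF st(1) that] le_less_trans[OF small(1)[OF st(1) that] ennreal_less_top]
          by (simp add: F1_def diff_eq_0_iff_ennreal)
      qed fact
      define I where "I = (\<integral>\<^sup>+u. (ennreal (p u) * F1 s u + ennreal (1 - p u) * F1 u t) * indicator {s<..<t} u \<partial>lborel)"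
      have le: "limit_mass UNIV s t \<le> ennreal (1 + \<epsilon>) + F1 s t" for s t
        unfolding F1_def using ennreal_minus_le_iff[of "limit_mass UNIV s t" "ennreal (1 + \<epsilon>)"] by auto
      have "ennreal (t - s) * limit_mass UNIV s t \<le> (\<integral>\<^sup>+u. ennreal (1 + \<epsilon>) * indicator {s<..<t} u +
          (ennreal (p u) * F1 s u + ennreal (1 - p u) * F1 u t) * indicator {s<..<t} u \<partial>lborel)"
        unfolding harm[OF st(1)]
      proof (intro nn_integral_mono)
        fix u
        have "ennreal (p u) * limit_mass UNIV s u + ennreal (1 - p u) * limit_mass UNIV u t \<le>
            ennreal (p u) * (ennreal (1 + \<epsilon>) + F1 s u) + ennreal (1 - p u) * (ennreal (1 + \<epsilon>) + F1 u t)"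
          by (intro add_mono mult_left_mono le) auto
        then show "(ennreal (p u) * limit_mass UNIV s u + ennreal (1 - p u) * limit_mass UNIV u t) * indicator {s<..<t} u \<le>
          ennreal (1 + \<epsilon>) * indicator {s<..<t} u + (ennreal (p u) * F1 s u + ennreal (1 - p u) * F1 u t) * indicator {s<..<t} u"
          unfolding split by (cases "u \<in> {s<..<t}") auto
      qed
      also have "\<dots> = ennreal (1 + \<epsilon>) * ennreal (t - s) + I"
        unfolding I_def using st by (subst nn_integral_add) (auto simp: nn_integral_cmult_indicator)
      finally have "ennreal (t - s) * limit_mass UNIV s t - ennreal (t - s) * ennreal (1 + \<epsilon>) \<le> I"
        by (subst ennreal_minus_le_iff) (simp add: mult.commute ennreal_mult_eq_top_iff)
      then show "ennreal (t - s) * F1 s t \<le> I"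
        by (simp add: F1_def ennreal_right_diff_distrib)
    qed
    moreover have "F2 s t = 0"
    proof (rule subharmonic_eq_0[OF Mr _ _ st])
      fix s t assume st: "s < t" "t - s \<le> \<Lambda>"
      show "F2 s t \<le> ennreal (M / r * (t - s) + M * real (card (S \<inter> {s<..<t})))"
      proof (rule bound)
        have "ennreal (1 - \<epsilon>) \<le> ennreal M" using M \<epsilon> by (intro ennreal_leI) auto
        then show "F2 s t \<le> ennreal M"
          by (auto simp: F2_def intro: order_trans[OF diff_le_self_ennreal])
        show "F2 s t = 0" if "t - s \<le> r" "S \<inter> {s<..<t} = {}"
          using small[OF st(1) that] by (simp add: F2_def diff_eq_0_iff_ennreal)
      qed fact
      define I where "I = (\<integral>\<^sup>+u. (ennreal (p u) * F2 s u + ennreal (1 - p u) * F2 u t) * indicator {s<..<t} u \<partial>lborel)"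
      have le: "ennreal (1 - \<epsilon>) \<le> limit_mass UNIV s t + F2 s t" for s t
        unfolding F2_def using ennreal_minus_le_iff[of "ennreal (1 - \<epsilon>)" "limit_mass UNIV s t"] by auto
      have "ennreal (1 - \<epsilon>) * ennreal (t - s) = (\<integral>\<^sup>+u. ennreal (1 - \<epsilon>) * indicator {s<..<t} u \<partial>lborel)"
        using st by (simp add: nn_integral_cmult_indicator)
      also have "\<dots> \<le> (\<integral>\<^sup>+u. (ennreal (p u) * limit_mass UNIV s u + ennreal (1 - p u) * limit_mass UNIV u t) * indicator {s<..<t} u +
          (ennreal (p u) * F2 s u + ennreal (1 - p u) * F2 u t) * indicator {s<..<t} u \<partial>lborel)"
      proof (intro nn_integral_mono)
        fix u
        have "ennreal (1 - \<epsilon>) = ennreal (p u) * ennreal (1 - \<epsilon>) + ennreal (1 - p u) * ennreal (1 - \<epsilon>)"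
          unfolding distrib_right[symmetric] pq by simp
        also have "\<dots> \<le> ennreal (p u) * (limit_mass UNIV s u + F2 s u) + ennreal (1 - p u) * (limit_mass UNIV u t + F2 u t)"
          by (intro add_mono mult_left_mono le) auto
        also have "\<dots> = (ennreal (p u) * limit_mass UNIV s u + ennreal (1 - p u) * limit_mass UNIV u t) +
            (ennreal (p u) * F2 s u + ennreal (1 - p u) * F2 u t)"
          by (simp add: distrib_left add_ac)
        finally show "ennreal (1 - \<epsilon>) * indicator {s<..<t} u \<le>
          (ennreal (p u) * limit_mass UNIV s u + ennreal (1 - p u) * limit_mass UNIV u t) * indicator {s<..<t} u +
          (ennreal (p u) * F2 s u + ennreal (1 - p u) * F2 u t) * indicator {s<..<t} u"
          by (cases "u \<in> {s<..<t}") auto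
      qed
      also have "\<dots> = ennreal (t - s) * limit_mass UNIV s t + I"
        unfolding I_def harm[OF st(1)] by (rule nn_integral_add) measurable
      finally have "ennreal (t - s) * ennreal (1 - \<epsilon>) - ennreal (t - s) * limit_mass UNIV s t \<le> I"
        by (subst ennreal_minus_le_iff) (simp add: mult.commute ennreal_mult_eq_top_iff)
      then show "ennreal (t - s) * F2 s t \<le> I"
        by (simp add: F2_def ennreal_right_diff_distrib)
    qed
    ultimately show ?thesis
      by (simp add: F1_def F2_def diff_eq_0_iff_ennreal)
  qed
  show ?thesis
  proof (rule antisym)
    show "limit_mass UNIV s t \<le> 1"
    proof (rule ennreal_le_epsilon)
      fix e :: real assume e: "0 < e"
      have "limit_mass UNIV s t \<le> ennreal (1 + min e (1/2))" using both[of "min e (1/2)"] e by auto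
      also have "\<dots> \<le> ennreal (1 + e)" by (intro ennreal_leI) auto
      also have "\<dots> = 1 + ennreal e" using e by (subst ennreal_plus) auto
      finally show "limit_mass UNIV s t \<le> 1 + ennreal e" .
    qed
    show "1 \<le> limit_mass UNIV s t"
    proof (rule ennreal_le_epsilon)
      fix e :: real assume e: "0 < e"
      have "1 = ennreal (1 - min e (1/2)) + ennreal (min e (1/2))"
        using e by (subst ennreal_plus[symmetric]) auto
      also have "\<dots> \<le> limit_mass UNIV s t + ennreal e"
        using both[of "min e (1/2)"] e by (intro add_mono ennreal_leI) auto
      finally show "1 \<le> limit_mass UNIV s t + ennreal e" .
    qed
  qed
qed

end

section \<open>Chains of nested intervals\<close>

text \<open>Forgetting all coordinates pushes the law forward to a Dirac measure, and a pushforward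
  has the same total mass.\<close>

lemma prob_space_chain_law:
  assumes \<mu>: "\<mu> \<in> space (prob_algebra M)" and K: "K \<in> M \<rightarrow>\<^sub>M prob_algebra M"
  shows "prob_space (chain_law M \<mu> K)"
proof (rule prob_space_distrD)
  show "(\<lambda>w. restrict w {0..<0::nat}) \<in> chain_law M \<mu> K \<rightarrow>\<^sub>M PiM {0..<0::nat} (\<lambda>_. M)"
    unfolding measurable_cong_sets[OF sets_chain_law[OF \<mu> K] refl]
    by (intro measurable_restrict measurable_component_singleton) auto
  show "prob_space (distr (chain_law M \<mu> K) (PiM {0..<0::nat} (\<lambda>_. M)) (\<lambda>w. restrict w {0..<0}))"
    using chain_law_Suc(1)[OF \<mu> K] by (simp, intro prob_space_return) (simp add: space_PiM)
qed

lemma measurable_chain_component: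
  assumes "\<mu> \<in> space (prob_algebra M)" "K \<in> M \<rightarrow>\<^sub>M prob_algebra M"
  shows "(\<lambda>X. X n) \<in> chain_law M \<mu> K \<rightarrow>\<^sub>M M"
  unfolding measurable_cong_sets[OF sets_chain_law[OF assms] refl]
  by (intro measurable_component_singleton) auto

lemma nn_integral_chain_law_step:
  assumes \<mu>: "\<mu> \<in> space (prob_algebra M)" and K: "K \<in> M \<rightarrow>\<^sub>M prob_algebra M"
    and g: "g \<in> borel_measurable (PiM {0..<Suc n} (\<lambda>_. M))"
  shows "(\<integral>\<^sup>+X. g (restrict X {0..<Suc n}) \<partial>chain_law M \<mu> K) =
    (\<integral>\<^sup>+X. (\<integral>\<^sup>+y. g ((restrict X {0..<n})(n := y)) \<partial>chain_kernel \<mu> K n (restrict X {0..<n})) \<partial>chain_law M \<mu> K)"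
proof -
  interpret Ionescu_Tulcea "chain_kernel \<mu> K" "\<lambda>_. M"
    by (rule Ionescu_Tulcea_chain_kernel) fact+
  define first where "first n = distr (chain_law M \<mu> K) (PiM {0..<n} (\<lambda>_. M)) (\<lambda>w. restrict w {0..<n})" for n
  have restr: "(\<lambda>w. restrict w {0..<n}) \<in> chain_law M \<mu> K \<rightarrow>\<^sub>M PiM {0..<n} (\<lambda>_. M)" for n
    unfolding measurable_cong_sets[OF sets_chain_law[OF \<mu> K] refl]
    by (intro measurable_restrict measurable_component_singleton) auto
  have Suc: "first (Suc n) = first n \<bind> eP n"
    using chain_law_Suc(2)[OF \<mu> K, of n] by (simp add: first_def eP_def[abs_def])
  have eP: "eP n \<in> first n \<rightarrow>\<^sub>M subprob_algebra (PiM {0..<Suc n} (\<lambda>_. M))"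
    by (simp add: first_def)
  have "(\<integral>\<^sup>+X. g (restrict X {0..<Suc n}) \<partial>chain_law M \<mu> K) = (\<integral>\<^sup>+w. g w \<partial>first (Suc n))"
    unfolding first_def by (rule nn_integral_distr[symmetric, OF restr]) (simp add: g)
  also have "\<dots> = (\<integral>\<^sup>+w. (\<integral>\<^sup>+v. g v \<partial>eP n w) \<partial>first n)"
    unfolding Suc by (rule nn_integral_bind[OF g eP])
  also have "\<dots> = (\<integral>\<^sup>+X. (\<integral>\<^sup>+v. g v \<partial>eP n (restrict X {0..<n})) \<partial>chain_law M \<mu> K)"
    unfolding first_def
    using measurable_compose[OF measurable_eP nn_integral_measurable_subprob_algebra[OF g]]
    by (intro nn_integral_distr restr) simp
  also have "\<dots> = (\<integral>\<^sup>+X. (\<integral>\<^sup>+y. g ((restrict X {0..<n})(n := y)) \<partial>chain_kernel \<mu> K n (restrict X {0..<n})) \<partial>chain_law M \<mu> K)"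
    by (intro nn_integral_cong nn_integral_eP g measurable_space[OF restr]) simp
  finally show ?thesis .
qed

lemma nn_integral_chain_law_0:
  assumes \<mu>: "\<mu> \<in> space (prob_algebra M)" and K: "K \<in> M \<rightarrow>\<^sub>M prob_algebra M"
    and h: "h \<in> borel_measurable M"
  shows "(\<integral>\<^sup>+X. h (X 0) \<partial>chain_law M \<mu> K) = (\<integral>\<^sup>+x. h x \<partial>\<mu>)"
proof -
  interpret P: prob_space "chain_law M \<mu> K" by (rule prob_space_chain_law) fact+
  have "(\<lambda>w. h (w 0)) \<in> borel_measurable (PiM {0..<Suc 0} (\<lambda>_. M))"
    by (rule measurable_compose[OF _ h]) (auto intro!: measurable_component_singleton)
  from nn_integral_chain_law_step[OF \<mu> K this] show ?thesis
    by (simp add: chain_kernel_def P.emeasure_space_1)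
qed

lemma nn_integral_chain_law_Suc:
  assumes \<mu>: "\<mu> \<in> space (prob_algebra M)" and K: "K \<in> M \<rightarrow>\<^sub>M prob_algebra M"
    and h: "case_prod h \<in> borel_measurable (M \<Otimes>\<^sub>M M)"
  shows "(\<integral>\<^sup>+X. h (X n) (X (Suc n)) \<partial>chain_law M \<mu> K) =
    (\<integral>\<^sup>+X. (\<integral>\<^sup>+y. h (X n) y \<partial>K (X n)) \<partial>chain_law M \<mu> K)"
proof -
  have "(\<lambda>w. (w n, w (Suc n))) \<in> PiM {0..<Suc (Suc n)} (\<lambda>_. M) \<rightarrow>\<^sub>M M \<Otimes>\<^sub>M M"
    by (auto intro!: measurable_Pair measurable_component_singleton)
  from measurable_compose[OF this h]
  have "(\<lambda>w. h (w n) (w (Suc n))) \<in> borel_measurable (PiM {0..<Suc (Suc n)} (\<lambda>_. M))" by simp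
  from nn_integral_chain_law_step[OF \<mu> K this] show ?thesis
    by (simp add: chain_kernel_def)
qed

lemma AE_chain_law_0:
  assumes \<mu>: "\<mu> \<in> space (prob_algebra M)" and K: "K \<in> M \<rightarrow>\<^sub>M prob_algebra M"
    and [measurable]: "Measurable.pred M Q" and AE: "AE x in \<mu>. Q x"
  shows "AE X in chain_law M \<mu> K. Q (X 0)"
proof -
  have m: "(\<lambda>x. if Q x then 0 else 1 :: ennreal) \<in> borel_measurable M" by measurable
  note [measurable] = measurable_chain_component[OF \<mu> K]
  have "AE x in \<mu>. (if Q x then 0 else 1 :: ennreal) = 0" using AE by eventually_elim simp
  then have "(\<integral>\<^sup>+x. (if Q x then 0 else 1) \<partial>\<mu>) = (\<integral>\<^sup>+x. 0 \<partial>\<mu>)"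
    by (rule nn_integral_cong_AE)
  then have "(\<integral>\<^sup>+X. (if Q (X 0) then 0 else 1) \<partial>chain_law M \<mu> K) = 0"
    using nn_integral_chain_law_0[OF \<mu> K m] by simp
  then show ?thesis
    by (subst (asm) nn_integral_0_iff_AE) (auto split: if_splits)
qed

text \<open>The indicator of failure has integral 0 by the Markov property.\<close>

lemma AE_chain_law_Suc:
  assumes \<mu>: "\<mu> \<in> space (prob_algebra M)" and K: "K \<in> M \<rightarrow>\<^sub>M prob_algebra M"
    and [measurable]: "Measurable.pred (M \<Otimes>\<^sub>M M) (case_prod Q)"
    and AE: "AE X in chain_law M \<mu> K. AE y in K (X n). Q (X n) y"
  shows "AE X in chain_law M \<mu> K. Q (X n) (X (Suc n))"
proof -
  note [measurable] = measurable_chain_component[OF \<mu> K]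
  have [measurable]: "Measurable.pred N (\<lambda>w. Q (f w) (g w))"
    if [measurable]: "f \<in> N \<rightarrow>\<^sub>M M" "g \<in> N \<rightarrow>\<^sub>M M" for f g and N :: "'c measure"
  proof -
    have "Measurable.pred N (\<lambda>w. case_prod Q (f w, g w))" by measurable
    then show ?thesis by simp
  qed
  have ind[measurable]: "case_prod (\<lambda>x y. if Q x y then 0 else 1 :: ennreal) \<in> borel_measurable (M \<Otimes>\<^sub>M M)"
    by measurable
  have "(\<integral>\<^sup>+X. (if Q (X n) (X (Suc n)) then 0 else 1) \<partial>chain_law M \<mu> K) =
      (\<integral>\<^sup>+X. (\<integral>\<^sup>+y. (if Q (X n) y then 0 else 1) \<partial>K (X n)) \<partial>chain_law M \<mu> K)"
    by (rule nn_integral_chain_law_Suc[OF \<mu> K ind])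
  also have "\<dots> = (\<integral>\<^sup>+X. 0 \<partial>chain_law M \<mu> K)"
  proof (intro nn_integral_cong_AE, use AE in eventually_elim)
    fix X assume "AE y in K (X n). Q (X n) y"
    then have "AE y in K (X n). (if Q (X n) y then 0 else 1 :: ennreal) = 0" by eventually_elim simp
    then have "(\<integral>\<^sup>+y. (if Q (X n) y then 0 else 1) \<partial>K (X n)) = (\<integral>\<^sup>+y. 0 \<partial>K (X n))"
      by (rule nn_integral_cong_AE)
    then show "(\<integral>\<^sup>+y. (if Q (X n) y then 0 else 1) \<partial>K (X n)) = 0" by simp
  qed
  finally have "(\<integral>\<^sup>+X. (if Q (X n) (X (Suc n)) then 0 else 1) \<partial>chain_law M \<mu> K) = 0" by simp
  then show ?thesis
    by (subst (asm) nn_integral_0_iff_AE) (auto split: if_splits)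
qed

section \<open>Almost sure convergence and the law of the limit\<close>

text \<open>Nothing about hooks enters here: a state carries an interval, a step passes to a
  subinterval, and the mean length falls by the factor \<open>c\<close>. By
  \<open>separating\<close>, the collapse of the intervals to \<open>l\<close> forces the states
  themselves to converge, with first coordinate \<open>l\<close>.\<close>

locale nested_chain =
  fixes \<mu> :: "(real \<times> real) measure" and K :: "real \<times> real \<Rightarrow> (real \<times> real) measure"
    and lo hi :: "real \<times> real \<Rightarrow> real" and a b c :: real
  assumes init: "\<mu> \<in> space (prob_algebra borel)" and kernel: "K \<in> borel \<rightarrow>\<^sub>M prob_algebra borel"
    and lo[measurable]: "lo \<in> borel_measurable borel" and hi[measurable]: "hi \<in> borel_measurable borel"
    and start: "AE z in \<mu>. a \<le> lo z \<and> lo z \<le> hi z \<and> hi z \<le> b"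
    and nested: "\<And>z. a \<le> lo z \<Longrightarrow> lo z \<le> hi z \<Longrightarrow> hi z \<le> b \<Longrightarrow>
      AE z' in K z. lo z \<le> lo z' \<and> lo z' \<le> hi z' \<and> hi z' \<le> hi z"
    and c_nonneg: "0 \<le> c" and c_less_1: "c < 1"
    and contract: "\<And>z. a \<le> lo z \<Longrightarrow> lo z \<le> hi z \<Longrightarrow> hi z \<le> b \<Longrightarrow>
      (\<integral>\<^sup>+z'. ennreal (hi z' - lo z') \<partial>K z) \<le> ennreal c * ennreal (hi z - lo z)"
    and separating: "\<And>X l. (\<lambda>n. lo (X n)) \<longlonglongrightarrow> l \<Longrightarrow> (\<lambda>n. hi (X n)) \<longlonglongrightarrow> l \<Longrightarrow> \<exists>y. X \<longlonglongrightarrow> (l, y)"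
begin

abbreviation law :: "(nat \<Rightarrow> real \<times> real) measure" where
  "law \<equiv> chain_law borel \<mu> K"

definition inv_set :: "(real \<times> real) set" where
  "inv_set = {z. a \<le> lo z \<and> lo z \<le> hi z \<and> hi z \<le> b}"

sublocale law: prob_space law
  by (rule prob_space_chain_law[OF init kernel])

lemmas component_measurable[measurable] = measurable_chain_component[OF init kernel]

lemma sets_init[measurable_cong]: "sets \<mu> = sets borel"
  using init by (simp add: space_prob_algebra)

lemma inv_set_measurable[measurable]: "inv_set \<in> sets borel"
proof -
  have "inv_set = {z \<in> space borel. a \<le> lo z \<and> lo z \<le> hi z \<and> hi z \<le> b}" by (simp add: inv_set_def)
  also have "\<dots> \<in> sets borel" by measurable
  finally show ?thesis .
qed

lemma nested_step:
  assumes "AE X in law. X n \<in> inv_set"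
  shows "AE X in law. lo (X n) \<le> lo (X (Suc n)) \<and> lo (X (Suc n)) \<le> hi (X (Suc n)) \<and> hi (X (Suc n)) \<le> hi (X n)"
proof (rule AE_chain_law_Suc[OF init kernel, where Q = "\<lambda>z z'. lo z \<le> lo z' \<and> lo z' \<le> hi z' \<and> hi z' \<le> hi z"])
  show "AE X in law. AE y in K (X n). lo (X n) \<le> lo y \<and> lo y \<le> hi y \<and> hi y \<le> hi (X n)"
    using assms by eventually_elim (rule nested; simp add: inv_set_def)
qed measurable

lemma AE_inv_set: "AE X in law. X n \<in> inv_set"
proof (induction n)
  case 0
  have "AE z in \<mu>. z \<in> inv_set" using start by (simp add: inv_set_def)
  then show ?case by (intro AE_chain_law_0[OF init kernel]) auto
next
  case (Suc n)
  then show ?case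
    using nested_step[OF Suc] by eventually_elim (auto simp: inv_set_def)
qed

text \<open>The mean of a harmonic function is constant in time; harmonicity on
  \<open>inv_set\<close> suffices because the chain almost surely stays there.\<close>

lemma nn_integral_harmonic:
  assumes [measurable]: "V \<in> borel_measurable borel"
    and V: "\<And>z. z \<in> inv_set \<Longrightarrow> (\<integral>\<^sup>+z'. V z' \<partial>K z) = V z"
  shows "(\<integral>\<^sup>+X. V (X n) \<partial>law) = (\<integral>\<^sup>+z. V z \<partial>\<mu>)"
proof (induction n)
  case 0
  show ?case by (rule nn_integral_chain_law_0[OF init kernel]) measurable
next
  case (Suc n)
  have "(\<integral>\<^sup>+X. V (X (Suc n)) \<partial>law) = (\<integral>\<^sup>+X. (\<integral>\<^sup>+y. V y \<partial>K (X n)) \<partial>law)"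
    by (rule nn_integral_chain_law_Suc[OF init kernel, of "\<lambda>_ y. V y"]) measurable
  also have "\<dots> = (\<integral>\<^sup>+X. V (X n) \<partial>law)"
    by (intro nn_integral_cong_AE, use AE_inv_set[of n] in eventually_elim) (rule V)
  finally show ?case using Suc by simp
qed

lemma expected_length_le:
  "(\<integral>\<^sup>+X. ennreal (hi (X n) - lo (X n)) \<partial>law) \<le> ennreal (c ^ n * (b - a))"
proof (induction n)
  case 0
  have "(\<integral>\<^sup>+X. ennreal (hi (X 0) - lo (X 0)) \<partial>law) \<le> (\<integral>\<^sup>+X. ennreal (b - a) \<partial>law)"
    by (intro nn_integral_mono_AE, use AE_inv_set[of 0] in eventually_elim)
       (auto simp: inv_set_def intro!: ennreal_leI)
  then show ?case by (simp add: law.emeasure_space_1)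
next
  case (Suc n)
  have "(\<integral>\<^sup>+X. ennreal (hi (X (Suc n)) - lo (X (Suc n))) \<partial>law) =
      (\<integral>\<^sup>+X. (\<integral>\<^sup>+y. ennreal (hi y - lo y) \<partial>K (X n)) \<partial>law)"
    by (rule nn_integral_chain_law_Suc[OF init kernel, of "\<lambda>_ y. ennreal (hi y - lo y)"]) measurable
  also have "\<dots> \<le> (\<integral>\<^sup>+X. ennreal c * ennreal (hi (X n) - lo (X n)) \<partial>law)"
    by (intro nn_integral_mono_AE, use AE_inv_set[of n] in eventually_elim)
       (auto simp: inv_set_def intro!: contract)
  also have "\<dots> = ennreal c * (\<integral>\<^sup>+X. ennreal (hi (X n) - lo (X n)) \<partial>law)"
    by (rule nn_integral_cmult) measurable
  also have "\<dots> \<le> ennreal c * ennreal (c ^ n * (b - a))"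
    by (intro mult_left_mono Suc) auto
  also have "\<dots> = ennreal (c ^ Suc n * (b - a))"
    using c_nonneg by (simp add: ennreal_mult'[symmetric] mult_ac)
  finally show ?case .
qed

text \<open>The mean lengths are dominated by a geometric series, so the sum of all lengths has
  finite mean and is almost surely finite.\<close>

lemma AE_lengths_tendsto_0: "AE X in law. (\<lambda>n. hi (X n) - lo (X n)) \<longlonglongrightarrow> 0"
proof -
  have inv: "AE X in law. \<forall>n. X n \<in> inv_set" by (simp add: AE_all_countable AE_inv_set)
  have sm: "summable (\<lambda>n. c ^ n * (b - a))"
    using c_nonneg c_less_1 by (intro summable_mult2 summable_geometric) auto
  have "(\<integral>\<^sup>+X. (\<Sum>n. ennreal (hi (X n) - lo (X n))) \<partial>law) = (\<Sum>n. \<integral>\<^sup>+X. ennreal (hi (X n) - lo (X n)) \<partial>law)"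
    by (rule nn_integral_suminf) measurable
  also have "\<dots> \<le> (\<Sum>n. ennreal (c ^ n * \<bar>b - a\<bar>))"
    using c_nonneg
    by (intro suminf_le order_trans[OF expected_length_le] ennreal_leI mult_left_mono) auto
  also have "\<dots> < \<infinity>"
    using c_nonneg c_less_1
    by (simp add: less_top[symmetric] ennreal_suminf_neq_top summable_mult2 summable_geometric)
  finally have "AE X in law. (\<Sum>n. ennreal (hi (X n) - lo (X n))) \<noteq> \<infinity>"
    by (intro nn_integral_PInf_AE) auto
  with inv show ?thesis
  proof eventually_elim
    case (elim X)
    then have "summable (\<lambda>n. hi (X n) - lo (X n))"
      by (intro summable_suminf_not_top) (auto simp: inv_set_def)
    then show ?case by (rule summable_LIMSEQ_zero)
  qed
qed

text \<open>The lower ends increase and are bounded by \<open>b\<close>; the upper ends follow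
  because the lengths vanish.\<close>

lemma AE_converges:
  "AE X in law. \<exists>l y. (\<lambda>n. lo (X n)) \<longlonglongrightarrow> l \<and> (\<lambda>n. hi (X n)) \<longlonglongrightarrow> l \<and> X \<longlonglongrightarrow> (l, y)"
proof -
  have inv: "AE X in law. \<forall>n. X n \<in> inv_set" by (simp add: AE_all_countable AE_inv_set)
  have step: "AE X in law. \<forall>n. lo (X n) \<le> lo (X (Suc n))"
    unfolding AE_all_countable
  proof
    show "AE X in law. lo (X n) \<le> lo (X (Suc n))" for n
      using nested_step[OF AE_inv_set, of n] by eventually_elim simp
  qed
  from inv step AE_lengths_tendsto_0 show ?thesis
  proof eventually_elim
    case (elim X)
    have "incseq (\<lambda>n. lo (X n))" using elim(2) by (simp add: incseq_SucI)
    moreover have "lo (X n) \<le> b" for n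
      using elim(1) by (auto simp: inv_set_def intro: order_trans)
    ultimately obtain l where l: "(\<lambda>n. lo (X n)) \<longlonglongrightarrow> l"
      using incseq_convergent[of "\<lambda>n. lo (X n)" b] by blast
    have "(\<lambda>n. lo (X n) + (hi (X n) - lo (X n))) \<longlonglongrightarrow> l + 0"
      by (intro tendsto_add l elim(3))
    then have h: "(\<lambda>n. hi (X n)) \<longlonglongrightarrow> l" by simp
    with l separating[OF l h] show ?case by blast
  qed
qed

lemma limit_measurable[measurable]: "(\<lambda>X. fst (lim X)) \<in> borel_measurable law"
proof -
  have "(\<lambda>X. lim (\<lambda>n. X n)) \<in> law \<rightarrow>\<^sub>M borel" by measurable
  then show ?thesis by (simp add: borel_prod[symmetric]) measurable
qed

text \<open>
  If \<open>A\<close> is open and the walk tends to a point of \<open>A\<close>, its intervals end up inside \<open>A\<close>; hence, by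
  Fatou's lemma, the limit lies in \<open>A\<close> with probability at most the initial mean of any harmonic
  function that is at least \<open>1\<close> on the intervals contained in \<open>A\<close>.
\<close>

lemma limit_in_open_le:
  assumes A: "open A" and V[measurable]: "V \<in> borel_measurable borel"
    and harm: "\<And>z. z \<in> inv_set \<Longrightarrow> (\<integral>\<^sup>+z'. V z' \<partial>K z) = V z"
    and ge1: "\<And>z. z \<in> inv_set \<Longrightarrow> {lo z..hi z} \<subseteq> A \<Longrightarrow> 1 \<le> V z"
  shows "emeasure (distr law borel (\<lambda>X. fst (lim X))) A \<le> (\<integral>\<^sup>+z. V z \<partial>\<mu>)"
proof -
  have [measurable]: "A \<in> sets borel" using A by simp
  have inv: "AE X in law. \<forall>n. X n \<in> inv_set" by (simp add: AE_all_countable AE_inv_set)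
  have "emeasure (distr law borel (\<lambda>X. fst (lim X))) A = (\<integral>\<^sup>+X. indicator A (fst (lim X)) \<partial>law)"
    by (subst nn_integral_distr[symmetric, of "\<lambda>X. fst (lim X)" law borel "indicator A"]) auto
  also have "\<dots> \<le> (\<integral>\<^sup>+X. liminf (\<lambda>n. V (X n)) \<partial>law)"
  proof (intro nn_integral_mono_AE, use inv AE_converges in eventually_elim)
    case (elim X)
    then obtain l y where l: "(\<lambda>n. lo (X n)) \<longlonglongrightarrow> l" "(\<lambda>n. hi (X n)) \<longlonglongrightarrow> l" "X \<longlonglongrightarrow> (l, y)" by blast
    have lim: "fst (lim X) = l" using limI[OF l(3)] by simp
    show ?case
    proof (cases "l \<in> A")
      case True
      then obtain e where e: "0 < e" "ball l e \<subseteq> A" using A open_contains_ball by blast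
      have "\<forall>\<^sub>F n in sequentially. dist (lo (X n)) l < e" "\<forall>\<^sub>F n in sequentially. dist (hi (X n)) l < e"
        using l(1,2) e(1) by (auto dest: tendstoD)
      then have "\<forall>\<^sub>F n in sequentially. 1 \<le> V (X n)"
      proof eventually_elim
        case (elim n)
        have "{lo (X n)..hi (X n)} \<subseteq> ball l e"
          using elim by (auto simp: dist_real_def abs_less_iff)
        then show ?case using e(2) \<open>\<forall>n. X n \<in> inv_set\<close> by (intro ge1) auto
      qed
      then have "1 \<le> liminf (\<lambda>n. V (X n))" by (rule Liminf_bounded)
      then show ?thesis using True lim by simp
    qed (simp add: lim)
  qed
  also have "\<dots> \<le> liminf (\<lambda>n. \<integral>\<^sup>+X. V (X n) \<partial>law)"
    by (rule nn_integral_liminf) measurable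
  also have "\<dots> = (\<integral>\<^sup>+z. V z \<partial>\<mu>)"
    by (simp add: nn_integral_harmonic[OF V harm] Liminf_const)
  finally show ?thesis .
qed

text \<open>Fatou gives only an upper bound, and only on open sets. Both measures have total mass 1,
  so complements turn it into a lower bound on closed sets, and half-lines of both kinds pin down
  the distribution function.\<close>

theorem limit_distribution:
  fixes V :: "real set \<Rightarrow> real \<times> real \<Rightarrow> ennreal"
  assumes V: "\<And>A. open A \<Longrightarrow> V A \<in> borel_measurable borel"
    and harm: "\<And>A z. open A \<Longrightarrow> z \<in> inv_set \<Longrightarrow> (\<integral>\<^sup>+z'. V A z' \<partial>K z) = V A z"
    and ge1: "\<And>A z. open A \<Longrightarrow> z \<in> inv_set \<Longrightarrow> {lo z..hi z} \<subseteq> A \<Longrightarrow> 1 \<le> V A z"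
    and \<nu>: "real_distribution \<nu>" "\<And>A. open A \<Longrightarrow> (\<integral>\<^sup>+z. V A z \<partial>\<mu>) = emeasure \<nu> A"
  shows "distr law borel (\<lambda>X. fst (lim X)) = \<nu>"
proof -
  define N where "N = distr law borel (\<lambda>X. fst (lim X))"
  interpret \<nu>: real_distribution \<nu> by fact
  interpret N: real_distribution N
    unfolding N_def by (rule law.real_distribution_distr) measurable
  have le: "measure N A \<le> measure \<nu> A" if "open A" for A
  proof -
    have "emeasure N A \<le> emeasure \<nu> A"
      using limit_in_open_le[OF that V[OF that] harm[OF that] ge1[OF that]] \<nu>(2)[OF that]
      by (simp add: N_def)
    then show ?thesis by (simp add: N.emeasure_eq_measure \<nu>.emeasure_eq_measure)
  qed
  have "cdf N x = cdf \<nu> x" for x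
  proof (rule antisym)
    \<comment> \<open>\<open>{..x}\<close> is not open: it is enlarged to \<open>{..<y}\<close>, and
      right continuity closes the gap as \<open>y\<close> decreases to \<open>x\<close>.\<close>
    have "(cdf \<nu> \<longlongrightarrow> cdf \<nu> x) (at_right x)"
      using \<nu>.cdf_is_right_cont[of x] by (simp add: continuous_within)
    moreover have "\<forall>\<^sub>F y in at_right x. cdf N x \<le> cdf \<nu> y"
    proof (rule eventually_at_right_less[THEN eventually_mono])
      fix y assume "x < y"
      have "measure N {..x} \<le> measure N {..<y}"
        using \<open>x < y\<close> by (intro N.finite_measure_mono) auto
      also have "\<dots> \<le> measure \<nu> {..<y}" by (rule le) simp
      also have "\<dots> \<le> measure \<nu> {..y}" by (intro \<nu>.finite_measure_mono) auto
      finally show "cdf N x \<le> cdf \<nu> y" by (simp add: cdf_def)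
    qed
    ultimately show "cdf N x \<le> cdf \<nu> x"
      by (rule tendsto_lowerbound) simp
    \<comment> \<open>Here the open set is the complement \<open>{x<..}\<close>, whose upper bound
      becomes the lower bound for \<open>{..x}\<close>.\<close>
    have "measure \<nu> (UNIV - {x<..}) = 1 - measure \<nu> {x<..}"
      using \<nu>.prob_compl[of "{x<..}"] by simp
    moreover have "measure N (UNIV - {x<..}) = 1 - measure N {x<..}"
      using N.prob_compl[of "{x<..}"] by simp
    moreover have "UNIV - {x<..} = {..x}" by auto
    ultimately show "cdf \<nu> x \<le> cdf N x"
      using le[of "{x<..}"] by (simp add: cdf_def)
  qed
  then have "N = \<nu>"
    by (intro cdf_unique N.real_distribution_axioms \<nu>.real_distribution_axioms) auto
  then show ?thesis by (simp add: N_def)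
qed

end

section \<open>The geometry of hooks\<close>

locale increasing_profile =
  fixes h g :: "real \<Rightarrow> real" and S :: "real set" and m :: real
  assumes finite_breaks: "finite S" and h_continuous: "continuous_on UNIV h"
    and h_deriv: "\<And>x. x \<notin> S \<Longrightarrow> (h has_real_derivative g x) (at x)"
    and m_pos: "0 < m" and g_ge: "\<And>x. m \<le> g x" and g_measurable[measurable]: "g \<in> borel_measurable borel"
begin

lemma g_has_integral: "x \<le> y \<Longrightarrow> (g has_integral (h y - h x)) {x..y}"
proof (rule fundamental_theorem_of_calculus_interior_strong[OF finite_breaks])
  show "(h has_vector_derivative g u) (at u)" if "u \<in> {x<..<y} - S" for u
    using h_deriv[of u] that by (simp add: has_real_derivative_iff_has_vector_derivative)
  show "continuous_on {x..y} h" by (rule continuous_on_subset[OF h_continuous]) simp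
qed

lemma h_diff_ge:
  assumes "x \<le> y"
  shows "m * (y - x) \<le> h y - h x"
proof -
  have "((\<lambda>_. m) has_integral (y - x) *\<^sub>R m) {x..y}"
    using assms by (metis has_integral_const_real content_real)
  from has_integral_le[OF this g_has_integral[OF assms]] show ?thesis
    by (simp add: g_ge mult.commute)
qed

lemma h_less_iff: "h x < h y \<longleftrightarrow> x < y"
proof -
  have "h x < h y" if "x < y" for x y
    using h_diff_ge[of x y] that m_pos by (smt (verit) mult_pos_pos)
  then show ?thesis by (metis less_asym linorder_neqE_linordered_idom less_irrefl)
qed

lemma h_le_iff: "h x \<le> h y \<longleftrightarrow> x \<le> y"
  using h_less_iff[of y x] by linarith

lemma inj_h: "inj h"
  by (rule injI) (metis h_le_iff order_antisym order_refl)

lemma surj_h: "surj h"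
proof (rule surjI)
  show "h (SOME x. h x = v) = v" for v
  proof (rule someI_ex)
    \<comment> \<open>Since \<open>h\<close> grows at least at rate \<open>m\<close>, going the
      distance \<open>r\<close> from 0 is enough to reach \<open>v\<close>.\<close>
    define r where "r = \<bar>v - h 0\<bar> / m"
    have r: "0 \<le> r" "m * r = \<bar>v - h 0\<bar>" using m_pos by (simp_all add: r_def)
    have "h (- r) \<le> v" "v \<le> h r"
      using h_diff_ge[of "- r" 0] h_diff_ge[of 0 r] r by auto
    then show "\<exists>x. h x = v"
      using IVT'[of h "- r" v r] r(1) continuous_on_subset[OF h_continuous] by auto
  qed
qed

definition h_inv :: "real \<Rightarrow> real" where
  "h_inv = inv h"

lemma h_h_inv[simp]: "h (h_inv v) = v"
  by (simp add: h_inv_def surj_f_inv_f surj_h)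

lemma h_inv_h[simp]: "h_inv (h x) = x"
  by (simp add: h_inv_def inv_f_f inj_h)

lemma h_inv_le_iff: "h_inv v \<le> x \<longleftrightarrow> v \<le> h x"
  using h_le_iff[of "h_inv v" x] by simp

lemma le_h_inv_iff: "x \<le> h_inv v \<longleftrightarrow> h x \<le> v"
  using h_le_iff[of x "h_inv v"] by simp

lemma h_inv_continuous: "continuous_on UNIV h_inv"
proof (rule lipschitz_on_continuous_on[OF lipschitz_onI])
  show "dist (h_inv u) (h_inv v) \<le> 1 / m * dist u v" for u v
  proof -
    have *: "\<bar>y - x\<bar> \<le> 1 / m * \<bar>h y - h x\<bar>" if "x \<le> y" for x y
      using h_diff_ge[OF that] h_le_iff[of x y] that m_pos by (simp add: field_simps)
    show ?thesis
      using *[of "h_inv u" "h_inv v"] *[of "h_inv v" "h_inv u"]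
      by (cases "h_inv u \<le> h_inv v") (auto simp: dist_real_def abs_minus_commute)
  qed
qed (use m_pos in simp)

lemma h_measurable[measurable]: "h \<in> borel_measurable borel"
  by (rule borel_measurable_continuous_onI[OF h_continuous])

lemma h_inv_measurable[measurable]: "h_inv \<in> borel_measurable borel"
  by (rule borel_measurable_continuous_onI[OF h_inv_continuous])

text \<open>Substitution as an identity of measures, checked on open intervals by the fundamental
  theorem of calculus; it then applies to every nonnegative measurable integrand.\<close>

lemma distr_density_h: "distr (density lborel g) borel h = lborel"
proof (rule lborel_eqI[symmetric])
  fix l u :: real assume "\<And>b. b \<in> Basis \<Longrightarrow> l \<bullet> b \<le> u \<bullet> b"
  then have lu: "l \<le> u" by simp
  have pre: "h -` {l<..<u} = {h_inv l<..<h_inv u}"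
    using h_less_iff[of "h_inv l"] h_less_iff[of _ "h_inv u"] by auto
  have "emeasure (distr (density lborel g) borel h) (box l u) = emeasure (density lborel g) {h_inv l<..<h_inv u}"
    by (subst emeasure_distr) (auto simp: box_real pre)
  also have "\<dots> = (\<integral>\<^sup>+x. ennreal (g x) * indicator {h_inv l<..<h_inv u} x \<partial>lborel)"
    by (rule emeasure_density) auto
  also have "\<dots> = (\<integral>\<^sup>+x. ennreal (indicator {h_inv l..h_inv u} x * g x) \<partial>lborel)"
    by (intro nn_integral_cong_AE,
        use AE_lborel_singleton[of "h_inv l"] AE_lborel_singleton[of "h_inv u"] in eventually_elim)
       (auto simp: indicator_def)
  also have "\<dots> = ennreal (u - l)"
  proof (rule nn_integral_has_integral_lborel)
    have "h_inv l \<le> h_inv u" using lu by (simp add: h_inv_le_iff)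
    from g_has_integral[OF this]
    show "((\<lambda>x. indicator {h_inv l..h_inv u} x * g x) has_integral u - l) UNIV"
      unfolding has_integral_restrict_UNIV[of "{h_inv l..h_inv u}", symmetric]
      by (simp add: indicator_def of_bool_def if_distrib[of "\<lambda>c. c * _"] cong: if_cong)
    show "0 \<le> indicator {h_inv l..h_inv u} x * g x" for x
      using g_ge[of x] m_pos by auto
  qed measurable
  finally show "emeasure (distr (density lborel g) borel h) (box l u) = (\<Prod>b\<in>Basis. (u - l) \<bullet> b)"
    by simp
qed simp

lemma nn_integral_substitution_h:
  assumes [measurable]: "f \<in> borel_measurable borel"
  shows "(\<integral>\<^sup>+v. f v \<partial>lborel) = (\<integral>\<^sup>+u. ennreal (g u) * f (h u) \<partial>lborel)"
  by (subst distr_density_h[symmetric], subst nn_integral_distr) (auto simp: nn_integral_density)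

end

section \<open>Interval coordinates and a single step of the walk\<close>

text \<open>Passing from the slope \<open>w\<close> to \<open>p\<close> halves it; the constants
  \<open>1 - 2 * \<delta>\<close> and \<open>2 * L\<close> are those that become
  \<open>\<delta>\<close> and \<open>L\<close> there.\<close>

locale profile =
  fixes \<phi> w :: "real \<Rightarrow> real" and S :: "real set" and \<delta> L \<sigma> :: real
  assumes finite_breaks: "finite S" and delta_pos: "0 < \<delta>" and L_nonneg: "0 \<le> L"
    and phi_continuous: "continuous_on UNIV \<phi>"
    and phi_deriv: "\<And>x. x \<notin> S \<Longrightarrow> (\<phi> has_real_derivative w x) (at x)"
    and w_bound: "\<And>x. \<bar>w x\<bar> \<le> 1 - 2 * \<delta>"
    and w_Lipschitz: "\<And>x y. x \<le> y \<Longrightarrow> {x..y} \<inter> S = {} \<Longrightarrow> \<bar>w y - w x\<bar> \<le> 2 * L * (y - x)"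
    and sigma: "\<sigma> = 1 \<or> \<sigma> = -1"
begin

definition p :: "real \<Rightarrow> real" where
  "p x = (1 - \<sigma> * w x) / 2"

lemma sigma_square[simp]: "\<sigma> * \<sigma> = 1" "\<sigma> * (\<sigma> * x) = x"
  using sigma by auto

sublocale splitting p S \<delta> L
proof
  show "\<delta> \<le> p u" "p u \<le> 1 - \<delta>" for u
    using sigma w_bound[of u] by (auto simp: p_def)
  show "\<bar>p y - p x\<bar> \<le> L * (y - x)" if "x \<le> y" "{x..y} \<inter> S = {}" for x y
    using sigma w_Lipschitz[OF that] by (auto simp: p_def field_simps abs_if split: if_splits)
qed (fact finite_breaks delta_pos L_nonneg)+

lemma w_eq: "w x = \<sigma> * (1 - 2 * p x)"
  using sigma by (auto simp: p_def field_simps)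

lemma w_measurable[measurable]: "w \<in> borel_measurable borel"
proof -
  have "(\<lambda>x. \<sigma> * (1 - 2 * p x)) \<in> borel_measurable borel" by measurable
  then show ?thesis by (simp only: w_eq[symmetric])
qed

text \<open>\<open>x + \<sigma> * y\<close> is constant on a left arm and
  \<open>x - \<sigma> * y\<close> on a right arm. Along the graph both increase at rate at least
  \<open>2 * \<delta>\<close>, so the line carrying an arm meets the graph exactly once.\<close>

sublocale up: increasing_profile "\<lambda>x. x + \<sigma> * \<phi> x" "\<lambda>x. 1 + \<sigma> * w x" S "2 * \<delta>"
proof
  show "2 * \<delta> \<le> 1 + \<sigma> * w x" for x using sigma w_bound[of x] by (auto simp: abs_le_iff)
  show "((\<lambda>x. x + \<sigma> * \<phi> x) has_real_derivative 1 + \<sigma> * w x) (at x)" if "x \<notin> S" for x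
    by (auto intro!: derivative_eq_intros phi_deriv that)
  show "continuous_on UNIV (\<lambda>x. x + \<sigma> * \<phi> x)"
    by (intro continuous_intros phi_continuous)
qed (use finite_breaks delta_pos in auto)

sublocale down: increasing_profile "\<lambda>x. x - \<sigma> * \<phi> x" "\<lambda>x. 1 - \<sigma> * w x" S "2 * \<delta>"
proof
  show "2 * \<delta> \<le> 1 - \<sigma> * w x" for x using sigma w_bound[of x] by (auto simp: abs_le_iff)
  show "((\<lambda>x. x - \<sigma> * \<phi> x) has_real_derivative 1 - \<sigma> * w x) (at x)" if "x \<notin> S" for x
    by (auto intro!: derivative_eq_intros phi_deriv that)
  show "continuous_on UNIV (\<lambda>x. x - \<sigma> * \<phi> x)"
    by (intro continuous_intros phi_continuous)
qed (use finite_breaks delta_pos in auto)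

text \<open>
  A point \<open>z\<close> is encoded by the abscissas \<open>lo z\<close> and \<open>hi z\<close> of the points where the two arms of its
  hook meet the graph of \<open>\<phi>\<close>; \<open>pt\<close> is the inverse map. The hook opens towards the graph: upwards
  for \<open>\<sigma> = 1\<close>, downwards for \<open>\<sigma> = -1\<close>.
\<close>

definition lo :: "real \<times> real \<Rightarrow> real" where
  "lo z = up.h_inv (fst z + \<sigma> * snd z)"

definition hi :: "real \<times> real \<Rightarrow> real" where
  "hi z = down.h_inv (fst z - \<sigma> * snd z)"

definition pt :: "real \<Rightarrow> real \<Rightarrow> real \<times> real" where
  "pt s t = (((s + \<sigma> * \<phi> s) + (t - \<sigma> * \<phi> t)) / 2, \<sigma> * ((s + \<sigma> * \<phi> s) - (t - \<sigma> * \<phi> t)) / 2)"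

lemma pt_sum: "fst (pt s t) + \<sigma> * snd (pt s t) = s + \<sigma> * \<phi> s"
  and pt_diff: "fst (pt s t) - \<sigma> * snd (pt s t) = t - \<sigma> * \<phi> t"
  using sigma by (auto simp: pt_def field_simps)

lemma lo_pt[simp]: "lo (pt s t) = s" and hi_pt[simp]: "hi (pt s t) = t"
  unfolding lo_def hi_def pt_sum pt_diff by simp_all

lemma pt_eq_half: "pt s t = (((fst z + \<sigma> * snd z) + (fst z - \<sigma> * snd z)) / 2,
    \<sigma> * ((fst z + \<sigma> * snd z) - (fst z - \<sigma> * snd z)) / 2)"
  if "s = lo z" "t = hi z"
  unfolding pt_def that lo_def hi_def up.h_h_inv down.h_h_inv by simp

lemma pt_lo_hi[simp]: "pt (lo z) (hi z) = z"
  using sigma by (subst pt_eq_half[OF refl refl]) (auto simp: prod_eq_iff)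

lemma lo_continuous: "continuous_on UNIV lo"
  unfolding lo_def[abs_def]
  by (rule continuous_on_compose2[OF up.h_inv_continuous]) (auto intro!: continuous_intros)

lemma hi_continuous: "continuous_on UNIV hi"
  unfolding hi_def[abs_def]
  by (rule continuous_on_compose2[OF down.h_inv_continuous]) (auto intro!: continuous_intros)

lemma lo_measurable[measurable]: "lo \<in> borel_measurable borel"
  by (rule borel_measurable_continuous_onI[OF lo_continuous])

lemma hi_measurable[measurable]: "hi \<in> borel_measurable borel"
  by (rule borel_measurable_continuous_onI[OF hi_continuous])

lemma phi_measurable[measurable]: "\<phi> \<in> borel_measurable borel"
  by (rule borel_measurable_continuous_onI[OF phi_continuous])

lemma pt_measurable[measurable (raw)]:
  assumes [measurable]: "f \<in> borel_measurable M" "g \<in> borel_measurable M"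
  shows "(\<lambda>x. pt (f x) (g x)) \<in> borel_measurable M"
  unfolding pt_def by measurable

lemma pt_tendsto_diagonal:
  assumes "(\<lambda>n. lo (X n)) \<longlonglongrightarrow> l" "(\<lambda>n. hi (X n)) \<longlonglongrightarrow> l"
  shows "X \<longlonglongrightarrow> (l, \<phi> l)"
proof -
  have phi: "(\<lambda>n. \<phi> (f n)) \<longlonglongrightarrow> \<phi> l" if "f \<longlonglongrightarrow> l" for f :: "nat \<Rightarrow> real"
    by (rule continuous_on_tendsto_compose[OF phi_continuous that]) auto
  have "(\<lambda>n. pt (lo (X n)) (hi (X n))) \<longlonglongrightarrow>
      (((l + \<sigma> * \<phi> l) + (l - \<sigma> * \<phi> l)) / 2, \<sigma> * ((l + \<sigma> * \<phi> l) - (l - \<sigma> * \<phi> l)) / 2)"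
    unfolding pt_def 
    by (intro tendsto_Pair tendsto_divide tendsto_mult tendsto_add tendsto_diff tendsto_const phi assms) auto
  moreover have "(((l + \<sigma> * \<phi> l) + (l - \<sigma> * \<phi> l)) / 2, \<sigma> * ((l + \<sigma> * \<phi> l) - (l - \<sigma> * \<phi> l)) / 2) = (l, \<phi> l)"
    using sigma by auto
  ultimately show ?thesis by simp
qed

definition region :: "real \<Rightarrow> real \<Rightarrow> (real \<times> real) set" where
  "region a b = {z. a \<le> lo z \<and> lo z \<le> hi z \<and> hi z \<le> b}"

text \<open>On the right arm \<open>x - \<sigma> * y\<close>, hence \<open>hi\<close>, is fixed,
  while \<open>x + \<sigma> * y\<close> grows by \<open>sqrt 2\<close> per unit of arc length. A
  move to the right arm therefore keeps the right part of the interval.\<close>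

lemma hook_arc_right:
  assumes "0 \<le> r"
  shows "hook_arc \<sigma> (pt s t) r = pt (up.h_inv (s + \<sigma> * \<phi> s + sqrt 2 * r)) t"
proof -
  have r: "r / sqrt 2 = sqrt 2 * r / 2" by (simp add: field_simps)
  have "fst (hook_arc \<sigma> (pt s t) r) + \<sigma> * snd (hook_arc \<sigma> (pt s t) r) =
      fst (pt s t) + \<sigma> * snd (pt s t) + sqrt 2 * r"
    using assms sigma by (auto simp: hook_arc_def r)
  then have 1: "lo (hook_arc \<sigma> (pt s t) r) = up.h_inv (s + \<sigma> * \<phi> s + sqrt 2 * r)"
    by (simp add: lo_def pt_sum)
  have "fst (hook_arc \<sigma> (pt s t) r) - \<sigma> * snd (hook_arc \<sigma> (pt s t) r) = fst (pt s t) - \<sigma> * snd (pt s t)"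
    using assms sigma by (auto simp: hook_arc_def)
  then have 2: "hi (hook_arc \<sigma> (pt s t) r) = t"
    by (simp add: hi_def pt_diff)
  show ?thesis using pt_lo_hi[of "hook_arc \<sigma> (pt s t) r"] 1 2 by simp
qed

lemma hook_arc_left:
  assumes "r \<le> 0"
  shows "hook_arc \<sigma> (pt s t) r = pt s (down.h_inv (t - \<sigma> * \<phi> t + sqrt 2 * r))"
proof -
  have r: "r / sqrt 2 = sqrt 2 * r / 2" by (simp add: field_simps)
  have "fst (hook_arc \<sigma> (pt s t) r) + \<sigma> * snd (hook_arc \<sigma> (pt s t) r) = fst (pt s t) + \<sigma> * snd (pt s t)"
    using assms sigma by (auto simp: hook_arc_def)
  then have 1: "lo (hook_arc \<sigma> (pt s t) r) = s"
    by (simp add: lo_def pt_sum)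
  have "fst (hook_arc \<sigma> (pt s t) r) - \<sigma> * snd (hook_arc \<sigma> (pt s t) r) =
      fst (pt s t) - \<sigma> * snd (pt s t) + sqrt 2 * r"
    using assms sigma by (auto simp: hook_arc_def r)
  then have 2: "hi (hook_arc \<sigma> (pt s t) r) = down.h_inv (t - \<sigma> * \<phi> t + sqrt 2 * r)"
    by (simp add: hi_def pt_diff)
  show ?thesis using pt_lo_hi[of "hook_arc \<sigma> (pt s t) r"] 1 2 by simp
qed

text \<open>Arc length until the left arm meets the graph, that is, until the upper coordinate has
  dropped from \<open>t\<close> to \<open>s\<close>.\<close>

definition left_length :: "real \<Rightarrow> real \<Rightarrow> real" where
  "left_length s t = ((t - \<sigma> * \<phi> t) - (s - \<sigma> * \<phi> s)) / sqrt 2"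

definition right_length :: "real \<Rightarrow> real \<Rightarrow> real" where
  "right_length s t = ((t + \<sigma> * \<phi> t) - (s + \<sigma> * \<phi> s)) / sqrt 2"

text \<open>Along an arm only one of the two coordinates moves, and the region is left exactly when
  it passes the other.\<close>

lemma hook_arc_in_region_iff:
  assumes "a \<le> s" "s \<le> t" "t \<le> b"
  shows "hook_arc \<sigma> (pt s t) r \<in> region a b \<longleftrightarrow> - left_length s t \<le> r \<and> r \<le> right_length s t"
proof (cases "0 \<le> r")
  case True
  have "0 \<le> left_length s t" unfolding left_length_def using down.h_le_iff[of s t] assms by simp
  moreover have "s \<le> up.h_inv (s + \<sigma> * \<phi> s + sqrt 2 * r)"
    using True by (simp add: up.le_h_inv_iff)
  moreover have "up.h_inv (s + \<sigma> * \<phi> s + sqrt 2 * r) \<le> t \<longleftrightarrow> r \<le> right_length s t"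
    by (simp add: up.h_inv_le_iff right_length_def field_simps)
  ultimately show ?thesis using True assms by (auto simp: hook_arc_right region_def)
next
  case False
  have "0 \<le> right_length s t" unfolding right_length_def using up.h_le_iff[of s t] assms by simp
  moreover have "down.h_inv (t - \<sigma> * \<phi> t + sqrt 2 * r) \<le> t"
    using False by (simp add: down.h_inv_le_iff mult_nonneg_nonpos)
  moreover have "s \<le> down.h_inv (t - \<sigma> * \<phi> t + sqrt 2 * r) \<longleftrightarrow> - left_length s t \<le> r"
    by (simp add: down.le_h_inv_iff left_length_def field_simps)
  ultimately show ?thesis using False assms by (auto simp: hook_arc_left region_def)
qed

text \<open>Arc length is first rescaled by \<open>sqrt 2\<close> and then expressed through the
  abscissa \<open>u\<close> on the graph, with derivative \<open>2 * (1 - p u)\<close> or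
  \<open>2 * p u\<close>; the factor is \<open>2 / sqrt 2\<close>.\<close>

lemma arm_substitution:
  fixes F :: "real \<Rightarrow> ennreal"
  assumes [measurable]: "F \<in> borel_measurable borel"
  shows "(\<integral>\<^sup>+r. F (s + \<sigma> * \<phi> s + sqrt 2 * r) \<partial>lborel) =
      ennreal (sqrt 2) * (\<integral>\<^sup>+u. ennreal (1 - p u) * F (u + \<sigma> * \<phi> u) \<partial>lborel)" (is "?I1 = _ * ?J1")
    and "(\<integral>\<^sup>+r. F (s - \<sigma> * \<phi> s + sqrt 2 * r) \<partial>lborel) =
      ennreal (sqrt 2) * (\<integral>\<^sup>+u. ennreal (p u) * F (u - \<sigma> * \<phi> u) \<partial>lborel)" (is "?I2 = _ * ?J2")
proof -
  have sqrt: "ennreal (sqrt 2) * (ennreal (sqrt 2) * x) = 2 * x" for x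
    by (simp add: mult.assoc[symmetric] ennreal_mult[symmetric])
  have g: "ennreal (1 + \<sigma> * w u) = 2 * ennreal (1 - p u)" "ennreal (1 - \<sigma> * w u) = 2 * ennreal (p u)" for u
  proof -
    have "1 + \<sigma> * w u = 2 * (1 - p u)" "1 - \<sigma> * w u = 2 * p u" by (simp_all add: p_def field_simps)
    moreover have "ennreal (2 * x) = 2 * ennreal x" for x using ennreal_mult'[of 2 x] by simp
    ultimately show "ennreal (1 + \<sigma> * w u) = 2 * ennreal (1 - p u)" "ennreal (1 - \<sigma> * w u) = 2 * ennreal (p u)"
      by metis+
  qed
  have "ennreal (sqrt 2) * ?I1 = (\<integral>\<^sup>+v. F v \<partial>lborel)"
    by (subst (2) nn_integral_real_affine[where c = "sqrt 2" and t = "s + \<sigma> * \<phi> s"]) auto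
  also have "\<dots> = (\<integral>\<^sup>+u. 2 * (ennreal (1 - p u) * F (u + \<sigma> * \<phi> u)) \<partial>lborel)"
    by (subst up.nn_integral_substitution_h) (auto simp: g mult.assoc)
  also have "\<dots> = ennreal (sqrt 2) * (ennreal (sqrt 2) * ?J1)"
    unfolding sqrt by (rule nn_integral_cmult) measurable
  finally show "?I1 = ennreal (sqrt 2) * ?J1"
    by (subst (asm) ennreal_mult_cancel_left) auto
  have "ennreal (sqrt 2) * ?I2 = (\<integral>\<^sup>+v. F v \<partial>lborel)"
    by (subst (2) nn_integral_real_affine[where c = "sqrt 2" and t = "s - \<sigma> * \<phi> s"]) auto
  also have "\<dots> = (\<integral>\<^sup>+u. 2 * (ennreal (p u) * F (u - \<sigma> * \<phi> u)) \<partial>lborel)"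
    by (subst down.nn_integral_substitution_h) (auto simp: g mult.assoc)
  also have "\<dots> = ennreal (sqrt 2) * (ennreal (sqrt 2) * ?J2)"
    unfolding sqrt by (rule nn_integral_cmult) measurable
  finally show "?I2 = ennreal (sqrt 2) * ?J2"
    by (subst (asm) ennreal_mult_cancel_left) auto
qed

lemma hook_set_eq:
  assumes H: "\<And>r. hook_arc \<sigma> (pt s t) r \<in> H \<longleftrightarrow> hook_arc \<sigma> (pt s t) r \<in> region a b"
    and "a \<le> s" "s \<le> t" "t \<le> b"
  shows "{r. hook_arc \<sigma> (pt s t) r \<in> H} = {- left_length s t..right_length s t}"
  unfolding H hook_arc_in_region_iff[OF assms(2-4)] by auto

text \<open>The values of \<open>\<phi>\<close> cancel: the total length of a hook depends on
  \<open>t - s\<close> only, which is why \<open>u\<close> becomes uniform on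
  \<open>[s, t]\<close>.\<close>

lemma arc_lengths: "right_length s t + left_length s t = sqrt 2 * (t - s)"
  by (simp add: right_length_def left_length_def add_divide_distrib[symmetric] field_simps)

lemma uniform_on_hook_degenerate:
  assumes H: "\<And>r. hook_arc \<sigma> (pt s s) r \<in> H \<longleftrightarrow> hook_arc \<sigma> (pt s s) r \<in> region a b"
    and "a \<le> s" "s \<le> b"
  shows "uniform_on_hook \<sigma> (pt s s) H = return borel (pt s s)"
proof -
  have "{r. hook_arc \<sigma> (pt s s) r \<in> H} = {- left_length s s..right_length s s}"
    using assms by (intro hook_set_eq[OF H]) auto
  also have "\<dots> = {0}" by (simp add: left_length_def right_length_def)
  finally show ?thesis unfolding uniform_on_hook_def by simp
qed

text \<open>
  Projected along its arm to the abscissa \<open>u\<close> on the graph, the uniform distribution on a hook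
  becomes the uniform distribution on \<open>[s, t]\<close>, and given \<open>u\<close> the left arm is chosen with
  probability \<open>p u\<close>.
\<close>

lemma nn_integral_uniform_on_hook:
  fixes f :: "real \<times> real \<Rightarrow> ennreal"
  assumes H: "\<And>r. hook_arc \<sigma> (pt s t) r \<in> H \<longleftrightarrow> hook_arc \<sigma> (pt s t) r \<in> region a b"
    and st: "a \<le> s" "s < t" "t \<le> b" and f[measurable]: "f \<in> borel_measurable borel"
  shows "ennreal (t - s) * (\<integral>\<^sup>+z. f z \<partial>uniform_on_hook \<sigma> (pt s t) H) =
    (\<integral>\<^sup>+u. (ennreal (p u) * f (pt s u) + ennreal (1 - p u) * f (pt u t)) * indicator {s..t} u \<partial>lborel)"
proof -
  define T where "T = {- left_length s t..right_length s t}"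
  have T: "{r. hook_arc \<sigma> (pt s t) r \<in> H} = T"
    unfolding T_def using st by (intro hook_set_eq[OF H]) auto
  have ll: "0 \<le> left_length s t" unfolding left_length_def using down.h_le_iff[of s t] st by simp
  have rl: "0 \<le> right_length s t" unfolding right_length_def using up.h_le_iff[of s t] st by simp
  have emT: "emeasure lborel T = ennreal (sqrt 2 * (t - s))"
    unfolding T_def arc_lengths[symmetric] using ll rl by (simp add: emeasure_lborel_Icc_eq)
  have arc[measurable]: "hook_arc \<sigma> (pt s t) \<in> borel_measurable borel"
    unfolding hook_arc_def[abs_def] by measurable
  define FR where "FR v = f (pt (up.h_inv v) t) * indicator {s + \<sigma> * \<phi> s..t + \<sigma> * \<phi> t} v" for v
  define FL where "FL v = f (pt s (down.h_inv v)) * indicator {s - \<sigma> * \<phi> s..t - \<sigma> * \<phi> t} v" for v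
  have [measurable]: "FR \<in> borel_measurable borel" "FL \<in> borel_measurable borel"
    unfolding FR_def FL_def by measurable
  have "(\<integral>\<^sup>+r. f (hook_arc \<sigma> (pt s t) r) * indicator T r \<partial>lborel) =
      (\<integral>\<^sup>+r. FR (s + \<sigma> * \<phi> s + sqrt 2 * r) + FL (t - \<sigma> * \<phi> t + sqrt 2 * r) \<partial>lborel)"
  \<comment> \<open>The corner \<open>r = 0\<close> lies on both arms and would be counted
    twice.\<close>
  proof (intro nn_integral_cong_AE, use AE_lborel_singleton[of 0] in eventually_elim)
    fix r :: real assume r: "r \<noteq> 0"
    show "f (hook_arc \<sigma> (pt s t) r) * indicator T r = FR (s + \<sigma> * \<phi> s + sqrt 2 * r) + FL (t - \<sigma> * \<phi> t + sqrt 2 * r)"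
    proof (cases "0 < r")
      case True
      have "r \<in> T \<longleftrightarrow> s + \<sigma> * \<phi> s + sqrt 2 * r \<le> t + \<sigma> * \<phi> t"
        using True ll by (auto simp: T_def right_length_def field_simps)
      then show ?thesis
        using True by (auto simp: FR_def FL_def hook_arc_right indicator_def mult_le_0_iff)
    next
      case False
      then have "r < 0" using r by simp
      moreover have "r \<in> T \<longleftrightarrow> s - \<sigma> * \<phi> s \<le> t - \<sigma> * \<phi> t + sqrt 2 * r"
        using \<open>r < 0\<close> rl by (auto simp: T_def left_length_def field_simps)
      moreover have "sqrt 2 * r < 0" using \<open>r < 0\<close> by (simp add: mult_pos_neg)
      ultimately show ?thesis
        by (auto simp: FR_def FL_def hook_arc_left indicator_def)
    qed
  qed
  also have "\<dots> = ennreal (sqrt 2) * (\<integral>\<^sup>+u. ennreal (1 - p u) * FR (u + \<sigma> * \<phi> u) \<partial>lborel) +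
      ennreal (sqrt 2) * (\<integral>\<^sup>+u. ennreal (p u) * FL (u - \<sigma> * \<phi> u) \<partial>lborel)"
    by (subst nn_integral_add) (auto simp: arm_substitution)
  also have "\<dots> = ennreal (sqrt 2) * (\<integral>\<^sup>+u. ennreal (1 - p u) * FR (u + \<sigma> * \<phi> u) + ennreal (p u) * FL (u - \<sigma> * \<phi> u) \<partial>lborel)"
    by (subst nn_integral_add) (auto simp: distrib_left)
  also have "(\<integral>\<^sup>+u. ennreal (1 - p u) * FR (u + \<sigma> * \<phi> u) + ennreal (p u) * FL (u - \<sigma> * \<phi> u) \<partial>lborel) =
      (\<integral>\<^sup>+u. (ennreal (p u) * f (pt s u) + ennreal (1 - p u) * f (pt u t)) * indicator {s..t} u \<partial>lborel)"
    by (intro nn_integral_cong)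
       (auto simp: FR_def FL_def indicator_def up.h_le_iff down.h_le_iff add.commute)
  finally have int: "(\<integral>\<^sup>+r. f (hook_arc \<sigma> (pt s t) r) * indicator T r \<partial>lborel) = ennreal (sqrt 2) *
      (\<integral>\<^sup>+u. (ennreal (p u) * f (pt s u) + ennreal (1 - p u) * f (pt u t)) * indicator {s..t} u \<partial>lborel)"
    (is "_ = _ * ?J") .
  have "(\<integral>\<^sup>+z. f z \<partial>uniform_on_hook \<sigma> (pt s t) H) =
      (\<integral>\<^sup>+r. f (hook_arc \<sigma> (pt s t) r) \<partial>uniform_measure lborel T)"
    unfolding uniform_on_hook_def T emT using st by (simp add: nn_integral_distr)
  also have "\<dots> = (\<integral>\<^sup>+r. f (hook_arc \<sigma> (pt s t) r) * indicator T r \<partial>lborel) / emeasure lborel T"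
    by (rule nn_integral_uniform_measure) (auto simp: T_def)
  finally have "ennreal (t - s) * (\<integral>\<^sup>+z. f z \<partial>uniform_on_hook \<sigma> (pt s t) H) =
      (?J * ennreal (sqrt 2 * (t - s))) / ennreal (sqrt 2 * (t - s))"
    unfolding int emT using st by (simp add: ennreal_times_divide ennreal_mult mult_ac)
  also have "\<dots> = ?J"
    using st by (intro mult_divide_eq_ennreal) auto
  finally show ?thesis .
qed

text \<open>On the graph the interval is a point and \<open>limit_mass\<close> is 0, but the walk
  has stopped there, so its limit is known.\<close>

definition harmonic_mass :: "real set \<Rightarrow> real \<times> real \<Rightarrow> ennreal" where
  "harmonic_mass A z = (if lo z < hi z then limit_mass A (lo z) (hi z) else indicator A (lo z))"

lemma harmonic_mass_measurable[measurable]: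
  assumes [measurable]: "A \<in> sets borel"
  shows "harmonic_mass A \<in> borel_measurable borel"
  unfolding harmonic_mass_def[abs_def] by measurable

lemma harmonic_mass_eq_1:
  assumes "lo z \<le> hi z" "{lo z..hi z} \<subseteq> A"
  shows "harmonic_mass A z = 1"
proof (cases "lo z < hi z")
  case True
  have "limit_mass A (lo z) (hi z) = limit_mass UNIV (lo z) (hi z)"
    unfolding limit_mass_def using subsetD[OF assms(2)]
    by (intro nn_integral_cong) (auto simp: indicator_def)
  then show ?thesis using True by (simp add: harmonic_mass_def limit_mass_eq_1)
next
  case False
  then show ?thesis using assms by (auto simp: harmonic_mass_def)
qed

end

section \<open>The hook walk as a chain of nested intervals\<close>

text \<open>Hooks enter only through their traces on the two rays, and the starting law is left
  open, so that both walks are instances.\<close>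

locale hook_chain = profile +
  fixes \<mu> :: "(real \<times> real) measure" and H :: "real \<times> real \<Rightarrow> (real \<times> real) set" and a b :: real
  assumes initial: "\<mu> \<in> space (prob_algebra borel)" and AE_initial: "AE z in \<mu>. z \<in> region a b"
    and H_kernel: "(\<lambda>z. uniform_on_hook \<sigma> z (H z)) \<in> borel \<rightarrow>\<^sub>M prob_algebra borel"
    and H_arc: "\<And>z r. hook_arc \<sigma> z r \<in> H z \<longleftrightarrow> hook_arc \<sigma> z r \<in> region a b"
begin

abbreviation step :: "real \<times> real \<Rightarrow> (real \<times> real) measure" where
  "step z \<equiv> uniform_on_hook \<sigma> z (H z)"

lemma sets_step: "sets (step z) = sets borel"
  using measurable_space[OF H_kernel, of z] by (simp add: space_prob_algebra)

lemma nn_integral_step: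
  assumes "a \<le> lo z" "lo z < hi z" "hi z \<le> b" "f \<in> borel_measurable borel"
  shows "ennreal (hi z - lo z) * (\<integral>\<^sup>+z. f z \<partial>step z) =
    (\<integral>\<^sup>+u. (ennreal (p u) * f (pt (lo z) u) + ennreal (1 - p u) * f (pt u (hi z))) * indicator {lo z..hi z} u \<partial>lborel)"
  using nn_integral_uniform_on_hook[of "lo z" "hi z" "H z" a b f] assms H_arc[of z] by simp

lemma step_degenerate:
  assumes "a \<le> lo z" "lo z = hi z" "hi z \<le> b"
  shows "step z = return borel z"
proof -
  have "pt (hi z) (hi z) = z" using pt_lo_hi[of z] assms(2) by simp
  then show ?thesis
    using uniform_on_hook_degenerate[of "hi z" "H z" a b] assms H_arc[of z] by simp
qed

lemma step_harmonic:
  assumes [measurable]: "A \<in> sets borel" and z: "a \<le> lo z" "lo z \<le> hi z" "hi z \<le> b"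
  shows "(\<integral>\<^sup>+z'. harmonic_mass A z' \<partial>step z) = harmonic_mass A z"
proof (cases "lo z < hi z")
  case True
  have "ennreal (hi z - lo z) * (\<integral>\<^sup>+z'. harmonic_mass A z' \<partial>step z) =
    (\<integral>\<^sup>+u. (ennreal (p u) * harmonic_mass A (pt (lo z) u) + ennreal (1 - p u) * harmonic_mass A (pt u (hi z))) *
      indicator {lo z..hi z} u \<partial>lborel)"
    using True z by (intro nn_integral_step) auto
  also have "\<dots> = (\<integral>\<^sup>+u. (ennreal (p u) * limit_mass A (lo z) u + ennreal (1 - p u) * limit_mass A u (hi z)) *
      indicator {lo z..hi z} u \<partial>lborel)"
    \<comment> \<open>For \<open>u\<close> at an end of the interval one successor lies on the
      graph, where \<open>harmonic_mass\<close> is an indicator.\<close>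
    by (intro nn_integral_cong_AE,
        use AE_lborel_singleton[of "lo z"] AE_lborel_singleton[of "hi z"] in eventually_elim)
       (auto simp: harmonic_mass_def indicator_def)
  also have "\<dots> = ennreal (hi z - lo z) * harmonic_mass A z"
    using limit_mass_harmonic[of A "lo z" "hi z"] z True by (simp add: harmonic_mass_def)
  finally show ?thesis
    using True by (subst (asm) ennreal_mult_cancel_left) auto
next
  case False
  then show ?thesis using z by (subst step_degenerate) (auto simp: nn_integral_return)
qed

lemma step_nested:
  assumes z: "a \<le> lo z" "lo z \<le> hi z" "hi z \<le> b"
  shows "AE z' in step z. lo z \<le> lo z' \<and> lo z' \<le> hi z' \<and> hi z' \<le> hi z"
proof (cases "lo z < hi z")
  case True
  define f :: "real \<times> real \<Rightarrow> ennreal"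
    where "f z' = (if lo z \<le> lo z' \<and> lo z' \<le> hi z' \<and> hi z' \<le> hi z then 0 else 1)" for z'
  have f[measurable]: "f \<in> borel_measurable borel" unfolding f_def[abs_def] by measurable
  have "ennreal (hi z - lo z) * (\<integral>\<^sup>+z'. f z' \<partial>step z) =
    (\<integral>\<^sup>+u. (ennreal (p u) * f (pt (lo z) u) + ennreal (1 - p u) * f (pt u (hi z))) * indicator {lo z..hi z} u \<partial>lborel)"
    using True z by (intro nn_integral_step) auto
  also have "\<dots> = (\<integral>\<^sup>+u. 0 * indicator {lo z..hi z} u \<partial>lborel)"
    by (intro nn_integral_cong) (auto simp: f_def indicator_def)
  finally have "(\<integral>\<^sup>+z'. f z' \<partial>step z) = 0" using True by (simp add: ennreal_eq_0_iff)
  moreover have "f \<in> borel_measurable (step z)"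
    by (subst measurable_cong_sets[OF sets_step refl]) (rule f)
  ultimately have "AE z' in step z. f z' = 0"
    by (subst (asm) nn_integral_0_iff_AE)
  then show ?thesis by eventually_elim (simp add: f_def split: if_splits)
next
  case False
  have [measurable]: "Measurable.pred borel (\<lambda>z'. lo z \<le> lo z' \<and> lo z' \<le> hi z' \<and> hi z' \<le> hi z)" by measurable
  show ?thesis using False z by (subst step_degenerate) (auto simp: AE_return)
qed

text \<open>Each of the pieces \<open>u - lo z\<close> and \<open>hi z - u\<close> survives with
  probability at most \<open>1 - \<delta>\<close>.\<close>

lemma step_contract:
  assumes z: "a \<le> lo z" "lo z \<le> hi z" "hi z \<le> b"
  shows "(\<integral>\<^sup>+z'. ennreal (hi z' - lo z') \<partial>step z) \<le> ennreal (1 - \<delta>) * ennreal (hi z - lo z)"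
proof (cases "lo z < hi z")
  case True
  have "ennreal (hi z - lo z) * (\<integral>\<^sup>+z'. ennreal (hi z' - lo z') \<partial>step z) =
    (\<integral>\<^sup>+u. (ennreal (p u) * ennreal (u - lo z) + ennreal (1 - p u) * ennreal (hi z - u)) *
      indicator {lo z..hi z} u \<partial>lborel)"
    using nn_integral_step[of z "\<lambda>z'. ennreal (hi z' - lo z')"] True z by simp
  also have "\<dots> \<le> (\<integral>\<^sup>+u. ennreal ((1 - \<delta>) * (hi z - lo z)) * indicator {lo z..hi z} u \<partial>lborel)"
  proof (intro nn_integral_mono)
    fix u
    show "(ennreal (p u) * ennreal (u - lo z) + ennreal (1 - p u) * ennreal (hi z - u)) * indicator {lo z..hi z} u
      \<le> ennreal ((1 - \<delta>) * (hi z - lo z)) * indicator {lo z..hi z} u"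
    proof (cases "u \<in> {lo z..hi z}")
      case u: True
      have "ennreal (p u) * ennreal (u - lo z) + ennreal (1 - p u) * ennreal (hi z - u) =
          ennreal (p u * (u - lo z) + (1 - p u) * (hi z - u))"
        using u p_pos[of u] p_less_1[of u] by (subst ennreal_plus) (auto simp: ennreal_mult)
      also have "\<dots> \<le> ennreal ((1 - \<delta>) * (u - lo z) + (1 - \<delta>) * (hi z - u))"
        using u p_le[of u] p_ge[of u] by (intro ennreal_leI add_mono mult_right_mono) auto
      also have "(1 - \<delta>) * (u - lo z) + (1 - \<delta>) * (hi z - u) = (1 - \<delta>) * (hi z - lo z)"
        by (simp add: algebra_simps)
      finally show ?thesis using u by simp
    qed simp
  qed
  also have "\<dots> = ennreal (hi z - lo z) * (ennreal (1 - \<delta>) * ennreal (hi z - lo z))"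
    using True delta_less_1 by (subst nn_integral_cmult_indicator) (auto simp: ennreal_mult mult_ac)
  finally show ?thesis
    using True by (subst (asm) ennreal_mult_le_mult_iff) auto
next
  case False
  then show ?thesis using z by (subst step_degenerate) (auto simp: nn_integral_return)
qed

sublocale nested_chain \<mu> step lo hi a b "1 - \<delta>"
proof
  show "AE z in \<mu>. a \<le> lo z \<and> lo z \<le> hi z \<and> hi z \<le> b"
    using AE_initial by (simp add: region_def)
  show "\<exists>y. X \<longlonglongrightarrow> (l, y)" if "(\<lambda>n. lo (X n)) \<longlonglongrightarrow> l" "(\<lambda>n. hi (X n)) \<longlonglongrightarrow> l" for X l
    using pt_tendsto_diagonal[OF that] by blast
qed (use initial H_kernel step_nested step_contract delta_less_1 delta_pos in auto)

text \<open>All that is left for a concrete walk is to compute the initial mean of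
  \<open>harmonic_mass\<close>.\<close>

theorem hook_walk_limit_distribution:
  assumes \<nu>: "sets \<nu> = sets borel"
    and mass: "\<And>A. A \<in> sets borel \<Longrightarrow> (\<integral>\<^sup>+z. harmonic_mass A z \<partial>\<mu>) = emeasure \<nu> A"
  shows "distr law borel (\<lambda>X. fst (lim X)) = \<nu>"
proof (rule limit_distribution[where V = harmonic_mass])
  interpret \<mu>: prob_space \<mu> using initial by (simp add: space_prob_algebra)
  have "(\<integral>\<^sup>+z. harmonic_mass UNIV z \<partial>\<mu>) = (\<integral>\<^sup>+z. 1 \<partial>\<mu>)"
    by (intro nn_integral_cong_AE, use AE_initial in eventually_elim)
       (auto simp: region_def intro!: harmonic_mass_eq_1)
  then have "emeasure \<nu> (space \<nu>) = 1"
    using mass[of UNIV] sets_eq_imp_space_eq[OF \<nu>] by (simp add: \<mu>.emeasure_space_1)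
  then show "real_distribution \<nu>"
    by (intro real_distribution.intro real_distribution_axioms.intro prob_spaceI \<nu>)
qed (auto simp: mass inv_set_def step_harmonic harmonic_mass_eq_1)

end

section \<open>Closed form of the density\<close>

context splitting
begin

text \<open>With \<open>u = x - v\<close> the left exponent has the integrand
  \<open>(p u - p x) / (u - x)\<close>, as the right one has with \<open>u = x + v\<close>; so the
  two exponentials merge into one integral over \<open>[s, t]\<close>.\<close>

lemma limit_density_eq:
  assumes x: "x \<notin> S" "s < x" "x < t"
  shows "limit_density s t x = sin (pi * p x) / pi * (x - s) powr (- p x) * (t - x) powr (p x - 1) *
    exp (LBINT u:{s..t}. (p u - p x) / (u - x))"
proof -
  interpret R: splitting "\<lambda>v. p (x + v)" "(\<lambda>c. c - x) ` S" \<delta> L by (rule splitting_right)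
  interpret G: splitting "\<lambda>v. 1 - p (x - v)" "(\<lambda>c. x - c) ` S" \<delta> L by (rule splitting_left)
  have S0: "0 \<notin> (\<lambda>c. c - x) ` S" "0 \<notin> (\<lambda>c. x - c) ` S" using x by auto
  define FR where "FR u = indicator {x..t} u * ((p u - p x) / (u - x))" for u
  define FL where "FL u = indicator {s..x} u * ((p u - p x) / (u - x))" for u
  have FR: "(\<lambda>v. FR (x + 1 * v)) = (\<lambda>v. indicator {0..t - x} v *\<^sub>R ((p (x + v) - p (x + 0)) / v))"
    by (auto simp: FR_def indicator_def fun_eq_iff)
  have FL: "(\<lambda>v. FL (x + (-1) * v)) = (\<lambda>v. indicator {0..x - s} v *\<^sub>R ((1 - p (x - v) - (1 - p (x - 0))) / v))"
    by (auto simp: FL_def indicator_def fun_eq_iff minus_divide_right[symmetric] minus_divide_left diff_divide_distrib)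
  have intR: "integrable lborel FR"
    using R.diff_quotient_integrable[OF S0(1), of "t - x"]
      lborel_integrable_real_affine_iff[of 1 FR x]
    unfolding set_integrable_def FR by simp
  have intL: "integrable lborel FL"
    using G.diff_quotient_integrable[OF S0(2), of "x - s"]
      lborel_integrable_real_affine_iff[of "-1" FL x]
    unfolding set_integrable_def FL by simp
  have "(LBINT v:{0..t - x}. (p (x + v) - p (x + 0)) / v) = integral\<^sup>L lborel FR"
    using lborel_integral_real_affine[of 1 FR x] unfolding FR by (simp add: set_lebesgue_integral_def)
  moreover have "(LBINT v:{0..x - s}. (1 - p (x - v) - (1 - p (x - 0))) / v) = integral\<^sup>L lborel FL"
    using lborel_integral_real_affine[of "-1" FL x] unfolding FL by (simp add: set_lebesgue_integral_def)
  moreover have "(LBINT u:{s..t}. (p u - p x) / (u - x)) = integral\<^sup>L lborel FL + integral\<^sup>L lborel FR"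
  proof -
    have "(LBINT u:{s..t}. (p u - p x) / (u - x)) = (\<integral>u. FL u + FR u \<partial>lborel)"
      unfolding set_lebesgue_integral_def using x
      \<comment> \<open>Both pieces contain \<open>u = x\<close>, but there the quotient is
        \<open>0 / 0 = 0\<close>.\<close>
      by (intro Bochner_Integration.integral_cong) (auto simp: FL_def FR_def indicator_def)
    then show ?thesis using intL intR by simp
  qed
  ultimately show ?thesis
    by (simp add: limit_density_def arm_def exp_add)
qed

end

section \<open>Averaging over a uniform starting point\<close>

context profile
begin

text \<open>The area element in interval coordinates:
  \<open>(1 + \<sigma> * w s) * (1 - \<sigma> * w t) / 2\<close>, expressed by \<open>p\<close>. The
  substitution is made one variable at a time.\<close>

lemma nn_integral_plane:
  assumes [measurable]: "f \<in> borel_measurable borel"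
  shows "(\<integral>\<^sup>+z. f z \<partial>lborel) =
    (\<integral>\<^sup>+s. \<integral>\<^sup>+t. ennreal (2 * (1 - p s) * p t) * f (pt s t) \<partial>lborel \<partial>lborel)"
proof -
  have f[measurable]: "f \<in> borel_measurable (borel \<Otimes>\<^sub>M borel)" by (simp add: borel_prod)
  have pos: "0 \<le> 1 - p u" "0 \<le> p u" for u using p_less_1[of u] p_pos[of u] by simp_all
  have abs_sigma: "ennreal \<bar>\<sigma>\<bar> = 1" "\<sigma> \<noteq> 0" using sigma by auto
  have "(\<integral>\<^sup>+z. f z \<partial>lborel) = (\<integral>\<^sup>+x. \<integral>\<^sup>+y. f (x, y) \<partial>lborel \<partial>lborel)"
    by (subst lborel.nn_integral_fst) (simp_all add: lborel_prod f)
  \<comment> \<open>The new variable is \<open>v = x + \<sigma> * y\<close>, at fixed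
    \<open>x\<close>.\<close>
  also have "\<dots> = (\<integral>\<^sup>+x. \<integral>\<^sup>+v. f (x, - \<sigma> * x + \<sigma> * v) \<partial>lborel \<partial>lborel)"
  proof (rule nn_integral_cong)
    fix x
    show "(\<integral>\<^sup>+y. f (x, y) \<partial>lborel) = (\<integral>\<^sup>+v. f (x, - \<sigma> * x + \<sigma> * v) \<partial>lborel)"
      by (subst nn_integral_real_affine[where c = \<sigma> and t = "- \<sigma> * x"]) (simp_all add: abs_sigma)
  qed
  also have "\<dots> = (\<integral>\<^sup>+v. \<integral>\<^sup>+x. f (x, - \<sigma> * x + \<sigma> * v) \<partial>lborel \<partial>lborel)"
    by (rule lborel_pair.Fubini') measurable
  \<comment> \<open>The new variable is \<open>v' = 2 * x - v = x - \<sigma> * y\<close>, at fixed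
    \<open>v\<close>; this produces the \<open>1 / 2\<close>.\<close>
  also have "\<dots> = (\<integral>\<^sup>+v. \<integral>\<^sup>+v'. ennreal (1 / 2) * f ((v + v') / 2, \<sigma> * (v - v') / 2) \<partial>lborel \<partial>lborel)"
  proof (rule nn_integral_cong)
    fix v
    have "(\<integral>\<^sup>+x. f (x, - \<sigma> * x + \<sigma> * v) \<partial>lborel) =
        ennreal \<bar>1 / 2\<bar> * (\<integral>\<^sup>+v'. f (v / 2 + 1 / 2 * v', - \<sigma> * (v / 2 + 1 / 2 * v') + \<sigma> * v) \<partial>lborel)"
      by (rule nn_integral_real_affine) measurable
    also have "\<dots> = (\<integral>\<^sup>+v'. ennreal (1 / 2) * f (v / 2 + 1 / 2 * v', - \<sigma> * (v / 2 + 1 / 2 * v') + \<sigma> * v) \<partial>lborel)"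
      by (subst nn_integral_cmult) (simp_all, measurable)
    also have "\<dots> = (\<integral>\<^sup>+v'. ennreal (1 / 2) * f ((v + v') / 2, \<sigma> * (v - v') / 2) \<partial>lborel)"
      by (intro nn_integral_cong arg_cong[where f = "\<lambda>z. ennreal (1 / 2) * f z"]) (simp add: field_simps)
    finally show "(\<integral>\<^sup>+x. f (x, - \<sigma> * x + \<sigma> * v) \<partial>lborel) =
      (\<integral>\<^sup>+v'. ennreal (1 / 2) * f ((v + v') / 2, \<sigma> * (v - v') / 2) \<partial>lborel)" .
  qed
  also have "\<dots> = (\<integral>\<^sup>+s. ennreal (1 + \<sigma> * w s) * (\<integral>\<^sup>+v'. ennreal (1 / 2) *
      f (((s + \<sigma> * \<phi> s) + v') / 2, \<sigma> * ((s + \<sigma> * \<phi> s) - v') / 2) \<partial>lborel) \<partial>lborel)"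
    by (rule up.nn_integral_substitution_h) measurable
  also have "\<dots> = (\<integral>\<^sup>+s. ennreal (1 + \<sigma> * w s) * (\<integral>\<^sup>+t. ennreal (1 - \<sigma> * w t) * (ennreal (1 / 2) * f (pt s t)) \<partial>lborel) \<partial>lborel)"
    unfolding pt_def
    by (intro nn_integral_cong arg_cong[where f = "\<lambda>x. _ * x"] down.nn_integral_substitution_h) measurable
  also have "\<dots> = (\<integral>\<^sup>+s. (\<integral>\<^sup>+t. ennreal (1 + \<sigma> * w s) * (ennreal (1 - \<sigma> * w t) * (ennreal (1 / 2) * f (pt s t))) \<partial>lborel) \<partial>lborel)"
    by (intro nn_integral_cong nn_integral_cmult[symmetric]) measurable
  also have "\<dots> = (\<integral>\<^sup>+s. \<integral>\<^sup>+t. ennreal (2 * (1 - p s) * p t) * f (pt s t) \<partial>lborel \<partial>lborel)"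
  proof (intro nn_integral_cong)
    fix s t
    have pos: "0 \<le> 1 + \<sigma> * w s" "0 \<le> 1 - \<sigma> * w t"
      using up.g_ge[of s] down.g_ge[of t] delta_pos by linarith+
    have "ennreal (1 + \<sigma> * w s) * (ennreal (1 - \<sigma> * w t) * ennreal (1 / 2)) =
        ennreal ((1 + \<sigma> * w s) * ((1 - \<sigma> * w t) * (1 / 2)))"
      by (simp only: ennreal_mult'[OF pos(1)] ennreal_mult'[OF pos(2)])
    also have "(1 + \<sigma> * w s) * ((1 - \<sigma> * w t) * (1 / 2)) = 2 * (1 - p s) * p t"
      by (simp add: p_def field_simps)
    finally show "ennreal (1 + \<sigma> * w s) * (ennreal (1 - \<sigma> * w t) * (ennreal (1 / 2) * f (pt s t))) =
        ennreal (2 * (1 - p s) * p t) * f (pt s t)"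
      by (simp only: mult.assoc[symmetric])
  qed
  finally show ?thesis .
qed

text \<open>At fixed \<open>x\<close> the area element supplies exactly the weights
  \<open>1 - p s\<close> and \<open>p t\<close> of the one-sided identities, so the integral over
  \<open>s < x < t\<close> factorises. Compared with a start at \<open>pt a b\<close>, the density
  gains the factor \<open>2 * (x - a) * (b - x)\<close>.\<close>

lemma nn_integral_harmonic_mass_region:
  assumes [measurable]: "A \<in> sets borel"
  shows "(\<integral>\<^sup>+z. harmonic_mass A z * indicator (region a b) z \<partial>lborel) =
    (\<integral>\<^sup>+x. ennreal (2 * (x - a) * (b - x) * limit_density a b x) * indicator (A \<inter> {a<..<b}) x \<partial>lborel)"
proof -
  have q: "0 \<le> 1 - p u" and p: "0 \<le> p u" for u using p_less_1[of u] p_pos[of u] by simp_all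
  have region[measurable]: "region a b \<in> sets borel"
  proof -
    have "region a b = {z \<in> space borel. a \<le> lo z \<and> lo z \<le> hi z \<and> hi z \<le> b}" by (simp add: region_def)
    also have "\<dots> \<in> sets borel" by measurable
    finally show ?thesis .
  qed
  define G where "G s t x = ennreal (2 * (1 - p s) * p t) * (ennreal (limit_density s t x) *
      (if x \<in> A \<and> a \<le> s \<and> s < x \<and> x < t \<and> t \<le> b then 1 else 0))" for s t x
  have [measurable]: "(\<lambda>z. G (f z) (g z) (h z)) \<in> borel_measurable M"
    if [measurable]: "f \<in> borel_measurable M" "g \<in> borel_measurable M" "h \<in> borel_measurable M" for f g h and M :: "'c measure"
    unfolding G_def by measurable
  have "(\<integral>\<^sup>+z. harmonic_mass A z * indicator (region a b) z \<partial>lborel) =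
      (\<integral>\<^sup>+s. \<integral>\<^sup>+t. ennreal (2 * (1 - p s) * p t) * (harmonic_mass A (pt s t) * indicator (region a b) (pt s t)) \<partial>lborel \<partial>lborel)"
    by (rule nn_integral_plane) measurable
  also have "\<dots> = (\<integral>\<^sup>+s. \<integral>\<^sup>+t. \<integral>\<^sup>+x. G s t x \<partial>lborel \<partial>lborel \<partial>lborel)"
  proof (rule nn_integral_cong, rule nn_integral_cong_AE)
    fix s
    show "AE t in lborel. ennreal (2 * (1 - p s) * p t) * (harmonic_mass A (pt s t) * indicator (region a b) (pt s t)) =
        (\<integral>\<^sup>+x. G s t x \<partial>lborel)"
      using AE_lborel_singleton[of s]
    proof eventually_elim
      case (elim t)
      have "harmonic_mass A (pt s t) * indicator (region a b) (pt s t) =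
          limit_mass A s t * (if a \<le> s \<and> t \<le> b then 1 else 0)"
      proof (cases "s < t")
        case False
        then have "limit_mass A s t = 0" by (simp add: limit_mass_def)
        then show ?thesis using False elim by (simp add: region_def)
      qed (simp add: harmonic_mass_def region_def indicator_def)
      also have "\<dots> = (\<integral>\<^sup>+x. ennreal (limit_density s t x) *
        (if x \<in> A \<and> a \<le> s \<and> s < x \<and> x < t \<and> t \<le> b then 1 else 0) \<partial>lborel)"
        unfolding limit_mass_def
        by (subst nn_integral_multc[symmetric]) (auto intro!: nn_integral_cong simp: indicator_def)
      finally show ?case
        unfolding G_def by (subst nn_integral_cmult) simp_all
    qed
  qed
  also have "\<dots> = (\<integral>\<^sup>+s. \<integral>\<^sup>+x. \<integral>\<^sup>+t. G s t x \<partial>lborel \<partial>lborel \<partial>lborel)"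
    by (intro nn_integral_cong lborel_pair.Fubini') measurable
  also have "\<dots> = (\<integral>\<^sup>+x. \<integral>\<^sup>+s. \<integral>\<^sup>+t. G s t x \<partial>lborel \<partial>lborel \<partial>lborel)"
    by (rule lborel_pair.Fubini') measurable
  also have "\<dots> = (\<integral>\<^sup>+x. ennreal (2 * (x - a) * (b - x) * limit_density a b x) * indicator (A \<inter> {a<..<b}) x \<partial>lborel)"
  proof (intro nn_integral_cong_AE, use AE_notin_S in eventually_elim)
    fix x assume x: "x \<notin> S"
    show "(\<integral>\<^sup>+s. \<integral>\<^sup>+t. G s t x \<partial>lborel \<partial>lborel) =
        ennreal (2 * (x - a) * (b - x) * limit_density a b x) * indicator (A \<inter> {a<..<b}) x"
    proof (cases "x \<in> A \<and> a < x \<and> x < b")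
      case True
      define c where "c = 2 * sin (pi * p x) / pi"
      have c: "0 \<le> c" by (simp add: c_def sin_p_nonneg)
      have "G s t x = ennreal c * ((ennreal ((1 - p s) * left_arm x (x - s)) * indicator {a..x} s) *
          (ennreal (p t * right_arm x (t - x)) * indicator {x..b} t))" for s t
      proof (cases "a \<le> s \<and> s < x \<and> x < t \<and> t \<le> b")
        case r: True
        have "2 * (1 - p s) * p t * limit_density s t x =
            c * (((1 - p s) * left_arm x (x - s)) * (p t * right_arm x (t - x)))"
          by (simp add: limit_density_def c_def)
        moreover have "G s t x = ennreal (2 * (1 - p s) * p t * limit_density s t x)"
          using r True q[of s] p[of t] by (simp add: G_def ennreal_mult limit_density_nonneg)
        ultimately have "G s t x = ennreal (c * (((1 - p s) * left_arm x (x - s)) * (p t * right_arm x (t - x))))"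
          by (simp only:)
        also have "\<dots> = ennreal c * (ennreal ((1 - p s) * left_arm x (x - s)) * ennreal (p t * right_arm x (t - x)))"
          by (simp only: ennreal_mult'[OF c] ennreal_mult'[OF mult_nonneg_nonneg[OF q arm_nonneg]])
        finally show ?thesis using r by (simp add: indicator_def)
      next
        case False
        \<comment> \<open>\<open>arm_def\<close> settles \<open>s = x\<close> and
          \<open>t = x\<close>, where an arm of length 0 vanishes.\<close>
        then show ?thesis using True by (auto simp: G_def indicator_def arm_def)
      qed
      then have "(\<integral>\<^sup>+s. \<integral>\<^sup>+t. G s t x \<partial>lborel \<partial>lborel) =
          ennreal c * (ennreal ((x - a) * left_arm x (x - a)) * ennreal ((b - x) * right_arm x (b - x)))"
        using nn_integral_left_arm[OF x, of a] nn_integral_right_arm[OF x, of b] True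
        by (simp add: nn_integral_cmult nn_integral_multc)
      also have "\<dots> = ennreal (c * (((x - a) * left_arm x (x - a)) * ((b - x) * right_arm x (b - x))))"
        using c True by (simp add: ennreal_mult arm_nonneg)
      also have "c * (((x - a) * left_arm x (x - a)) * ((b - x) * right_arm x (b - x))) =
          2 * (x - a) * (b - x) * limit_density a b x"
        by (simp add: limit_density_def c_def)
      finally show ?thesis using True by simp
    next
      case False
      then have "G s t x = 0" for s t by (auto simp: G_def)
      then show ?thesis using False by (auto simp: indicator_def)
    qed
  qed
  finally show ?thesis .
qed

lemma lo_le_fst_iff: "lo z \<le> fst z \<longleftrightarrow> \<sigma> * snd z \<le> \<sigma> * \<phi> (fst z)"
  and fst_le_hi_iff: "fst z \<le> hi z \<longleftrightarrow> \<sigma> * snd z \<le> \<sigma> * \<phi> (fst z)"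
  by (simp_all add: lo_def hi_def up.h_inv_le_iff down.le_h_inv_iff)

text \<open>\<open>lo z \<le> fst z\<close> and \<open>fst z \<le> hi z\<close> amount to the same
  inequality, so \<open>lo z \<le> hi z\<close> only says on which side of the graph
  \<open>z\<close> lies.\<close>

lemma in_region_iff:
  "z \<in> region a b \<longleftrightarrow> a + \<sigma> * \<phi> a \<le> fst z + \<sigma> * snd z \<and>
    fst z - \<sigma> * snd z \<le> b - \<sigma> * \<phi> b \<and> \<sigma> * snd z \<le> \<sigma> * \<phi> (fst z)"
proof -
  have "lo z \<le> hi z \<longleftrightarrow> \<sigma> * snd z \<le> \<sigma> * \<phi> (fst z)"
    using lo_le_fst_iff[of z] fst_le_hi_iff[of z] by linarith
  moreover have "a \<le> lo z \<longleftrightarrow> a + \<sigma> * \<phi> a \<le> fst z + \<sigma> * snd z"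
    by (simp add: lo_def up.le_h_inv_iff)
  moreover have "hi z \<le> b \<longleftrightarrow> fst z - \<sigma> * snd z \<le> b - \<sigma> * \<phi> b"
    by (simp add: hi_def down.h_inv_le_iff)
  ultimately show ?thesis by (auto simp: region_def)
qed

lemma region_fst: "z \<in> region a b \<Longrightarrow> a \<le> fst z \<and> fst z \<le> b"
  using lo_le_fst_iff[of z] fst_le_hi_iff[of z] by (auto simp: region_def in_region_iff)

text \<open>The area will be a denominator. The strict inequalities define a nonempty open subset,
  which cannot be negligible.\<close>

lemma region_emeasure_pos:
  assumes "a < b"
  shows "emeasure lborel (region a b) \<noteq> 0"
proof
  assume 0: "emeasure lborel (region a b) = 0"
  define U where "U = {z. a < lo z} \<inter> {z. lo z < hi z} \<inter> {z. hi z < b}"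
  have "open U" unfolding U_def
    by (intro open_Int open_Collect_less lo_continuous hi_continuous continuous_on_const)
  moreover have "pt ((2 * a + b) / 3) ((a + 2 * b) / 3) \<in> U"
    using assms by (simp add: U_def)
  ultimately have "\<not> negligible U" by (intro open_not_negligible) auto
  moreover have "closed (region a b)" unfolding region_def
    by (intro closed_Collect_conj closed_Collect_le lo_continuous hi_continuous continuous_on_const)
  then have "region a b \<in> null_sets lborel" using 0 by (auto simp: null_sets_def)
  then have "negligible (region a b)"
    by (simp add: negligible_iff_null_sets null_sets_completionI)
  then have "negligible U"
    by (rule negligible_subset) (auto simp: U_def region_def)
  ultimately show False by simp
qed

end

section \<open>The transition measures\<close>

text \<open>At break points and end points the claimed formula is not controlled; being finitely
  many, they affect neither measurability nor the measure.\<close>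

lemma has_density_onI:
  fixes f h :: "real \<Rightarrow> real"
  assumes X: "finite X" and h[measurable]: "h \<in> borel_measurable borel"
    and eq: "\<And>x. x \<notin> X \<Longrightarrow> indicator A x * f x = h x"
    and \<nu>: "\<nu> = density lborel (\<lambda>x. ennreal (h x))"
  shows "has_density_on \<nu> A f"
  unfolding has_density_on_def
proof (intro conjI)
  have "(\<lambda>x. indicator A x *\<^sub>R f x) \<in> borel_measurable lborel"
    by (rule measurable_discrete_difference[where f = h and X = X]) (use X eq in \<open>auto intro: countable_finite\<close>)
  then show f: "set_borel_measurable lborel A f" by (simp add: set_borel_measurable_def)
  have ind: "ennreal (f x) * indicator A x = ennreal (indicator A x *\<^sub>R f x)" for x
    by (simp add: indicator_def)
  show "\<nu> = density lborel (\<lambda>x. ennreal (f x) * indicator A x)"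
    unfolding \<nu> ind
  proof (rule density_cong)
    show "AE x in lborel. ennreal (h x) = ennreal (indicator A x *\<^sub>R f x)"
      using AE_not_in[OF finite_imp_null_set_lborel[OF X]] by eventually_elim (simp add: eq)
  qed (use f in \<open>auto simp: set_borel_measurable_def\<close>)
  show "absolutely_continuous lborel \<nu>"
    unfolding \<nu> by (intro absolutely_continuousI_density) auto
qed

text \<open>Extension by constants gives slope 0 outside \<open>[a, b]\<close>, so that the bounds
  hold on the whole line at the price of possible breaks at \<open>a\<close> and
  \<open>b\<close>.\<close>

definition clamped :: "real \<Rightarrow> real \<Rightarrow> (real \<Rightarrow> real) \<Rightarrow> real \<Rightarrow> real" where
  "clamped a b \<omega> x = \<omega> (max a (min x b))"

definition slope :: "real \<Rightarrow> real \<Rightarrow> real set \<Rightarrow> (real \<Rightarrow> real) \<Rightarrow> real \<Rightarrow> real" where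
  "slope a b S \<omega> x = (if x \<in> {a<..<b} - S then deriv \<omega> x else 0)"

lemma clamped_eq: "a \<le> x \<Longrightarrow> x \<le> b \<Longrightarrow> clamped a b \<omega> x = \<omega> x"
  by (simp add: clamped_def min_absorb1 max_absorb2)

lemma smooth_diagram_profile:
  assumes ab: "a < b" and \<omega>: "\<omega> \<in> smooth_diagrams a b"
  obtains S \<delta> L where "finite S" "a \<in> S" "b \<in> S"
    "\<And>\<sigma>. \<sigma> = 1 \<or> \<sigma> = -1 \<Longrightarrow> profile (clamped a b \<omega>) (slope a b S \<omega>) S \<delta> L \<sigma>"
proof -
  from \<omega> obtain S0 c1 c2 where S0: "finite S0"
      "\<And>x. x \<in> {a<..<b} - S0 \<Longrightarrow> \<omega> differentiable (at x) \<and> deriv \<omega> differentiable (at x)"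
      "bounded (deriv (deriv \<omega>) ` ({a<..<b} - S0))"
    and c: "-1 < c1" "c1 < c2" "c2 < 1"
      "\<And>x. x \<in> {a<..<b} \<Longrightarrow> \<omega> differentiable (at x) \<Longrightarrow> c1 < deriv \<omega> x \<and> deriv \<omega> x < c2"
    and diag: "\<omega> \<in> diagrams a b"
    unfolding smooth_diagrams_def by blast
  from S0(3) obtain B where "\<forall>y\<in>deriv (deriv \<omega>) ` ({a<..<b} - S0). norm y \<le> B"
    unfolding bounded_iff by blast
  then have B: "\<bar>deriv (deriv \<omega>) x\<bar> \<le> B" if "x \<in> {a<..<b} - S0" for x
    using that by auto
  define S where "S = insert a (insert b S0)"
  \<comment> \<open>\<open>max B 0\<close> makes \<open>L\<close> nonnegative without exhibiting a
    point at which \<open>B\<close> bounds an absolute value.\<close>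
  define L where "L = max B 0 / 2"
  define \<delta> where "\<delta> = (1 - max \<bar>c1\<bar> \<bar>c2\<bar>) / 2"
  have \<delta>: "0 < \<delta>" "1 - 2 * \<delta> = max \<bar>c1\<bar> \<bar>c2\<bar>"
    using c by (auto simp: \<delta>_def field_simps)
  have cont: "continuous_on UNIV (clamped a b \<omega>)"
    unfolding clamped_def[abs_def]
    by (rule continuous_on_compose2[OF diagrams_continuous_on[OF diag]])
       (use ab in \<open>auto intro!: continuous_intros\<close>)
  have deriv: "(clamped a b \<omega> has_real_derivative slope a b S \<omega> x) (at x)" if x: "x \<notin> S" for x
  proof -
    consider "x < a" | "b < x" | "x \<in> {a<..<b}" using x by (auto simp: S_def) linarith
    then show ?thesis
    proof cases
      case 1
      have "(clamped a b \<omega> has_real_derivative 0) (at x)"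
        by (rule has_field_derivative_transform_within_open[where f = "\<lambda>_. \<omega> a" and S = "{..<a}"])
           (use 1 ab in \<open>auto simp: clamped_def max_def min_def\<close>)
      then show ?thesis using 1 by (simp add: slope_def)
    next
      case 2
      have "(clamped a b \<omega> has_real_derivative 0) (at x)"
        by (rule has_field_derivative_transform_within_open[where f = "\<lambda>_. \<omega> b" and S = "{b<..}"])
           (use 2 ab in \<open>auto simp: clamped_def max_def min_def\<close>)
      then show ?thesis using 2 by (simp add: slope_def)
    next
      case 3
      then have "(\<omega> has_real_derivative deriv \<omega> x) (at x)"
        using S0(2)[of x] x by (auto simp: S_def DERIV_deriv_iff_real_differentiable)
      then have "(clamped a b \<omega> has_real_derivative deriv \<omega> x) (at x)"
        by (rule has_field_derivative_transform_within_open[where S = "{a<..<b}"])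
           (use 3 in \<open>auto simp: clamped_eq\<close>)
      then show ?thesis using 3 x by (simp add: slope_def)
    qed
  qed
  have bound: "\<bar>slope a b S \<omega> x\<bar> \<le> 1 - 2 * \<delta>" for x
  proof (cases "x \<in> {a<..<b} - S")
    case True
    then have "c1 < deriv \<omega> x \<and> deriv \<omega> x < c2"
      using S0(2)[of x] c(4)[of x] by (auto simp: S_def)
    then show ?thesis using True by (auto simp: slope_def \<delta>(2) max_def)
  qed (auto simp: slope_def \<delta>(2))
  have Lip: "\<bar>slope a b S \<omega> y - slope a b S \<omega> x\<bar> \<le> 2 * L * (y - x)"
    if xy: "x \<le> y" "{x..y} \<inter> S = {}" for x y
  proof (cases "x \<in> {a<..<b} \<and> x < y")
    case True
    have notin: "a \<notin> {x..y}" "b \<notin> {x..y}" using xy(2) by (auto simp: S_def)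
    have sub: "{x..y} \<subseteq> {a<..<b} - S0" using True notin xy by (auto simp: S_def)
    obtain z where z: "x < z" "z < y" "deriv \<omega> y - deriv \<omega> x = (y - x) * deriv (deriv \<omega>) z"
      using MVT2[of x y "deriv \<omega>" "deriv (deriv \<omega>)"] True sub S0(2)
      by (auto simp: DERIV_deriv_iff_real_differentiable subset_iff)
    have "\<bar>deriv (deriv \<omega>) z\<bar> \<le> 2 * L"
      using B[of z] z sub by (auto simp: L_def subset_iff)
    then have "(y - x) * \<bar>deriv (deriv \<omega>) z\<bar> \<le> (y - x) * (2 * L)"
      using True by (intro mult_left_mono) auto
    then have "\<bar>deriv \<omega> y - deriv \<omega> x\<bar> \<le> 2 * L * (y - x)"
      unfolding z(3) using True by (simp add: abs_mult mult_ac)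
    moreover have "x \<in> {a<..<b} - S" "y \<in> {a<..<b} - S"
    proof -
      have "x \<in> {x..y}" "y \<in> {x..y}" using xy(1) by auto
      then show "x \<in> {a<..<b} - S" "y \<in> {a<..<b} - S" using sub xy(2) by blast+
    qed
    ultimately show ?thesis by (simp add: slope_def)
  next
    case False
    have notin: "a \<notin> {x..y}" "b \<notin> {x..y}" using xy(2) by (auto simp: S_def)
    \<comment> \<open>An interval that starts outside \<open>(a, b)\<close> and avoids both end
      points stays outside, where the slope is 0.\<close>
    then have "slope a b S \<omega> y = slope a b S \<omega> x"
      using False xy(1) by (cases "x = y") (auto simp: slope_def)
    then show ?thesis using xy(1) by (simp add: L_def)
  qed
  show ?thesis
  proof (rule that[of S \<delta> L])
    fix \<sigma> :: real assume "\<sigma> = 1 \<or> \<sigma> = -1"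
    then show "profile (clamped a b \<omega>) (slope a b S \<omega>) S \<delta> L \<sigma>"
      by unfold_locales (use S0(1) \<delta>(1) cont deriv bound Lip in \<open>auto simp: S_def L_def\<close>)
  qed (use S0(1) in \<open>auto simp: S_def\<close>)
qed

text \<open>\<open>c\<close> will be \<open>1 / 2\<close> or \<open>- (1 / 2)\<close>, the factor
  between slope and \<open>p\<close>. On \<open>[a, b]\<close> the function \<open>slope\<close>
  differs from \<open>deriv \<omega>\<close> in finitely many points at most.\<close>

lemma slope_integral_eq:
  assumes "finite S" "x \<in> {a<..<b} - S"
  shows "(LBINT u:{a..b}. (c * slope a b S \<omega> u - c * slope a b S \<omega> x) / (u - x)) =
    c * (LBINT u:{a..b}. (deriv \<omega> u - deriv \<omega> x) / (u - x))"
proof -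
  have "(LBINT u:{a..b}. (c * slope a b S \<omega> u - c * slope a b S \<omega> x) / (u - x)) =
      (LBINT u:{a..b}. c * ((deriv \<omega> u - deriv \<omega> x) / (u - x)))"
    unfolding set_lebesgue_integral_def
    by (rule integral_discrete_difference[where X = "insert a (insert b S)"])
       (use assms in \<open>auto simp: slope_def indicator_def right_diff_distrib countable_finite\<close>)
  then show ?thesis by (simp only: set_integral_mult_right)
qed

section \<open>The exterior and the interior walk\<close>

lemma smooth_diagramsD: "\<omega> \<in> smooth_diagrams a b \<Longrightarrow> \<omega> \<in> diagrams a b"
  by (simp add: smooth_diagrams_def)

text \<open>Here \<open>\<sigma> = -1\<close>, so \<open>p = (1 + \<omega>') / 2\<close>. The
  starting corner is \<open>pt a b\<close>, the whole interval, so \<open>limit_density a b\<close>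
  is itself the density of the limit.\<close>

lemma exterior_transition_density:
  assumes ab: "a < b" and \<omega>: "\<omega> \<in> smooth_diagrams a b"
  shows "has_density_on (exterior_transition_measure a b \<omega>) {a..b}
       (\<lambda>x. 1 / pi * cos (pi * deriv \<omega> x / 2)
          * (x - a) powr (- (1 + deriv \<omega> x) / 2)
          * (b - x) powr (- (1 - deriv \<omega> x) / 2)
          * exp (1 / 2 * (LBINT u:{a..b}. (deriv \<omega> u - deriv \<omega> x) / (u - x))))"
proof -
  have center: "a + \<omega> a = b - \<omega> b" and diag: "\<omega> \<in> diagrams a b"
    using smooth_diagramsD[OF \<omega>] by (auto simp: diagrams_def)
  obtain S \<delta> L where S: "finite S" "a \<in> S" "b \<in> S"
    and prof: "\<And>\<sigma>. \<sigma> = 1 \<or> \<sigma> = -1 \<Longrightarrow> profile (clamped a b \<omega>) (slope a b S \<omega>) S \<delta> L \<sigma>"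
    using smooth_diagram_profile[OF ab \<omega>] by metis
  interpret E: profile "clamped a b \<omega>" "slope a b S \<omega>" S \<delta> L "-1" by (rule prof) simp
  have region: "E.region a b = dual_domain a b \<omega>"
  proof (rule set_eqI)
    fix z :: "real \<times> real"
    show "z \<in> E.region a b \<longleftrightarrow> z \<in> dual_domain a b \<omega>"
      using E.region_fst[of z a b] E.in_region_iff[of z a b] ab
      by (cases z) (auto simp: dual_domain_def clamped_eq)
  qed
  have start: "E.pt a b = (b - \<omega> a, \<omega> a + \<omega> b)"
    using center ab by (simp add: E.pt_def clamped_eq field_simps)
  have step: "exterior_step a b \<omega> = (\<lambda>z. uniform_on_hook (-1) z (exterior_hook a b \<omega> z))"
    by (simp add: fun_eq_iff exterior_step_def)
  interpret E: hook_chain "clamped a b \<omega>" "slope a b S \<omega>" S \<delta> L "-1"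
    "return borel (b - \<omega> a, \<omega> a + \<omega> b)" "exterior_hook a b \<omega>" a b
  proof
    show "AE z in return borel (b - \<omega> a, \<omega> a + \<omega> b). z \<in> E.region a b"
      unfolding region using start ab dual_domain_closed[OF diag]
      by (subst AE_return) (auto simp: region[symmetric] E.region_def start[symmetric])
    show "(\<lambda>z. uniform_on_hook (-1) z (exterior_hook a b \<omega> z)) \<in> borel \<rightarrow>\<^sub>M prob_algebra borel"
      using exterior_step_measurable[OF diag] by (simp add: step)
  qed (auto simp: space_prob_algebra prob_space_return region hook_arc_in_exterior_hook_iff)
  define h where "h x = indicator {a<..<b} x * E.limit_density a b x" for x
  have h[measurable]: "h \<in> borel_measurable borel" unfolding h_def by measurable
  define \<nu> where "\<nu> = density lborel (\<lambda>x. ennreal (h x))"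
  have "distr E.law borel (\<lambda>X. fst (lim X)) = \<nu>"
  proof (rule E.hook_walk_limit_distribution)
    fix A :: "real set" assume A[measurable]: "A \<in> sets borel"
    have "emeasure \<nu> A = (\<integral>\<^sup>+x. ennreal (h x) * indicator A x \<partial>lborel)"
      unfolding \<nu>_def by (rule emeasure_density) auto
    also have "\<dots> = E.limit_mass A a b"
      unfolding E.limit_mass_def by (intro nn_integral_cong) (simp add: h_def indicator_def)
    also have "\<dots> = (\<integral>\<^sup>+z. E.harmonic_mass A z \<partial>return borel (b - \<omega> a, \<omega> a + \<omega> b))"
      using ab by (simp add: nn_integral_return start[symmetric] E.harmonic_mass_def)
    finally show "(\<integral>\<^sup>+z. E.harmonic_mass A z \<partial>return borel (b - \<omega> a, \<omega> a + \<omega> b)) = emeasure \<nu> A" ..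
  qed (simp add: \<nu>_def)
  then have \<nu>: "exterior_transition_measure a b \<omega> = \<nu>"
    by (simp add: exterior_transition_measure_def exterior_walk_def step)
  show ?thesis
  proof (rule has_density_onI[OF S(1) h _ \<nu>[unfolded \<nu>_def]])
    fix x assume x: "x \<notin> S"
    show "indicator {a..b} x * (1 / pi * cos (pi * deriv \<omega> x / 2)
          * (x - a) powr (- (1 + deriv \<omega> x) / 2)
          * (b - x) powr (- (1 - deriv \<omega> x) / 2)
          * exp (1 / 2 * (LBINT u:{a..b}. (deriv \<omega> u - deriv \<omega> x) / (u - x)))) = h x"
    proof (cases "x \<in> {a<..<b}")
      case True
      have p: "E.p u = 1 / 2 + 1 / 2 * slope a b S \<omega> u" for u by (simp add: E.p_def field_simps)
      have px: "E.p x = (1 + deriv \<omega> x) / 2" using True x by (simp add: E.p_def slope_def)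
      have int: "(LBINT u:{a..b}. (E.p u - E.p x) / (u - x)) =
          1 / 2 * (LBINT u:{a..b}. (deriv \<omega> u - deriv \<omega> x) / (u - x))"
        using slope_integral_eq[OF S(1), of x a b "1 / 2" \<omega>] True x by (simp only: p) simp
      have "sin (pi * E.p x) = sin (pi / 2 + pi * deriv \<omega> x / 2)"
        by (rule arg_cong[where f = sin]) (simp add: px field_simps)
      then have sin: "sin (pi * E.p x) = cos (pi * deriv \<omega> x / 2)" by (simp add: sin_add)
      have e: "- E.p x = - (1 + deriv \<omega> x) / 2" "E.p x - 1 = - (1 - deriv \<omega> x) / 2"
        by (simp_all add: px field_simps)
      show ?thesis
        using True E.limit_density_eq[OF x, of a b] unfolding h_def sin int e by simp
    next
      case False
      \<comment> \<open>The end points belong to \<open>S\<close>, so \<open>x\<close> outside the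
        open interval is outside the closed one.\<close>
      then have "x \<notin> {a..b}" using x S by auto
      then show ?thesis using False by (simp add: h_def)
    qed
  qed
qed

lemma diagram_area_eq:
  assumes "a < b" "\<omega> \<in> diagrams a b"
  shows "0 \<le> diagram_area a b \<omega>"
    and "emeasure lborel (diagram_domain a b \<omega>) = ennreal (diagram_area a b \<omega>)"
proof -
  define c where "c = diagram_center a \<omega>"
  have c: "c = a + \<omega> a" "c = b - \<omega> b" and lip: "1-lipschitz_on {a..b} \<omega>"
    using assms by (auto simp: c_def diagram_center_def diagrams_def)
  \<comment> \<open>The Lipschitz bound from \<open>a\<close>, where
    \<open>\<omega> a = c - a\<close>, gives \<open>c - x \<le> \<omega> x\<close>; the one from
    \<open>b\<close> gives \<open>x - c \<le> \<omega> x\<close>.\<close>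
  have nonneg: "\<bar>x - c\<bar> \<le> \<omega> x" if "x \<in> {a..b}" for x
    using lipschitz_onD[OF lip that, of a] lipschitz_onD[OF lip that, of b] that assms(1) c
    by (auto simp: dist_real_def abs_le_iff)
  have "continuous_on {a..b} (\<lambda>x. \<omega> x - \<bar>x - c\<bar>)"
    by (intro continuous_intros diagrams_continuous_on assms)
  then have int: "integrable lborel (\<lambda>x. indicator {a..b} x *\<^sub>R (\<omega> x - \<bar>x - c\<bar>))"
    by (rule borel_integrable_compact[OF compact_Icc])
  have nn: "0 \<le> indicator {a..b} x *\<^sub>R (\<omega> x - \<bar>x - c\<bar>)" for x
    using nonneg[of x] by (simp add: indicator_def)
  show "0 \<le> diagram_area a b \<omega>"
    unfolding diagram_area_def set_lebesgue_integral_def c_def[symmetric]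
    by (rule Bochner_Integration.integral_nonneg) (rule nn)
  have D: "diagram_domain a b \<omega> \<in> sets (lborel \<Otimes>\<^sub>M lborel)"
    unfolding lborel_prod sets_lborel by (rule borel_closed[OF diagram_domain_closed[OF assms(2)]])
  have "emeasure lborel (diagram_domain a b \<omega>) = emeasure (lborel \<Otimes>\<^sub>M lborel) (diagram_domain a b \<omega>)"
    by (simp add: lborel_prod)
  also have "\<dots> = (\<integral>\<^sup>+x. emeasure lborel (Pair x -` diagram_domain a b \<omega>) \<partial>lborel)"
    by (rule lborel.emeasure_pair_measure_alt[OF D])
  also have "\<dots> = (\<integral>\<^sup>+x. ennreal (indicator {a..b} x *\<^sub>R (\<omega> x - \<bar>x - c\<bar>)) \<partial>lborel)"
  proof (intro nn_integral_cong)
    fix x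
    have "Pair x -` diagram_domain a b \<omega> = (if x \<in> {a..b} then {\<bar>x - c\<bar>..\<omega> x} else {})"
      by (auto simp: diagram_domain_def c_def)
    then show "emeasure lborel (Pair x -` diagram_domain a b \<omega>) = ennreal (indicator {a..b} x *\<^sub>R (\<omega> x - \<bar>x - c\<bar>))"
      using nonneg[of x] by (simp add: emeasure_lborel_Icc_eq)
  qed
  also have "\<dots> = ennreal (diagram_area a b \<omega>)"
    unfolding diagram_area_def set_lebesgue_integral_def c_def[symmetric]
    by (rule nn_integral_eq_integral[OF int]) (intro AE_I2 nn)
  finally show "emeasure lborel (diagram_domain a b \<omega>) = ennreal (diagram_area a b \<omega>)" .
qed

text \<open>Here \<open>\<sigma> = 1\<close>, so \<open>p = (1 - \<omega>') / 2\<close> and the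
  exponential changes its sign. The uniform start contributes \<open>2 * (x - a) * (b - x)\<close>
  divided by the area.\<close>

lemma interior_transition_density:
  assumes ab: "a < b" and \<omega>: "\<omega> \<in> smooth_diagrams a b"
  shows "has_density_on (interior_transition_measure a b \<omega>) {a..b}
       (\<lambda>x. 2 / (pi * diagram_area a b \<omega>) * cos (pi * deriv \<omega> x / 2)
          * (x - a) powr ((1 + deriv \<omega> x) / 2)
          * (b - x) powr ((1 - deriv \<omega> x) / 2)
          * exp (- (1 / 2) * (LBINT u:{a..b}. (deriv \<omega> u - deriv \<omega> x) / (u - x))))"
proof -
  have center: "a + \<omega> a = b - \<omega> b" and diag: "\<omega> \<in> diagrams a b"
    using smooth_diagramsD[OF \<omega>] by (auto simp: diagrams_def)
  define Ar where "Ar = diagram_area a b \<omega>"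
  obtain S \<delta> L where S: "finite S" "a \<in> S" "b \<in> S"
    and prof: "\<And>\<sigma>. \<sigma> = 1 \<or> \<sigma> = -1 \<Longrightarrow> profile (clamped a b \<omega>) (slope a b S \<omega>) S \<delta> L \<sigma>"
    using smooth_diagram_profile[OF ab \<omega>] by metis
  interpret I: profile "clamped a b \<omega>" "slope a b S \<omega>" S \<delta> L 1 by (rule prof) simp
  have region: "I.region a b = diagram_domain a b \<omega>"
  proof (rule set_eqI)
    fix z :: "real \<times> real"
    show "z \<in> I.region a b \<longleftrightarrow> z \<in> diagram_domain a b \<omega>"
      using I.region_fst[of z a b] I.in_region_iff[of z a b] ab center
      by (cases z) (auto simp: diagram_domain_def diagram_center_def clamped_eq abs_le_iff)
  qed
  have emD: "emeasure lborel (diagram_domain a b \<omega>) = ennreal Ar" "0 \<le> Ar"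
    unfolding Ar_def by (rule diagram_area_eq[OF ab diag])+
  have Ar: "0 < Ar"
    using I.region_emeasure_pos[OF ab] emD unfolding region by (cases "Ar = 0") auto
  have D: "diagram_domain a b \<omega> \<in> sets borel"
    using diagram_domain_closed[OF diag] by simp
  have step: "interior_step a b \<omega> = (\<lambda>z. uniform_on_hook 1 z (interior_hook a b \<omega> z))"
    by (simp add: fun_eq_iff interior_step_def)
  interpret I: hook_chain "clamped a b \<omega>" "slope a b S \<omega>" S \<delta> L 1
    "uniform_measure lborel (diagram_domain a b \<omega>)" "interior_hook a b \<omega>" a b
  proof
    show "uniform_measure lborel (diagram_domain a b \<omega>) \<in> space (prob_algebra borel)"
      using Ar by (auto simp: space_prob_algebra emD intro!: prob_space_uniform_measure)
    show "AE z in uniform_measure lborel (diagram_domain a b \<omega>). z \<in> I.region a b"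
      unfolding region using D by (intro AE_uniform_measureI) auto
    show "(\<lambda>z. uniform_on_hook 1 z (interior_hook a b \<omega> z)) \<in> borel \<rightarrow>\<^sub>M prob_algebra borel"
      using interior_step_measurable[OF diag] by (simp add: step)
  qed (auto simp: region hook_arc_in_interior_hook_iff)
  define h where "h x = indicator {a<..<b} x * (2 / Ar * (x - a) * (b - x) * I.limit_density a b x)" for x
  have h[measurable]: "h \<in> borel_measurable borel" unfolding h_def by measurable
  define \<nu> where "\<nu> = density lborel (\<lambda>x. ennreal (h x))"
  have "distr I.law borel (\<lambda>X. fst (lim X)) = \<nu>"
  proof (rule I.hook_walk_limit_distribution)
    fix A :: "real set" assume A[measurable]: "A \<in> sets borel"
    have "(\<integral>\<^sup>+z. I.harmonic_mass A z \<partial>uniform_measure lborel (diagram_domain a b \<omega>)) =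
        (\<integral>\<^sup>+x. ennreal (2 * (x - a) * (b - x) * I.limit_density a b x) * indicator (A \<inter> {a<..<b}) x \<partial>lborel) / ennreal Ar"
      using D I.nn_integral_harmonic_mass_region[OF A, of a b]
      by (subst nn_integral_uniform_measure) (auto simp: emD region)
    also have "\<dots> = (\<integral>\<^sup>+x. ennreal (2 * (x - a) * (b - x) * I.limit_density a b x) * indicator (A \<inter> {a<..<b}) x / ennreal Ar \<partial>lborel)"
      by (rule nn_integral_divide[symmetric]) measurable
    also have "\<dots> = (\<integral>\<^sup>+x. ennreal (h x) * indicator A x \<partial>lborel)"
      using Ar
      by (intro nn_integral_cong) (simp add: h_def indicator_def divide_ennreal I.limit_density_nonneg)
    also have "\<dots> = emeasure \<nu> A"
      unfolding \<nu>_def by (rule emeasure_density[symmetric]) auto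
    finally show "(\<integral>\<^sup>+z. I.harmonic_mass A z \<partial>uniform_measure lborel (diagram_domain a b \<omega>)) = emeasure \<nu> A" .
  qed (simp add: \<nu>_def)
  then have \<nu>: "interior_transition_measure a b \<omega> = \<nu>"
    by (simp add: interior_transition_measure_def interior_walk_def step)
  show ?thesis
  proof (rule has_density_onI[OF S(1) h _ \<nu>[unfolded \<nu>_def]])
    fix x assume x: "x \<notin> S"
    show "indicator {a..b} x * (2 / (pi * diagram_area a b \<omega>) * cos (pi * deriv \<omega> x / 2)
          * (x - a) powr ((1 + deriv \<omega> x) / 2)
          * (b - x) powr ((1 - deriv \<omega> x) / 2)
          * exp (- (1 / 2) * (LBINT u:{a..b}. (deriv \<omega> u - deriv \<omega> x) / (u - x)))) = h x"
    proof (cases "x \<in> {a<..<b}")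
      case True
      then have xab: "a < x" "x < b" by auto
      have alg: "2 / (pi * A) * C * (X * P) * (Y * Q) * E = 2 / A * X * Y * (C / pi * P * Q * E)"
        for A C X P Y Q E :: real by (simp add: mult_ac)
      have p: "I.p u = 1 / 2 + (- (1 / 2)) * slope a b S \<omega> u" for u by (simp add: I.p_def field_simps)
      have px: "I.p x = (1 - deriv \<omega> x) / 2" using True x by (simp add: I.p_def slope_def)
      have int: "(LBINT u:{a..b}. (I.p u - I.p x) / (u - x)) =
          - (1 / 2) * (LBINT u:{a..b}. (deriv \<omega> u - deriv \<omega> x) / (u - x))"
        using slope_integral_eq[OF S(1), of x a b "- (1 / 2)" \<omega>] True x by (simp only: p) simp
      have "sin (pi * I.p x) = sin (pi / 2 - pi * deriv \<omega> x / 2)"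
        by (rule arg_cong[where f = sin]) (simp add: px field_simps)
      then have sin: "sin (pi * I.p x) = cos (pi * deriv \<omega> x / 2)" by (simp add: sin_diff)
      \<comment> \<open>The factors \<open>x - a\<close> and \<open>b - x\<close> raise the two
        exponents of the harmonic density by 1.\<close>
      have pow: "(x - a) powr ((1 + deriv \<omega> x) / 2) = (x - a) * (x - a) powr (- I.p x)"
        "(b - x) powr ((1 - deriv \<omega> x) / 2) = (b - x) * (b - x) powr (I.p x - 1)"
      proof -
        have "(1 + deriv \<omega> x) / 2 = 1 + (- I.p x)" "(1 - deriv \<omega> x) / 2 = 1 + (I.p x - 1)"
          by (simp_all add: px field_simps)
        then show "(x - a) powr ((1 + deriv \<omega> x) / 2) = (x - a) * (x - a) powr (- I.p x)"
          "(b - x) powr ((1 - deriv \<omega> x) / 2) = (b - x) * (b - x) powr (I.p x - 1)"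
          using True by (simp_all only: powr_add) simp_all
      qed
      show ?thesis
        using True unfolding h_def sin int pow Ar_def[symmetric] I.limit_density_eq[OF x xab]
        by (simp only: alg) simp
    next
      case False
      then have "x \<notin> {a..b}" using x S by auto
      then show ?thesis using False by (simp add: h_def)
    qed
  qed
qed

theorem theorem1:
  fixes a b :: real and \<omega> :: "real \<Rightarrow> real"
  assumes "a < b" and "\<omega> \<in> smooth_diagrams a b"
  shows
    "has_density_on (exterior_transition_measure a b \<omega>) {a..b}
       (\<lambda>x. 1 / pi * cos (pi * deriv \<omega> x / 2)
          * (x - a) powr (- (1 + deriv \<omega> x) / 2)
          * (b - x) powr (- (1 - deriv \<omega> x) / 2)
          * exp (1 / 2 * (LBINT u:{a..b}. (deriv \<omega> u - deriv \<omega> x) / (u - x))))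
     \<and>
     has_density_on (interior_transition_measure a b \<omega>) {a..b}
       (\<lambda>x. 2 / (pi * diagram_area a b \<omega>) * cos (pi * deriv \<omega> x / 2)
          * (x - a) powr ((1 + deriv \<omega> x) / 2)
          * (b - x) powr ((1 - deriv \<omega> x) / 2)
          * exp (- (1 / 2) * (LBINT u:{a..b}. (deriv \<omega> u - deriv \<omega> x) / (u - x))))"
  using exterior_transition_density[OF assms] interior_transition_density[OF assms] by blast

end
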